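(* Let $n\ge 1$, let $\mathbb{B}_n$ be the open unit ball of $\mathbb{C}^n$, and let $\mu$ be a non-negative Borel measure on $\mathbb{B}_n$. Suppose that $$ \sup_{\lambda\in\operatorname{supp}\mu}\int_{\mathbb{B}_n}|k_\lambda(z)|^2\,d\mu(z)=C<\infty, $$ where $k_\lambda$, $\lambda\in\mathbb{B}_n$, is the normalized reproducing kernel of $H^2(\mathbb{B}_n)$. Then $$ \int_{\mathbb{B}_n}|f(z)|^2\,d\mu(z)\le e\,\frac{(2n)!}{(n!)^2}\,C\,\|f\|_{H^2(\mathbb{B}_n)}^2\qquad\text{for all } f\in H^2(\mathbb{B}_n). $$
   Context: The Hardy space $H^2(\mathbb{B}_n)$ is the closure of the holomorphic polynomials in $L^2(\mathbb{S},\sigma)$, where $\sigma$ is Lebesgue (surface) measure on $\mathbb{S}=\partial\mathbb{B}_n$, normalized by $\sigma(\mathbb{S})=1$, with the norm inherited from $L^2(\mathbb{S},\sigma)$. Each $f\in H^2(\mathbb{B}_n)$ is identified with its holomorphic extension to $\mathbb{B}_n$. With this normalization the normalized reproducing kernel is $$k_\lambda(z)=\frac{(1-|\lambda|^2)^{n/2}}{(1-\langle z,\lambda\rangle)^n},$$ where $\langle z,\lambda\rangle=\sum_j z_j\overline{\lambda_j}$ is the standard Hermitian inner product on $\mathbb{C}^n$. The support $\operatorname{supp}\mu$ is the closed support of $\mu$ in $\mathbb{B}_n$. *)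

theory Defs
  imports "HOL-Analysis.Analysis" "HOL-Probability.Probability"
begin

definition herm :: "complex ^ 'n::finite \<Rightarrow> complex ^ 'n \<Rightarrow> complex" where
  "herm z w = (\<Sum>i\<in>UNIV. z $ i * cnj (w $ i))"

(* Normalized surface measure on the unit sphere S of C^n, given by polar coordinates:
   sigma(A) is the proportion of the volume of the unit ball taken up by the cone
   {t x | x in A, 0 < t < 1}; here sgn x = x / |x|, and the origin is a null set. *)
definition sphere_measure :: "(complex ^ 'n::finite) measure" where
  "sphere_measure =
     restrict_space (distr (uniform_measure lborel (ball 0 1)) borel sgn) (sphere 0 1)"

lemma space_sphere_measure [simp]: "space sphere_measure = sphere 0 1"
  by (simp add: sphere_measure_def space_restrict_space)

lemma sets_sphere_measure [simp, measurable_cong]: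
  "sets sphere_measure = sets (restrict_space borel (sphere 0 1))"
  by (simp add: sphere_measure_def sets_restrict_space)

lemma emeasure_sphere_measure:
  fixes A :: "(complex ^ 'n::finite) set"
  assumes "A \<in> sets borel" "A \<subseteq> sphere 0 1"
  shows "emeasure sphere_measure A =
    emeasure lborel {x \<in> ball 0 1. sgn x \<in> A} / emeasure lborel (ball (0 :: complex ^ 'n) 1)"
proof -
  have sgn_meas [measurable]: "sgn \<in> borel_measurable (borel :: (complex ^ 'n) measure)"
    unfolding sgn_div_norm by measurable
  have "emeasure sphere_measure A =
      emeasure (distr (uniform_measure lborel (ball 0 1)) borel sgn) A"
    unfolding sphere_measure_def using assms by (intro emeasure_restrict_space) auto
  also have "\<dots> = emeasure (uniform_measure lborel (ball 0 1)) (sgn -` A)"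
    using assms by (subst emeasure_distr) auto
  also have "\<dots> = emeasure lborel (ball 0 1 \<inter> sgn -` A) / emeasure lborel (ball (0 :: complex ^ 'n) 1)"
    using measurable_sets[OF sgn_meas assms(1)] by (intro emeasure_uniform_measure) auto
  also have "ball 0 1 \<inter> sgn -` A = {x \<in> ball 0 1. sgn x \<in> A}"
    by auto
  finally show ?thesis .
qed

lemma prob_space_sphere_measure: "prob_space (sphere_measure :: (complex ^ 'n::finite) measure)"
proof (rule prob_spaceI)
  let ?B = "ball 0 1 :: (complex ^ 'n) set"
  have pos: "emeasure lborel ?B \<noteq> 0"
    by (simp add: emeasure_ball less_imp_neq[OF unit_ball_vol_pos, symmetric])
  have fin: "emeasure lborel ?B \<noteq> \<infinity>"
    using emeasure_lborel_ball_finite[of "0 :: complex ^ 'n" 1] by auto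
  have "{x \<in> ?B. sgn x \<in> sphere 0 1} = ?B - {0}"
    by (auto simp: norm_sgn)
  moreover have "emeasure lborel (?B - {0}) = emeasure lborel ?B"
    by (subst emeasure_Diff_null_set) (auto intro: null_setsI)
  ultimately show "emeasure sphere_measure (space (sphere_measure :: (complex ^ 'n) measure)) = 1"
    using pos fin by (simp add: emeasure_sphere_measure ennreal_divide_self less_top)
qed

definition holomorphic_polynomials :: "(complex ^ 'n::finite \<Rightarrow> complex) set" where
  "holomorphic_polynomials =
     {p. \<exists>(A :: ('n \<Rightarrow> nat) set) c. finite A \<and>
          p = (\<lambda>z. \<Sum>\<alpha>\<in>A. c \<alpha> * (\<Prod>i\<in>UNIV. (z $ i) ^ \<alpha> i))}"

definition L2_sphere :: "(complex ^ 'n::finite \<Rightarrow> complex) set" where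
  "L2_sphere = {g \<in> borel_measurable sphere_measure.
                  integrable sphere_measure (\<lambda>\<zeta>. (cmod (g \<zeta>))\<^sup>2)}"

definition L2_sphere_norm :: "(complex ^ 'n::finite \<Rightarrow> complex) \<Rightarrow> real" where
  "L2_sphere_norm g = sqrt (LINT \<zeta>|sphere_measure. (cmod (g \<zeta>))\<^sup>2)"

(* Elements are represented by boundary functions on the sphere, not by their almost-everywhere
   classes; values off the sphere are irrelevant. *)
definition hardy_space :: "(complex ^ 'n::finite \<Rightarrow> complex) set" where
  "hardy_space = {g \<in> L2_sphere. \<forall>\<epsilon>>0. \<exists>p\<in>holomorphic_polynomials.
                    L2_sphere_norm (\<lambda>\<zeta>. p \<zeta> - g \<zeta>) < \<epsilon>}"

(* f is, on the open unit ball, the holomorphic extension of the boundary function g: the locally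
   uniform limit of holomorphic polynomials that converge to g in L^2 of the sphere. Since
   evaluation at points of the ball is bounded on polynomials in the L^2 norm, locally uniformly
   in the point, every g in hardy_space has such an f, and f is determined by g on the ball. *)
definition is_hardy_extension ::
  "(complex ^ 'n::finite \<Rightarrow> complex) \<Rightarrow> (complex ^ 'n \<Rightarrow> complex) \<Rightarrow> bool" where
  "is_hardy_extension g f \<longleftrightarrow>
     (\<exists>p :: nat \<Rightarrow> complex ^ 'n \<Rightarrow> complex.
        (\<forall>k. p k \<in> holomorphic_polynomials) \<and>
        (\<lambda>k. L2_sphere_norm (\<lambda>\<zeta>. p k \<zeta> - g \<zeta>)) \<longlonglongrightarrow> 0 \<and>
        (\<forall>K. compact K \<and> K \<subseteq> ball 0 1 \<longrightarrow> uniform_limit K p f sequentially))"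

definition hardy_kernel :: "complex ^ 'n::finite \<Rightarrow> complex ^ 'n \<Rightarrow> complex" where
  "hardy_kernel w z =
     of_real ((1 - (norm w)\<^sup>2) powr (real CARD('n) / 2)) / (1 - herm z w) ^ CARD('n)"

definition closed_support :: "'a::topological_space measure \<Rightarrow> 'a set" where
  "closed_support M =
     {x \<in> space M. \<forall>U. open U \<and> x \<in> U \<longrightarrow> emeasure M (U \<inter> space M) > 0}"

end

theory Submission
  imports Defs "HOL-Complex_Analysis.Conformal_Mappings" "HOL-Real_Asymp.Real_Asymp"
begin

text \<open>
  Write \<open>h(z) = 1 - |z|^2\<close> and let \<open>\<phi>(l) = t \<integral> (h(l) / |1 - <l,z>|^2)^n d\<mu>(z)\<close>, which is at most
  \<open>t C\<close> on the support of \<open>\<mu>\<close>. For a holomorphic polynomial \<open>f\<close> put \<open>u = |f|^2 exp (-\<phi>)\<close>. As in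
  Uchiyama's lemma, \<open>u\<close> is subharmonic for the automorphisms of the ball. Only the following mean value
  form of this is used, for \<open>F\<close> and \<open>\<psi>\<close> obtained from \<open>f\<close> and \<open>\<phi>\<close> by composition with an automorphism:
  the mean of \<open>|F|^2 exp (-\<psi>)\<close> over a rotation invariant probability measure \<open>m\<close> on the ball is at least
  \<open>|F(0)|^2 exp (-\<psi>(0)) (1 + \<psi>(0) - \<integral> \<psi> dm)\<close>.

  Applied to small Moebius balls of radius \<open>r\<close> around \<open>l\<close> and integrated against \<open>h^(n+e)\<close> times the
  invariant measure, for which the averaging operators are self-adjoint, this yields, as first \<open>r\<close> and
  then \<open>e\<close> tends to \<open>0\<close>,
  \<open>t \<integral> u(l) \<integral> h(l)^n h(z) / |1 - <l,z>|^(2n+2) d\<mu>(z) dV(l) \<le> \<integral> |f|^2 d\<sigma>\<close>,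
  where \<open>V\<close> is normalized volume and \<open>\<sigma>\<close> normalized surface measure. Applied on the whole ball after
  moving \<open>z\<close> to its centre, with the weight \<open>h^n\<close>, it bounds the integral over \<open>l\<close> from below by
  \<open>(n!)^2 / (2n)! |f(z)|^2 exp (-\<phi>(z))\<close>. The choice \<open>t = 1 / C\<close> gives the constant.
\<close>

section \<open>The automorphisms of the ball\<close>

text \<open>Every t > 0 yields the factor exp (t C) / t times the binomial coefficient of 2n over n,
  and t = 1 / C minimizes it; this is the origin of e. Away from the support \<phi> may be large,
  which does no harm because the damping only decreases |f|^2. The mean value inequality is Jensen's
  inequality for exp applied to 2 log |F| - \<psi>, since log |F| has the sub-mean value property on
  circles. The weight: the average of h^b over a Moebius ball of radius r around l is, to second
  order, h(l)^b (1 + m r^2 (b^2 |l|^2 / n - b)), where m is the mean of |x|^2. The number b^2 / n -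
  b vanishes for b = n, but h^n is not integrable for the invariant measure dV / h^(n+1). For b = n
  + e it is, the number becomes (n + e) e / n, and e h^(e-1) dV concentrates on the sphere with mass
  tending to n. The constant (n!)^2 / (2n)! is the integral of h^n dV. To keep all functions
  bounded, the argument is run for polynomials and for \<mu> cut to |z| \<le> R; Fatou's lemma
  removes both restrictions at the end.\<close>

lemma norm_power2_vec: "(norm (x :: complex ^ 'n::finite))^2 = (\<Sum>i\<in>UNIV. (cmod (x $ i))^2)"
  unfolding norm_vec_def L2_set_def by (simp add: sum_nonneg)

lemma herm_diff_left: "herm (x - y) z = herm x z - herm y z"
  by (simp add: herm_def algebra_simps sum_subtractf)

lemma herm_smult_left: "herm (c *s x) z = c * herm x z"
  by (simp add: herm_def algebra_simps sum_distrib_left)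

lemma herm_diff_right: "herm z (x - y) = herm z x - herm z y"
  by (simp add: herm_def algebra_simps sum_subtractf)

lemma herm_smult_right: "herm z (c *s x) = cnj c * herm z x"
  by (simp add: herm_def algebra_simps sum_distrib_left)

lemma herm_commute: "herm y x = cnj (herm x y)"
  by (simp add: herm_def mult.commute)

lemma herm_self: "herm x x = of_real ((norm x)^2)"
  unfolding herm_def norm_power2_vec of_real_sum complex_norm_square ..

lemma herm_0_left [simp]: "herm 0 x = 0" and herm_0_right [simp]: "herm x 0 = 0"
  by (simp_all add: herm_def)

lemma scaleR_eq_smult: "r *\<^sub>R (x :: complex ^ 'n::finite) = of_real r *s x"
proof (rule vec_eq_iff[THEN iffD2], rule allI)
  show "(r *\<^sub>R x) $ i = (of_real r *s x) $ i" for i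
    unfolding vector_smult_component vector_scaleR_component by (rule scaleR_conv_of_real)
qed

lemma herm_scaleR_left: "herm (r *\<^sub>R x) y = of_real r * herm x y"
  by (simp add: scaleR_eq_smult herm_smult_left)

lemma cmod_herm_le: "cmod (herm x y) \<le> norm x * norm y"
proof -
  have "cmod (herm x y) \<le> (\<Sum>i\<in>UNIV. \<bar>cmod (x $ i)\<bar> * \<bar>cmod (y $ i)\<bar>)"
    unfolding herm_def by (rule order_trans[OF norm_sum]) (simp add: norm_mult)
  also have "\<dots> \<le> norm x * norm y"
    unfolding norm_vec_def by (rule L2_set_mult_ineq)
  finally show ?thesis .
qed

lemma norm_smult: "norm (c *s (x :: complex ^ 'n::finite)) = cmod c * norm x"
  by (rule power2_eq_imp_eq)
     (simp_all add: norm_power2_vec norm_mult power_mult_distrib sum_distrib_left)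

lemma cmod_herm_lt_1:
  assumes "norm x < 1" "norm y \<le> 1"
  shows "cmod (herm x y) < 1"
  using cmod_herm_le[of x y] mult_left_le[OF assms(2) norm_ge_zero[of x]] assms by linarith

lemma one_minus_herm_nonzero:
  assumes "norm x < 1" "norm y \<le> 1"
  shows "1 - herm x y \<noteq> 0"
  using cmod_herm_lt_1[OF assms] by auto

lemma continuous_on_herm [continuous_intros]:
  "continuous_on S f \<Longrightarrow> continuous_on S g \<Longrightarrow> continuous_on S (\<lambda>x. herm (f x) (g x))"
  unfolding herm_def by (intro continuous_intros)

lemma continuous_on_smult [continuous_intros]:
  fixes f :: "'a::topological_space \<Rightarrow> complex" and g :: "'a \<Rightarrow> complex ^ 'n::finite"
  shows "continuous_on S f \<Longrightarrow> continuous_on S g \<Longrightarrow> continuous_on S (\<lambda>x. f x *s g x)"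
  unfolding vector_scalar_mult_def by (intro continuous_intros)

lemma borel_measurable_herm_aux: "(\<lambda>p. herm (fst p) (snd p)) \<in> borel_measurable borel"
  by (intro borel_measurable_continuous_onI continuous_intros)

lemma borel_measurable_herm [measurable (raw)]:
  fixes f g :: "'a \<Rightarrow> complex ^ 'n::finite"
  assumes "f \<in> borel_measurable M" "g \<in> borel_measurable M"
  shows "(\<lambda>x. herm (f x) (g x)) \<in> borel_measurable M"
  using measurable_compose[OF borel_measurable_Pair[OF assms] borel_measurable_herm_aux] by simp

lemma borel_measurable_smult_aux:
  "(\<lambda>p. fst p *s (snd p :: complex ^ 'n::finite)) \<in> borel_measurable borel"
  by (intro borel_measurable_continuous_onI continuous_intros)

lemma borel_measurable_smult [measurable (raw)]:
  fixes g :: "'a \<Rightarrow> complex ^ 'n::finite"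
  assumes "f \<in> borel_measurable M" "g \<in> borel_measurable M"
  shows "(\<lambda>x. f x *s g x) \<in> borel_measurable M"
  using measurable_compose[OF borel_measurable_Pair[OF assms] borel_measurable_smult_aux] by simp

lemma one_minus_norm_pos: "norm (a :: 'a::real_normed_vector) < 1 \<Longrightarrow> 0 < 1 - (norm a)^2"
  by (simp add: power_less_one_iff)

text \<open>The standard involutive automorphism (a - P y - s Q y) / (1 - <y,a>), where P is the
  projection onto the line of \<open>a\<close>, Q = 1 - P and s = sqrt (1 - |a|^2). Writing P y + s
  Q y as s y + (<y,a> / (1 + s)) a avoids the division by |a|^2, so that \<open>a = 0\<close> is no
  special case.\<close>

definition ball_moebius :: "complex ^ 'n::finite \<Rightarrow> complex ^ 'n \<Rightarrow> complex ^ 'n" where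
  "ball_moebius a y = inverse (1 - herm y a) *s
     (a - of_real (sqrt (1 - (norm a)^2)) *s y
        - (herm y a / of_real (1 + sqrt (1 - (norm a)^2))) *s a)"

lemma moebius_0 [simp]: "ball_moebius a 0 = a"
  by (simp add: ball_moebius_def)

lemma borel_measurable_moebius [measurable (raw)]:
  assumes "f \<in> borel_measurable M" "g \<in> borel_measurable M"
  shows "(\<lambda>x. ball_moebius (f x) (g x)) \<in> borel_measurable M"
  unfolding ball_moebius_def using assms by measurable

text \<open>After clearing denominators both sides are 1 - <x,a> - <a,z> + s <x,z> + <x,a> <a,z> /
  (1 + s), with s = sqrt (1 - |a|^2). The automorphism is thus self-adjoint up to scalar factors,
  and the transformation law of the kernel follows from this.\<close>

lemma herm_moebius:
  assumes "norm a < 1" "norm x < 1" "norm z < 1"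
  shows "(1 - herm x a) * (1 - herm (ball_moebius a x) z) = (1 - herm a z) * (1 - herm x (ball_moebius a z))"
proof -
  define r where "r = sqrt (1 - (norm a)^2)"
  have "1 - herm x a \<noteq> 0" "1 - herm a z \<noteq> 0"
    using one_minus_herm_nonzero[of x a] one_minus_herm_nonzero[of a z] assms by simp_all
  then show ?thesis
    unfolding ball_moebius_def r_def[symmetric] herm_diff_left herm_diff_right herm_smult_left
      herm_smult_right herm_commute[of z a] complex_cnj_inverse complex_cnj_diff
      complex_cnj_divide complex_cnj_cnj complex_cnj_one complex_cnj_complex_of_real
    by (simp add: field_simps)
qed

text \<open>The automorphism sends \<open>a\<close> to the centre, so this is the case
  \<open>z = a\<close> of \<open>herm_moebius\<close>.\<close>

lemma herm_moebius_self:
  assumes "norm a < 1" "norm x < 1"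
  shows "(1 - herm x a) * (1 - herm (ball_moebius a x) a) = of_real (1 - (norm a)^2)"
proof -
  define r where "r = sqrt (1 - (norm a)^2)"
  have r: "r > 0" "r^2 = 1 - (norm a)^2"
    using one_minus_norm_pos[OF assms(1)] by (simp_all add: r_def)
  have "(norm a)^2 = (1 + r) * (1 - r)"
    using r by (simp add: algebra_simps power2_eq_square)
  then have "1 - r - (norm a)^2 / (1 + r) = 0"
    using r by simp
  then have "(1 - r - (norm a)^2 / (1 + r)) *\<^sub>R a = 0"
    by simp
  then have "a - of_real r *s a - (of_real ((norm a)^2) / of_real (1 + r)) *s a = 0"
    by (simp add: scaleR_eq_smult vec_eq_iff algebra_simps)
  then have "ball_moebius a a = 0"
    by (simp add: ball_moebius_def r_def[symmetric] herm_self)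
  then show ?thesis
    using herm_moebius[OF assms(1,2,1)] by (simp add: herm_self)
qed

text \<open>In homogeneous coordinates the fractional linear map becomes the linear map from
  \<open>(w0, y)\<close> to \<open>(z1, v)\<close>, which preserves the form |w0|^2 - |y|^2. It is
  factored into a shear producing \<open>z0\<close>, a shear with a reflection producing
  \<open>v\<close>, and a shear producing \<open>z1\<close>, so that its effect on Lebesgue measure
  can be read off without a determinant.\<close>

lemma moebius_lift:
  fixes a y :: "complex ^ 'n::finite" and w0 :: complex
  assumes a: "norm a < 1"
  defines "r \<equiv> sqrt (1 - (norm a)^2)"
  defines "z0 \<equiv> w0 - herm y a / of_real (1 + r)"
  defines "v \<equiv> (z0 / of_real r) *s a - y"
  defines "z1 \<equiv> herm v a / of_real (1 + r) + z0"
  shows "(cmod z1)^2 - (norm v)^2 = (cmod w0)^2 - (norm y)^2"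
    and "z1 = (w0 - herm y a) / of_real r"
    and "w0 \<noteq> 0 \<Longrightarrow> inverse z1 *s v = ball_moebius a (inverse w0 *s y)"
proof -
  have r: "r > 0" "r^2 = 1 - (norm a)^2"
    using one_minus_norm_pos[OF a] by (simp_all add: r_def)
  have aa: "(norm a)^2 = (1 + r) * (1 - r)"
    using r by (simp add: algebra_simps power2_eq_square)
  have cr: "complex_of_real (1 + r) \<noteq> 0" "complex_of_real r \<noteq> 0"
    using r by (metis add_pos_pos less_numeral_extra(1) of_real_eq_0_iff order_less_irrefl) (use r in simp)
  define q where "q = herm y a"
  have z0: "z0 = w0 - q / of_real (1 + r)"
    by (simp add: z0_def q_def)
  have hv: "herm v a = z0 / of_real r * of_real ((1 + r) * (1 - r)) - q"
    unfolding v_def herm_diff_left herm_smult_left herm_self aa q_def ..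
  define s where "s = q / of_real (1 + r)"
  have q: "q = of_real (1 + r) * s"
    using cr by (simp add: s_def)
  have z0s: "z0 = w0 - s"
    by (simp add: z0 s_def)
  have z1: "z1 = (w0 - q) / of_real r"
  proof -
    have A: "herm v a / of_real (1 + r) = z0 / of_real r * of_real (1 - r) - s"
      unfolding hv diff_divide_distrib s_def[symmetric] of_real_mult using cr by simp
    show ?thesis
      unfolding z1_def A q unfolding z0s using cr(2) by (simp add: field_simps)
  qed
  then show "z1 = (w0 - herm y a) / of_real r"
    by (simp add: q_def)
  show "inverse z1 *s v = ball_moebius a (inverse w0 *s y)" if "w0 \<noteq> 0"
  proof -
    have "inverse z1 *s v = inverse (1 - q / w0) *s ((of_real r / w0) *s v)"
      unfolding z1 vector_smult_assoc using that cr by (simp add: field_simps)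
    also have "(of_real r / w0) *s v = a - of_real r *s (inverse w0 *s y) - (q / w0 / of_real (1 + r)) *s a"
    proof -
      have *: "q / w0 / of_real (1 + r) = s / w0"
        by (simp add: s_def)
      show ?thesis
        unfolding v_def z0s vec_eq_iff * using that cr(2) by (simp add: field_simps)
    qed
    finally show ?thesis
      unfolding ball_moebius_def herm_smult_left r_def[symmetric] by (simp add: q_def field_simps)
  qed
  have "of_real ((norm v)^2) = herm v v"
    by (simp add: herm_self)
  also have "\<dots> = (z0 / of_real r) * cnj (z0 / of_real r) * of_real ((1 + r) * (1 - r))
      - z0 / of_real r * cnj q - cnj (z0 / of_real r) * q + of_real ((norm y)^2)"
    unfolding v_def herm_diff_left herm_diff_right herm_smult_left herm_smult_right
    unfolding herm_self herm_commute[of a y] q_def aa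
    by (simp only: algebra_simps)
  finally have nv: "of_real ((norm v)^2) = (z0 / of_real r) * cnj (z0 / of_real r) * of_real ((1 + r) * (1 - r))
      - z0 / of_real r * cnj q - cnj (z0 / of_real r) * q + of_real ((norm y)^2)" .
  define t where "t = z0 / of_real r"
  have t: "z0 = of_real r * t" "w0 = of_real r * t + s" "z1 = t - s"
    using cr(2) unfolding z1 q t_def z0s by (simp_all add: field_simps)
  have "complex_of_real ((cmod z1)^2 - (norm v)^2) = of_real ((cmod w0)^2 - (norm y)^2)"
    unfolding of_real_diff nv t_def[symmetric]
    unfolding complex_norm_square t(2,3) q
    by (simp add: algebra_simps)
  then show "(cmod z1)^2 - (norm v)^2 = (cmod w0)^2 - (norm y)^2"
    by (simp only: of_real_eq_iff)
qed

text \<open>The lift of the point \<open>(1, y)\<close> has the same value of the invariant form;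
  dividing by the squared modulus of its first coordinate returns to the ball.\<close>

lemma one_minus_norm_moebius:
  assumes a: "norm a < 1" and y: "norm y < 1"
  shows "1 - (norm (ball_moebius a y))^2 =
    (1 - (norm a)^2) * (1 - (norm y)^2) / (cmod (1 - herm y a))^2"
proof -
  define r where "r = sqrt (1 - (norm a)^2)"
  have r: "r > 0" "r^2 = 1 - (norm a)^2"
    using one_minus_norm_pos[OF a] by (simp_all add: r_def)
  define z1 where "z1 = (1 - herm y a) / of_real r"
  obtain v where v: "(cmod z1)^2 - (norm v)^2 = 1 - (norm y)^2" "inverse z1 *s v = ball_moebius a y"
    using moebius_lift[OF a, of 1 y] unfolding z1_def r_def by auto
  have nz: "1 - herm y a \<noteq> 0"
    using one_minus_herm_nonzero[of y a] assms by simp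
  then have "z1 \<noteq> 0" using r by (simp add: z1_def)
  then have "1 - (norm (ball_moebius a y))^2 = ((cmod z1)^2 - (norm v)^2) / (cmod z1)^2"
    unfolding v(2)[symmetric] norm_smult norm_inverse by (simp add: field_simps)
  also have "\<dots> = r^2 * (1 - (norm y)^2) / (cmod (1 - herm y a))^2"
    unfolding v(1) unfolding z1_def norm_divide norm_of_real power_divide using r(1) by simp
  finally show ?thesis unfolding r(2) .
qed

lemma norm_moebius_less_1:
  assumes "norm a < 1" "norm y < 1"
  shows "norm (ball_moebius a y) < 1"
proof -
  have "1 - (norm (ball_moebius a y))^2 > 0"
    unfolding one_minus_norm_moebius[OF assms]
    using assms one_minus_herm_nonzero[of y a]
    by (intro divide_pos_pos mult_pos_pos one_minus_norm_pos zero_less_power) auto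
  then show ?thesis
    by (simp add: power_less_one_iff)
qed

text \<open>A consequence of the involution property, obtained by applying the formula for the norm
  twice and eliminating the denominators with \<open>herm_moebius_self\<close>.\<close>

lemma one_minus_norm_moebius_moebius:
  assumes "norm a < 1" "norm y < 1"
  shows "1 - (norm (ball_moebius a (ball_moebius a y)))^2 = 1 - (norm y)^2"
proof -
  have nz: "1 - herm y a \<noteq> 0" and pos: "1 - (norm a)^2 > 0"
    using one_minus_herm_nonzero[of y a] one_minus_norm_pos[OF assms(1)] assms by simp_all
  have "cmod (1 - herm y a) * cmod (1 - herm (ball_moebius a y) a) = 1 - (norm a)^2"
    unfolding norm_mult[symmetric] herm_moebius_self[OF assms] norm_of_real using pos by simp
  then have "cmod (1 - herm (ball_moebius a y) a) = (1 - (norm a)^2) / cmod (1 - herm y a)"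
    using nz by (simp add: field_simps)
  moreover have "A * (A * Y / N^2) / (A / N)^2 = Y" if "A > 0" "N \<noteq> 0" for A Y N :: real
    using that by (simp add: field_simps power2_eq_square)
  ultimately show ?thesis
    using nz pos assms by (simp only: one_minus_norm_moebius norm_moebius_less_1) simp
qed

section \<open>Lebesgue measure under linear maps, and the invariant measure\<close>

lemma pred_ball [measurable]: "Measurable.pred borel (\<lambda>x::'a::metric_space. x \<in> ball a r)"
  by (rule pred_sets2[OF borel_open]) simp_all

lemma nn_integral_lborel_affine:
  fixes f :: "'a::euclidean_space \<Rightarrow> ennreal"
  assumes [measurable]: "f \<in> borel_measurable borel" and c: "c \<noteq> 0"
  shows "(\<integral>\<^sup>+x. f x \<partial>lborel) = ennreal (\<bar>c\<bar> ^ DIM('a)) * (\<integral>\<^sup>+x. f (t + c *\<^sub>R x) \<partial>lborel)"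
  by (subst lborel_affine[OF c, of t])
     (simp add: nn_integral_density nn_integral_distr nn_integral_cmult)

lemma nn_integral_lborel_translation:
  fixes f :: "'a::euclidean_space \<Rightarrow> ennreal"
  assumes [measurable]: "f \<in> borel_measurable borel"
  shows "(\<integral>\<^sup>+x. f (t + x) \<partial>lborel) = (\<integral>\<^sup>+x. f x \<partial>lborel)"
  using nn_integral_lborel_affine[OF assms, of 1 t] by simp

lemma nn_integral_lborel_reflection:
  fixes f :: "'a::euclidean_space \<Rightarrow> ennreal"
  assumes [measurable]: "f \<in> borel_measurable borel"
  shows "(\<integral>\<^sup>+x. f (t - x) \<partial>lborel) = (\<integral>\<^sup>+x. f x \<partial>lborel)"
  using nn_integral_lborel_affine[OF assms, of "-1" t] by simp

text \<open>Uniqueness of Haar measure by Fubini: with B the unit ball, the double integral of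
  1_A(x) 1_B(x + y), in \<open>x\<close> against \<open>M\<close> and in \<open>y\<close> against
  Lebesgue measure, is computed in two ways. This gives M(A) |B| = |A| M(B).\<close>

lemma lborel_unique_translation_invariant:
  fixes M :: "'a::euclidean_space measure"
  assumes sets[measurable_cong]: "sets M = sets borel" and sf: "sigma_finite_measure M"
    and trans: "\<And>c. distr M borel (\<lambda>x. c + x) = M"
    and ball: "emeasure M (ball 0 1) = emeasure lborel (ball (0::'a) 1)"
  shows "M = lborel"
proof (rule measure_eqI)
  fix A :: "'a set" assume "A \<in> sets M"
  then have A[measurable]: "A \<in> sets borel" by (simp add: sets)
  interpret M: sigma_finite_measure M by fact
  interpret P: pair_sigma_finite lborel M ..
  let ?B = "ball (0::'a) 1"
  define f g :: "'a \<Rightarrow> ennreal" where "f = indicator A" and "g = indicator ?B"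
  have [measurable]: "f \<in> borel_measurable borel" "g \<in> borel_measurable borel"
    unfolding f_def g_def by (auto intro!: borel_measurable_indicator)
  have M_trans: "(\<integral>\<^sup>+x. k (c + x) \<partial>M) = (\<integral>\<^sup>+x. k x \<partial>M)" if [measurable]: "k \<in> borel_measurable borel"
    for k :: "'a \<Rightarrow> ennreal" and c
    by (subst (2) trans[of c, symmetric], subst nn_integral_distr) auto
  have mult_A: "(\<integral>\<^sup>+x. f x * c \<partial>M) = emeasure M A * c" for c
    by (subst nn_integral_multc) (auto simp: f_def sets)
  have "emeasure M A * emeasure lborel ?B = (\<integral>\<^sup>+x. f x * (\<integral>\<^sup>+y. g y \<partial>lborel) \<partial>M)"
    by (simp add: mult_A) (simp add: g_def)
  also have "\<dots> = (\<integral>\<^sup>+x. f x * (\<integral>\<^sup>+y. g (x + y) \<partial>lborel) \<partial>M)"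
    by (subst nn_integral_lborel_translation) auto
  also have "\<dots> = (\<integral>\<^sup>+x. (\<integral>\<^sup>+y. f x * g (x + y) \<partial>lborel) \<partial>M)"
    by (subst nn_integral_cmult) auto
  also have "\<dots> = (\<integral>\<^sup>+y. (\<integral>\<^sup>+x. f x * g (x + y) \<partial>M) \<partial>lborel)"
    by (subst P.Fubini') auto
  \<comment> \<open>Translating \<open>x\<close> by \<open>- y\<close> inside the integral against
    \<open>M\<close> frees \<open>g\<close> from \<open>y\<close>; the remaining integral over
    \<open>y\<close> sees only a reflected translate of A.\<close>
  also have "\<dots> = (\<integral>\<^sup>+y. (\<integral>\<^sup>+x. f (- y + x) * g x \<partial>M) \<partial>lborel)"
    by (subst M_trans[of "\<lambda>x. f x * g (x + y)" "- y" for y, symmetric]) (auto simp: algebra_simps)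
  also have "\<dots> = (\<integral>\<^sup>+x. (\<integral>\<^sup>+y. f (- y + x) * g x \<partial>lborel) \<partial>M)"
    by (subst P.Fubini') auto
  also have "\<dots> = (\<integral>\<^sup>+x. (\<integral>\<^sup>+y. f (x - y) \<partial>lborel) * g x \<partial>M)"
    by (subst nn_integral_multc) auto
  also have "\<dots> = (\<integral>\<^sup>+x. (\<integral>\<^sup>+y. f y \<partial>lborel) * g x \<partial>M)"
    by (subst nn_integral_lborel_reflection) auto
  also have "\<dots> = emeasure lborel A * emeasure lborel ?B"
    by (simp add: nn_integral_cmult) (simp add: f_def g_def sets ball)
  finally have "emeasure M A * emeasure lborel ?B = emeasure lborel A * emeasure lborel ?B" .
  moreover have "emeasure lborel ?B \<noteq> 0"
    by (simp add: emeasure_ball less_imp_neq[OF unit_ball_vol_pos, symmetric])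
  moreover have "emeasure lborel ?B \<noteq> \<infinity>"
    using emeasure_lborel_ball_finite[of "0 :: 'a" 1] by auto
  ultimately show "emeasure M A = emeasure lborel A"
    by (simp add: ennreal_mult_cancel_left mult.commute[of _ "emeasure lborel ?B"])
qed (simp add: sets)

text \<open>The image measure is translation invariant because \<open>T\<close> is linear and onto,
  and it gives the unit ball its old volume because \<open>T\<close> preserves norms; uniqueness
  does the rest.\<close>

lemma lborel_distr_isometry:
  fixes T :: "'a::euclidean_space \<Rightarrow> 'a"
  assumes lin: "linear T" and iso: "\<And>x. norm (T x) = norm x"
  shows "distr lborel borel T = lborel"
proof (rule lborel_unique_translation_invariant)
  have [measurable]: "T \<in> borel_measurable borel"
    using linear_continuous_on lin by (intro borel_measurable_continuous_onI)
      (simp add: linear_conv_bounded_linear linear_continuous_on)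
  have pre: "emeasure (distr lborel borel T) (ball 0 r) = emeasure lborel (ball (0::'a) r)" for r
  proof -
    have "T -` ball 0 r = ball 0 r"
      using iso by auto
    then show ?thesis by (simp add: emeasure_distr)
  qed
  show "emeasure (distr lborel borel T) (ball 0 1) = emeasure lborel (ball (0::'a) 1)"
    by (rule pre)
  have fin: "emeasure lborel (ball (0::'a) r) \<noteq> \<infinity>" for r
    using emeasure_lborel_ball_finite[of "0::'a" r] by auto
  have UN: "(\<Union>n::nat. ball (0::'a) (real n)) = UNIV"
    by (auto simp: reals_Archimedean2)
  show "sigma_finite_measure (distr lborel borel T)"
  proof
    show "\<exists>A. countable A \<and> A \<subseteq> sets (distr lborel borel T) \<and>
        \<Union>A = space (distr lborel borel T) \<and> (\<forall>a\<in>A. emeasure (distr lborel borel T) a \<noteq> \<infinity>)"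
      using UN pre fin by (intro exI[of _ "range (\<lambda>n::nat. ball (0::'a) (real n))"]) auto
  qed
  have "inj T"
    using lin iso by (auto simp: linear_injective_0) (metis norm_eq_zero)
  then have "surj T"
    using lin linear_injective_imp_surjective by blast
  fix c
  obtain d where d: "T d = c" using \<open>surj T\<close> by (metis surjD)
  have "distr (distr lborel borel T) borel (\<lambda>x. c + x) = distr lborel borel (\<lambda>x. c + T x)"
    by (subst distr_distr) (auto simp: o_def)
  \<comment> \<open>Translating the image by \<open>c = T d\<close> is the same as translating by
    \<open>d\<close> before applying \<open>T\<close>.\<close>
  also have "(\<lambda>x. c + T x) = T \<circ> (\<lambda>x. d + x)"
    using lin d by (auto simp: linear_add)
  also have "distr lborel borel (T \<circ> (\<lambda>x. d + x)) = distr (distr lborel borel (\<lambda>x. d + x)) borel T"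
    by (subst distr_distr) auto
  also have "distr lborel borel (\<lambda>x. d + x) = lborel"
    using lborel_distr_plus[of d] by simp
  finally show "distr (distr lborel borel T) borel (\<lambda>x. c + x) = distr lborel borel T" .
qed simp

lemma linear_smult: "linear (\<lambda>x :: complex ^ 'n::finite. c *s x)"
  by (rule linearI) (simp_all add: vec_eq_iff algebra_simps)

text \<open>Multiplication by \<open>c\<close> is an isometry, multiplication by
  \<open>sgn c\<close>, followed by a real dilation by |c|; the real dimension of the space is
  2n.\<close>

lemma nn_integral_lborel_smult:
  fixes f :: "complex ^ 'n::finite \<Rightarrow> ennreal"
  assumes [measurable]: "f \<in> borel_measurable borel" and c: "c \<noteq> 0"
  shows "(\<integral>\<^sup>+x. f x \<partial>lborel) = ennreal (cmod c ^ (2 * CARD('n))) * (\<integral>\<^sup>+x. f (c *s x) \<partial>lborel)"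
proof -
  have "(\<integral>\<^sup>+x. f (cmod c *\<^sub>R x) \<partial>lborel) = (\<integral>\<^sup>+x. f (cmod c *\<^sub>R x) \<partial>distr lborel borel (\<lambda>x. sgn c *s x))"
    using c by (subst lborel_distr_isometry) (auto simp: linear_smult norm_smult norm_sgn)
  also have "\<dots> = (\<integral>\<^sup>+x. f (cmod c *\<^sub>R (sgn c *s x)) \<partial>lborel)"
    by (simp add: nn_integral_distr)
  also have "(\<lambda>x. cmod c *\<^sub>R (sgn c *s (x :: complex ^ 'n))) = (\<lambda>x. c *s x)"
    using c by (simp add: scaleR_eq_smult vector_smult_assoc sgn_eq)
  finally have "(\<integral>\<^sup>+x. f (cmod c *\<^sub>R x) \<partial>lborel) = (\<integral>\<^sup>+x. f (c *s x) \<partial>lborel)"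
    by (metis (no_types, lifting))
  moreover have "(\<integral>\<^sup>+x. f x \<partial>lborel) = ennreal (cmod c ^ (2 * CARD('n))) * (\<integral>\<^sup>+x. f (cmod c *\<^sub>R x) \<partial>lborel)"
    using nn_integral_lborel_affine[of f "cmod c" 0] c by (simp add: mult.commute)
  ultimately show ?thesis by simp
qed

lemma nn_integral_lborel_prod:
  fixes f :: "'a::euclidean_space \<times> 'b::euclidean_space \<Rightarrow> ennreal"
  assumes [measurable]: "f \<in> borel_measurable borel"
  shows "(\<integral>\<^sup>+z. f z \<partial>lborel) = (\<integral>\<^sup>+x. \<integral>\<^sup>+y. f (x, y) \<partial>lborel \<partial>lborel)"
    and "(\<integral>\<^sup>+z. f z \<partial>lborel) = (\<integral>\<^sup>+y. \<integral>\<^sup>+x. f (x, y) \<partial>lborel \<partial>lborel)"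
proof -
  have m: "f \<in> borel_measurable (lborel \<Otimes>\<^sub>M lborel)"
    by (simp add: lborel_prod)
  show "(\<integral>\<^sup>+z. f z \<partial>lborel) = (\<integral>\<^sup>+x. \<integral>\<^sup>+y. f (x, y) \<partial>lborel \<partial>lborel)"
    using lborel.nn_integral_fst[OF m] by (simp add: lborel_prod)
  show "(\<integral>\<^sup>+z. f z \<partial>lborel) = (\<integral>\<^sup>+y. \<integral>\<^sup>+x. f (x, y) \<partial>lborel \<partial>lborel)"
    using lborel_pair.nn_integral_snd[OF m] by (simp add: lborel_prod)
qed

lemma borel_measurable_fst_snd [measurable]:
  "fst \<in> borel_measurable (borel :: ('a::topological_space \<times> 'b::topological_space) measure)"
  "snd \<in> borel_measurable (borel :: ('a::topological_space \<times> 'b::topological_space) measure)"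
  by (auto intro!: borel_measurable_continuous_onI continuous_intros)

text \<open>For a fixed second coordinate the shear is a translation of the first one.\<close>

lemma nn_integral_shear_fst:
  fixes f :: "'a::euclidean_space \<times> 'b::euclidean_space \<Rightarrow> ennreal"
  assumes [measurable]: "f \<in> borel_measurable borel" "k \<in> borel_measurable borel"
  shows "(\<integral>\<^sup>+z. f (k (snd z) + fst z, snd z) \<partial>lborel) = (\<integral>\<^sup>+z. f z \<partial>lborel)"
  by (subst (1 2) nn_integral_lborel_prod(2), measurable) (simp_all add: nn_integral_lborel_translation[of "\<lambda>x. f (x, y)" for y])

lemma nn_integral_shear_snd:
  fixes f :: "'a::euclidean_space \<times> 'b::euclidean_space \<Rightarrow> ennreal"
  assumes [measurable]: "f \<in> borel_measurable borel" "k \<in> borel_measurable borel"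
  shows "(\<integral>\<^sup>+z. f (fst z, k (fst z) + snd z) \<partial>lborel) = (\<integral>\<^sup>+z. f z \<partial>lborel)"
  by (subst (1 2) nn_integral_lborel_prod(1), measurable) (simp_all add: nn_integral_lborel_translation[of "\<lambda>y. f (x, y)" for x])

lemma nn_integral_reflect_snd:
  fixes f :: "'a::euclidean_space \<times> 'b::euclidean_space \<Rightarrow> ennreal"
  assumes [measurable]: "f \<in> borel_measurable borel"
  shows "(\<integral>\<^sup>+z. f (fst z, - snd z) \<partial>lborel) = (\<integral>\<^sup>+z. f z \<partial>lborel)"
proof -
  have m: "(\<lambda>z. f (fst z, - snd z)) \<in> borel_measurable borel"
    by (rule measurable_compose[OF _ assms]) (intro borel_measurable_continuous_onI continuous_intros)
  show ?thesis
    unfolding nn_integral_lborel_prod(1)[OF m] nn_integral_lborel_prod(1)[OF assms]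
    using nn_integral_lborel_reflection[of "\<lambda>y. f (x, y)" 0 for x] by simp
qed

section \<open>Normalized volume on the ball and the invariant measure\<close>

definition unif_ball :: "'a::euclidean_space measure" where
  "unif_ball = uniform_measure lborel (ball 0 1)"

lemma sets_unif_ball [simp, measurable_cong]: "sets unif_ball = sets borel"
  and space_unif_ball [simp]: "space unif_ball = UNIV"
  by (simp_all add: unif_ball_def)

lemma emeasure_unit_ball_pos: "emeasure lborel (ball (0 :: 'a::euclidean_space) 1) \<noteq> 0"
  and emeasure_unit_ball_finite: "emeasure lborel (ball (0 :: 'a::euclidean_space) 1) \<noteq> \<infinity>"
  using emeasure_lborel_ball_finite[of "0 :: 'a" 1]
  by (auto simp: emeasure_ball less_imp_neq[OF unit_ball_vol_pos, symmetric])

lemma prob_space_unif_ball: "prob_space unif_ball"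
  unfolding unif_ball_def
  by (rule prob_space_uniform_measure[OF emeasure_unit_ball_pos emeasure_unit_ball_finite])

lemma AE_unif_ball: "AE y in unif_ball. norm y < 1"
  unfolding unif_ball_def using emeasure_unit_ball_pos emeasure_unit_ball_finite
  by (intro AE_uniform_measureI) auto

lemma nn_integral_unif_ball:
  fixes f :: "'a::euclidean_space \<Rightarrow> ennreal"
  assumes [measurable]: "f \<in> borel_measurable borel"
  shows "emeasure lborel (ball (0::'a) 1) * (\<integral>\<^sup>+y. f y \<partial>unif_ball) = (\<integral>\<^sup>+y. f y * indicator (ball 0 1) y \<partial>lborel)"
  unfolding unif_ball_def using emeasure_unit_ball_pos[where 'a='a] emeasure_unit_ball_finite[where 'a='a]
  by (subst nn_integral_uniform_measure) (auto simp: ennreal_times_divide mult.commute[of "emeasure _ _"] ennreal_mult_divide_eq)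

text \<open>Up to a constant, the volume of the Bergman metric. Its total mass is infinite.
  \<open>unif_ball\<close> lives on the whole space but gives no mass to the complement of the ball,
  so the values of the density there do not matter.\<close>

definition invariant_measure :: "(complex ^ 'n::finite) measure" where
  "invariant_measure = density unif_ball (\<lambda>y. ennreal (1 / (1 - (norm y)^2) ^ (CARD('n) + 1)))"

lemma sets_tau [simp, measurable_cong]: "sets invariant_measure = sets borel"
  and space_tau [simp]: "space invariant_measure = UNIV"
  by (simp_all add: invariant_measure_def)

lemma nn_integral_tau:
  fixes f :: "complex ^ 'n::finite \<Rightarrow> ennreal"
  assumes [measurable]: "f \<in> borel_measurable borel"
  shows "(\<integral>\<^sup>+y. f y \<partial>invariant_measure) = (\<integral>\<^sup>+y. ennreal (1 / (1 - (norm y)^2) ^ (CARD('n) + 1)) * f y \<partial>unif_ball)"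
  unfolding invariant_measure_def by (subst nn_integral_density) auto

lemma nn_integral_tau_lborel:
  fixes f :: "complex ^ 'n::finite \<Rightarrow> ennreal"
  assumes [measurable]: "f \<in> borel_measurable borel"
  shows "emeasure lborel (ball (0::complex ^ 'n) 1) * (\<integral>\<^sup>+y. f y \<partial>invariant_measure) =
    (\<integral>\<^sup>+y. indicator (ball 0 1) y * ennreal (1 / (1 - (norm y)^2) ^ (CARD('n) + 1)) * f y \<partial>lborel)"
  unfolding nn_integral_tau[OF assms] by (subst nn_integral_unif_ball) (auto simp: ac_simps)

text \<open>The ball is the set of complex lines in the cone \<open>|z'| < |z_0|\<close> of \<open>\<complex> \<times> \<complex>^n\<close>, with coordinate
  \<open>y = z' / z_0\<close>. Integrating out \<open>z_0\<close> turns Lebesgue measure into the invariant measure.\<close>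

lemma nn_integral_projective:
  fixes \<psi> :: "complex ^ 'n::finite \<Rightarrow> ennreal"
  assumes [measurable]: "\<psi> \<in> borel_measurable borel"
  shows "(\<integral>\<^sup>+z. indicator {z. 0 < (cmod (fst z))^2 - (norm (snd z))^2 \<and>
        (cmod (fst z))^2 - (norm (snd z))^2 < 1} z * \<psi> (inverse (fst z) *s snd z) \<partial>lborel) =
    (\<integral>\<^sup>+z. indicator (ball (0::complex) 1) z * ennreal (cmod z ^ (2 * CARD('n))) \<partial>lborel) * (emeasure lborel (ball (0::complex ^ 'n) 1) * (\<integral>\<^sup>+y. \<psi> y \<partial>invariant_measure))"
    (is "(\<integral>\<^sup>+z. ?g z \<partial>lborel) = ?\<kappa> * (?v * _)")
proof -
  let ?n = "CARD('n)"
  \<comment> \<open>The lower bound describes the cone. The upper bound cuts the cone so that the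
    fibre integrals are finite, and it uses the invariant form so that the lift preserves the
    region.\<close>
  let ?S = "{z :: complex \<times> (complex ^ 'n). 0 < (cmod (fst z))^2 - (norm (snd z))^2 \<and>
        (cmod (fst z))^2 - (norm (snd z))^2 < 1}"
  let ?k = "\<lambda>z y. indicator (ball 0 1) y * indicator {z. (cmod z)^2 * (1 - (norm y)^2) < 1} z
      * ennreal (cmod z ^ (2 * ?n)) * \<psi> (y :: complex ^ 'n)"
  have mg [measurable]: "?g \<in> borel_measurable borel"
    by measurable
  have inner: "(\<integral>\<^sup>+y. ?g (z, y) \<partial>lborel) = (\<integral>\<^sup>+y. ?k z y \<partial>lborel)" if "z \<noteq> 0" for z
  proof -
    have eq: "?g (z, z *s y) = indicator (ball 0 1) y * indicator {z. (cmod z)^2 * (1 - (norm y)^2) < 1} z * \<psi> y" for y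
    proof -
      have "(cmod z)^2 - (norm (z *s y))^2 = (cmod z)^2 * (1 - (norm y)^2)"
        by (simp add: norm_smult power_mult_distrib algebra_simps)
      moreover have "0 < (cmod z)^2 * (1 - (norm y)^2) \<longleftrightarrow> norm y < 1"
        using that by (simp add: zero_less_mult_iff power_less_one_iff)
      ultimately have "(z, z *s y) \<in> ?S \<longleftrightarrow> y \<in> ball 0 1 \<and> z \<in> {z. (cmod z)^2 * (1 - (norm y)^2) < 1}"
        by (simp only: mem_Collect_eq fst_conv snd_conv mem_ball dist_0_norm)
      then show ?thesis
        unfolding indicator_def using that by (simp add: vector_smult_assoc)
    qed
    \<comment> \<open>Substituting \<open>z *s y\<close> for the second coordinate turns the slice
      of the region into the unit ball together with a condition on |z|.\<close>
    have "(\<integral>\<^sup>+y. ?g (z, y) \<partial>lborel) = ennreal (cmod z ^ (2 * ?n)) * (\<integral>\<^sup>+y. ?g (z, z *s y) \<partial>lborel)"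
      by (rule nn_integral_lborel_smult[OF _ that]) measurable
    also have "\<dots> = (\<integral>\<^sup>+y. ?k z y \<partial>lborel)"
      unfolding eq by (subst nn_integral_cmult[symmetric]) (auto intro!: nn_integral_cong simp: ac_simps)
    finally show ?thesis .
  qed
  have outer: "(\<integral>\<^sup>+z. ?k z y \<partial>lborel) =
      ?\<kappa> * (indicator (ball 0 1) y * ennreal (1 / (1 - (norm y)^2) ^ (?n + 1)) * \<psi> y)" for y
  proof (cases "norm y < 1")
    case True
    define h where "h = 1 - (norm y)^2"
    have h: "h > 0" using one_minus_norm_pos[OF True] by (simp add: h_def)
    have "(\<integral>\<^sup>+z. ?k z y \<partial>lborel) =
        (\<integral>\<^sup>+z. indicator {z. (cmod z)^2 * h < 1} z * ennreal (cmod z ^ (2 * ?n)) \<partial>lborel) * \<psi> y"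
      by (subst nn_integral_multc[symmetric]) (auto simp: True h_def)
    \<comment> \<open>Dilating the plane by 1 / sqrt h contributes 1 / h from the area and 1 / h^n
      from the factor |z|^(2n); their product is the density of the invariant measure.\<close>
    also have "(\<integral>\<^sup>+z. indicator {z. (cmod z)^2 * h < 1} z * ennreal (cmod z ^ (2 * ?n)) \<partial>lborel) =
      ennreal (1 / h) * (\<integral>\<^sup>+z. indicator {z. (cmod z)^2 * h < 1} ((1 / sqrt h) *\<^sub>R z)
          * ennreal (cmod ((1 / sqrt h) *\<^sub>R z) ^ (2 * ?n)) \<partial>lborel)"
      using h by (subst nn_integral_lborel_affine[where c="1 / sqrt h" and t=0])
        (auto simp: power_divide)
    also have "(\<lambda>z::complex. indicator {z. (cmod z)^2 * h < 1} ((1 / sqrt h) *\<^sub>R z)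
          * ennreal (cmod ((1 / sqrt h) *\<^sub>R z) ^ (2 * ?n))) =
        (\<lambda>z. ennreal (1 / h ^ ?n) * (indicator (ball 0 1) z * ennreal (cmod z ^ (2 * ?n))))"
    proof
      fix z :: complex
      have 1: "cmod ((1 / sqrt h) *\<^sub>R z) ^ (2 * ?n) = 1 / h ^ ?n * cmod z ^ (2 * ?n)"
        using h by (simp add: power_mult_distrib power_divide power_mult)
      have "(cmod ((1 / sqrt h) *\<^sub>R z))^2 * h = (cmod z)^2"
        using h by (simp add: power_mult_distrib power_divide)
      then have 2: "indicator {z. (cmod z)^2 * h < 1} ((1 / sqrt h) *\<^sub>R z) = (indicator (ball 0 1) z :: ennreal)"
        by (simp add: indicator_def power_less_one_iff)
      show "indicator {z. (cmod z)^2 * h < 1} ((1 / sqrt h) *\<^sub>R z)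
          * ennreal (cmod ((1 / sqrt h) *\<^sub>R z) ^ (2 * ?n)) =
        ennreal (1 / h ^ ?n) * (indicator (ball 0 1) z * ennreal (cmod z ^ (2 * ?n)))"
        unfolding 1 2 using h by (subst ennreal_mult) (auto simp: ac_simps)
    qed
    also have "ennreal (1 / h) * (\<integral>\<^sup>+z. ennreal (1 / h ^ ?n) * (indicator (ball (0::complex) 1) z * ennreal (cmod z ^ (2 * ?n))) \<partial>lborel)
       = ennreal (1 / h ^ (?n + 1)) * ?\<kappa>"
      using h by (subst nn_integral_cmult) (auto simp: mult.assoc[symmetric] ennreal_mult'[symmetric])
    finally show ?thesis
      using True by (simp add: h_def ac_simps)
  qed simp
  have "(\<integral>\<^sup>+z. ?g z \<partial>lborel) = (\<integral>\<^sup>+z. \<integral>\<^sup>+y. ?g (z, y) \<partial>lborel \<partial>lborel)"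
    by (rule nn_integral_lborel_prod(1)[OF mg])
  also have "\<dots> = (\<integral>\<^sup>+z. \<integral>\<^sup>+y. ?k z y \<partial>lborel \<partial>lborel)"
    by (intro nn_integral_cong_AE eventually_mono[OF AE_lborel_singleton[of 0]] inner)
  also have "\<dots> = (\<integral>\<^sup>+y. \<integral>\<^sup>+z. ?k z y \<partial>lborel \<partial>lborel)"
    by (rule lborel_pair.Fubini') measurable
  also have "\<dots> = ?\<kappa> * (?v * (\<integral>\<^sup>+y. \<psi> y \<partial>invariant_measure))"
    unfolding outer by (subst nn_integral_cmult) (auto simp: nn_integral_tau_lborel)
  finally show ?thesis .
qed

text \<open>The automorphism lifts to the linear map of \<open>\<complex> \<times> \<complex>^n\<close> below, which preserves Lebesgue measure because
  it is composed of three shears and a reflection.\<close>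

lemma nn_integral_moebius_lift:
  fixes a :: "complex ^ 'n::finite" and c d :: complex and g :: "complex \<times> (complex ^ 'n) \<Rightarrow> ennreal"
  assumes [measurable]: "g \<in> borel_measurable borel" and nz: "c \<noteq> 0" "d \<noteq> 0"
  defines "p \<equiv> \<lambda>z. fst z - herm (snd z) a / c"
  defines "v \<equiv> \<lambda>z. (p z / d) *s a - snd z"
  shows "(\<integral>\<^sup>+z. g (herm (v z) a / c + p z, v z) \<partial>lborel) = (\<integral>\<^sup>+z. g z \<partial>lborel)"
proof -
  let ?g1 = "\<lambda>z. g (herm (snd z) a / c + fst z, snd z)"
  let ?g2 = "\<lambda>z. ?g1 (fst z, (fst z / d) *s a + snd z)"
  let ?g3 = "\<lambda>z. ?g2 (herm (snd z) a / c + fst z, snd z)"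
  have m1: "?g1 \<in> borel_measurable borel"
    by (rule measurable_compose[OF _ assms(1)], rule borel_measurable_continuous_onI, intro continuous_intros)
       (use nz in auto)
  have m2: "?g2 \<in> borel_measurable borel"
    by (rule measurable_compose[OF _ m1], rule borel_measurable_continuous_onI, intro continuous_intros)
       (use nz in auto)
  have m3: "?g3 \<in> borel_measurable borel"
    by (rule measurable_compose[OF _ m2], rule borel_measurable_continuous_onI, intro continuous_intros)
       (use nz in auto)
  have "(\<integral>\<^sup>+z. g (herm (v z) a / c + p z, v z) \<partial>lborel) = (\<integral>\<^sup>+z. ?g3 (fst z, - snd z) \<partial>lborel)"
    by (intro nn_integral_cong) (simp add: v_def p_def herm_def sum_negf)
  also have "\<dots> = (\<integral>\<^sup>+z. ?g3 z \<partial>lborel)"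
    by (rule nn_integral_reflect_snd[OF m3])
  also have "\<dots> = (\<integral>\<^sup>+z. ?g2 z \<partial>lborel)"
    by (rule nn_integral_shear_fst[OF m2, of "\<lambda>y. herm y a / c"]) measurable
  also have "\<dots> = (\<integral>\<^sup>+z. ?g1 z \<partial>lborel)"
    by (rule nn_integral_shear_snd[OF m1, of "\<lambda>x. (x / d) *s a"]) measurable
  also have "\<dots> = (\<integral>\<^sup>+z. g z \<partial>lborel)"
    by (rule nn_integral_shear_fst[OF assms(1), of "\<lambda>y. herm y a / c"]) measurable
  finally show ?thesis .
qed

text \<open>The lift preserves both the cut cone and Lebesgue measure and induces the automorphism
  on complex lines. Both integrals therefore arise from the same integral over the cone, with a
  common factor that is finite and nonzero.\<close>

theorem nn_integral_tau_moebius: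
  fixes a :: "complex ^ 'n::finite" and \<psi> :: "complex ^ 'n \<Rightarrow> ennreal"
  assumes a: "norm a < 1" and [measurable]: "\<psi> \<in> borel_measurable borel"
  shows "(\<integral>\<^sup>+y. \<psi> (ball_moebius a y) \<partial>invariant_measure) = (\<integral>\<^sup>+y. \<psi> y \<partial>invariant_measure)"
proof -
  let ?\<kappa> = "\<integral>\<^sup>+z. indicator (ball (0::complex) 1) z * ennreal (cmod z ^ (2 * CARD('n))) \<partial>lborel"
  let ?vol = "emeasure lborel (ball (0::complex ^ 'n) 1)"
  let ?Q = "\<lambda>z :: complex \<times> (complex ^ 'n). (cmod (fst z))^2 - (norm (snd z))^2"
  let ?g = "\<lambda>\<psi> z. indicator {z. 0 < ?Q z \<and> ?Q z < 1} z * \<psi> (inverse (fst z) *s snd z) :: ennreal"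
  let ?r = "sqrt (1 - (norm a)^2)"
  let ?p = "\<lambda>z. fst z - herm (snd z) a / of_real (1 + ?r)"
  let ?v = "\<lambda>z. (?p z / of_real ?r) *s a - snd z"
  let ?A = "\<lambda>z. (herm (?v z) a / of_real (1 + ?r) + ?p z, ?v z)"
  have cr: "complex_of_real (1 + ?r) \<noteq> 0"
    using one_minus_norm_pos[OF a]
    by (metis add_pos_pos less_numeral_extra(1) of_real_eq_0_iff order_less_irrefl real_sqrt_gt_zero)
  have Q: "?Q (?A z) = ?Q z" for z
    using moebius_lift(1)[OF a, of "fst z" "snd z"] by simp
  have g: "?g \<psi> (?A z) = ?g (\<lambda>y. \<psi> (ball_moebius a y)) z" for z
  proof (cases "0 < ?Q z")
    case True
    then have "fst z \<noteq> 0" by auto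
    then show ?thesis
      using moebius_lift(3)[OF a, of "fst z" "snd z"] Q[of z] by (simp add: indicator_def)
  qed (use Q[of z] in simp)
  have "?\<kappa> * (?vol * (\<integral>\<^sup>+y. \<psi> (ball_moebius a y) \<partial>invariant_measure)) = (\<integral>\<^sup>+z. ?g \<psi> (?A z) \<partial>lborel)"
    unfolding g by (rule nn_integral_projective[symmetric]) measurable
  also have "\<dots> = (\<integral>\<^sup>+z. ?g \<psi> z \<partial>lborel)"
    using nn_integral_moebius_lift[of "?g \<psi>" "of_real (1 + ?r)" "of_real ?r" a]
      one_minus_norm_pos[OF a] cr by simp
  also have "\<dots> = ?\<kappa> * (?vol * (\<integral>\<^sup>+y. \<psi> y \<partial>invariant_measure))"
    by (rule nn_integral_projective) measurable
  finally have eq: "?\<kappa> * (?vol * (\<integral>\<^sup>+y. \<psi> (ball_moebius a y) \<partial>invariant_measure)) = ?\<kappa> * (?vol * (\<integral>\<^sup>+y. \<psi> y \<partial>invariant_measure))" .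
  have "?\<kappa> \<le> (\<integral>\<^sup>+z. indicator (ball (0::complex) 1) z \<partial>lborel)"
    by (intro nn_integral_mono) (auto simp: indicator_def power_le_one)
  also have "\<dots> < \<infinity>"
    using emeasure_lborel_ball_finite[of "0::complex" 1] by simp
  finally have fin: "?\<kappa> \<noteq> \<infinity>" by simp
  have pos: "?\<kappa> \<noteq> 0"
  proof
    assume "?\<kappa> = 0"
    then have "AE z in lborel. indicator (ball 0 1) z * ennreal (cmod z ^ (2 * CARD('n))) = 0"
      by (subst (asm) nn_integral_0_iff_AE) auto
    then have "AE z::complex in lborel. z \<notin> ball 0 1"
      using AE_lborel_singleton[of "0::complex"]
    proof eventually_elim
      case (elim z)
      then have "0 < cmod z ^ (2 * CARD('n))" by simp
      with elim show ?case
        by (auto simp: indicator_def ennreal_eq_0_iff simp del: zero_less_power_eq split: if_splits)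
    qed
    then have "emeasure lborel (ball (0::complex) 1) = 0"
      by (subst (asm) AE_iff_measurable[of "ball 0 1"]) auto
    then show False
      by (simp add: emeasure_ball less_imp_neq[OF unit_ball_vol_pos, symmetric])
  qed
  show ?thesis
    using eq fin pos emeasure_unit_ball_pos[where 'a="complex ^ 'n"]
      emeasure_unit_ball_finite[where 'a="complex ^ 'n"] by (simp add: ennreal_mult_cancel_left)
qed

section \<open>Polar coordinates\<close>

lemma unif_ball_isometry:
  fixes T :: "'a::euclidean_space \<Rightarrow> 'a"
  assumes lin: "linear T" and iso: "\<And>x. norm (T x) = norm x"
  shows "distr unif_ball borel T = unif_ball"
proof (rule measure_eqI)
  have [measurable]: "T \<in> borel_measurable borel"
    using linear_continuous_on lin by (intro borel_measurable_continuous_onI)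
      (simp add: linear_conv_bounded_linear linear_continuous_on)
  fix A assume "A \<in> sets (distr (unif_ball :: 'a measure) borel T)"
  then have [measurable]: "A \<in> sets borel" by simp
  have "ball 0 1 \<inter> T -` A = T -` (ball 0 1 \<inter> A)"
    using iso by auto
  then have "emeasure lborel (ball 0 1 \<inter> T -` A) = emeasure (distr lborel borel T) (ball 0 1 \<inter> A)"
    by (simp add: emeasure_distr)
  then show "emeasure (distr unif_ball borel T) A = emeasure unif_ball A"
    using measurable_sets[OF \<open>T \<in> borel_measurable borel\<close> \<open>A \<in> sets borel\<close>]
    by (simp add: emeasure_distr unif_ball_def emeasure_uniform_measure lborel_distr_isometry[OF assms])
qed simp

lemma integral_unif_ball_isometry:
  fixes T :: "'a::euclidean_space \<Rightarrow> 'a" and f :: "'a \<Rightarrow> real"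
  assumes lin: "linear T" and iso: "\<And>x. norm (T x) = norm x"
    and [measurable]: "f \<in> borel_measurable borel"
  shows "(LINT x|unif_ball. f (T x)) = (LINT x|unif_ball. f x)"
proof -
  have [measurable]: "T \<in> borel_measurable borel"
    using linear_continuous_on lin by (intro borel_measurable_continuous_onI)
      (simp add: linear_conv_bounded_linear linear_continuous_on)
  show ?thesis
    by (subst (2) unif_ball_isometry[OF assms(1,2), symmetric], subst integral_distr) auto
qed

lemma nn_integral_unif_ball_isometry:
  fixes T :: "'a::euclidean_space \<Rightarrow> 'a"
  assumes lin: "linear T" and iso: "\<And>x. norm (T x) = norm x"
    and [measurable]: "f \<in> borel_measurable borel"
  shows "(\<integral>\<^sup>+x. f (T x) \<partial>unif_ball) = (\<integral>\<^sup>+x. f x \<partial>unif_ball)"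
proof -
  have [measurable]: "T \<in> borel_measurable borel"
    using linear_continuous_on lin by (intro borel_measurable_continuous_onI)
      (simp add: linear_conv_bounded_linear linear_continuous_on)
  show ?thesis
    by (subst (2) unif_ball_isometry[OF assms(1,2), symmetric], subst nn_integral_distr) auto
qed

text \<open>A truncated cone is the dilation by \<open>a\<close> of the cone truncated at radius 1.
  The factorization expresses that norm and direction are independent.\<close>

lemma emeasure_unif_ball_cone:
  fixes B :: "'a::euclidean_space set"
  assumes [measurable]: "B \<in> sets borel" and a: "0 \<le> a" "a \<le> 1"
  shows "emeasure unif_ball {x. norm x \<le> a \<and> sgn x \<in> B} =
    ennreal (a ^ DIM('a)) * emeasure unif_ball {x. sgn x \<in> B}"
proof (cases "a = 0")
  case True
  have "emeasure unif_ball {x::'a. norm x \<le> a \<and> sgn x \<in> B} \<le> emeasure unif_ball {0::'a}"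
    using True by (intro emeasure_mono) auto
  also have "\<dots> = 0"
  proof -
    have "ball (0::'a) 1 \<inter> {0} = {0}" by auto
    then show ?thesis by (simp add: unif_ball_def emeasure_uniform_measure)
  qed
  finally show ?thesis
    using True by (simp add: power_0_left)
next
  case False
  then have a0: "a > 0" using a by simp
  have [measurable]: "sgn \<in> borel_measurable (borel :: 'a measure)"
    unfolding sgn_div_norm by measurable
  let ?v = "emeasure lborel (ball (0::'a) 1)"
  define g where "g b x = (indicator {x::'a. norm x \<le> b \<and> sgn x \<in> B} x :: ennreal)" for b x
  have gm [measurable]: "g b \<in> borel_measurable borel" for b
    unfolding g_def by measurable
  \<comment> \<open>The truncation at \<open>b = 1\<close> is closed and the ball is open; they
    differ by the null sphere.\<close>
  have AEs: "AE x in lborel. x \<notin> sphere (0::'a) 1"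
    by (rule AE_I'[of "sphere 0 1"])
       (use negligible_sphere[of "0::'a" 1] in \<open>auto simp: negligible_iff_null_sets null_sets_completion_iff\<close>)
  have 1: "?v * (\<integral>\<^sup>+x. g b x \<partial>unif_ball) = (\<integral>\<^sup>+x. g b x \<partial>lborel)" if "b \<le> 1" for b
    unfolding nn_integral_unif_ball[OF gm]
    using that by (intro nn_integral_cong_AE eventually_mono[OF AEs]) (auto simp: g_def indicator_def)
  have "(\<integral>\<^sup>+x. g a x \<partial>lborel) = ennreal (a ^ DIM('a)) * (\<integral>\<^sup>+x. g a (a *\<^sub>R x) \<partial>lborel)"
    using nn_integral_lborel_affine[of "g a" a 0] a0 by simp
  also have "(\<lambda>x. g a (a *\<^sub>R x)) = g 1"
    using a0 by (auto simp: g_def fun_eq_iff indicator_def sgn_scaleR)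
  finally have "?v * (\<integral>\<^sup>+x. g a x \<partial>unif_ball) = ?v * (ennreal (a ^ DIM('a)) * (\<integral>\<^sup>+x. g 1 x \<partial>unif_ball))"
    unfolding 1[OF a(2)] 1[OF order_refl, symmetric] by (simp add: ac_simps)
  then have "(\<integral>\<^sup>+x. g a x \<partial>unif_ball) = ennreal (a ^ DIM('a)) * (\<integral>\<^sup>+x. g 1 x \<partial>unif_ball)"
    using emeasure_unit_ball_pos[where 'a='a] emeasure_unit_ball_finite[where 'a='a]
    by (simp add: ennreal_mult_cancel_left)
  moreover have "(\<integral>\<^sup>+x. g b x \<partial>unif_ball) = emeasure unif_ball {x. norm x \<le> b \<and> sgn x \<in> B}" for b
    unfolding g_def by (subst nn_integral_indicator) auto
  moreover have "emeasure unif_ball {x. norm x \<le> 1 \<and> sgn x \<in> B} = emeasure unif_ball {x. sgn x \<in> B}"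
    by (intro emeasure_eq_AE eventually_mono[OF AE_unif_ball]) auto
  ultimately show ?thesis by simp
qed

lemma emeasure_unif_ball_norm_le:
  assumes a: "0 \<le> a" "a \<le> 1"
  shows "emeasure unif_ball {x::'a::euclidean_space. norm x \<le> a} = ennreal (a ^ DIM('a))"
  using emeasure_unif_ball_cone[of "UNIV :: 'a set", OF _ a] prob_space.emeasure_space_1[OF prob_space_unif_ball[where 'a='a]]
  by simp

text \<open>Norm and direction of a uniformly distributed point are independent. For fixed
  \<open>B\<close> the law of the norm on the event that the direction lies in \<open>B\<close> is a
  multiple of the full law, since both finite measures on the line agree on half-lines by the cone
  formula.\<close>

lemma unif_ball_polar:
  "distr (unif_ball :: 'a measure) borel norm \<Otimes>\<^sub>M distr (unif_ball :: 'a measure) borel sgn =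
    distr unif_ball (borel \<Otimes>\<^sub>M borel) (\<lambda>x::'a::euclidean_space. (norm x, sgn x))"
proof -
  interpret prob_space "unif_ball :: 'a measure" by (rule prob_space_unif_ball)
  have [measurable]: "sgn \<in> borel_measurable (borel :: 'a measure)"
    unfolding sgn_div_norm by measurable
  interpret N: prob_space "distr (unif_ball :: 'a measure) borel norm"
    by (rule prob_space_distr) simp
  interpret S: prob_space "distr (unif_ball :: 'a measure) borel sgn"
    by (rule prob_space_distr) simp
  show ?thesis
  proof (rule pair_measure_eqI)
    fix A :: "real set" and B :: "'a set"
    assume "A \<in> sets (distr (unif_ball :: 'a measure) borel norm)" "B \<in> sets (distr (unif_ball :: 'a measure) borel sgn)"
    then have [measurable]: "A \<in> sets borel" "B \<in> sets borel" by simp_all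
    let ?c = "emeasure unif_ball {x::'a. sgn x \<in> B}"
    let ?M = "distr (density unif_ball (indicator {x::'a. sgn x \<in> B})) borel norm"
    let ?N = "density (distr (unif_ball :: 'a measure) borel norm) (\<lambda>_. ?c)"
    have eM: "emeasure ?M X = emeasure unif_ball {x::'a. norm x \<in> X \<and> sgn x \<in> B}" if [measurable]: "X \<in> sets borel" for X
    proof -
      have "emeasure ?M X = (\<integral>\<^sup>+x. indicator {x::'a. sgn x \<in> B} x * indicator (norm -` X) x \<partial>unif_ball)"
        using measurable_sets[of norm "unif_ball :: 'a measure" borel X]
        by (subst emeasure_distr) (auto simp: emeasure_density)
      also have "\<dots> = (\<integral>\<^sup>+x. indicator {x::'a. norm x \<in> X \<and> sgn x \<in> B} x \<partial>unif_ball)"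
        by (intro nn_integral_cong) (auto simp: indicator_def)
      also have "\<dots> = emeasure unif_ball {x::'a. norm x \<in> X \<and> sgn x \<in> B}"
        by (rule nn_integral_indicator) simp
      finally show ?thesis .
    qed
    have eN: "emeasure ?N X = ?c * emeasure unif_ball {x::'a. norm x \<in> X}" if [measurable]: "X \<in> sets borel" for X
      by (simp add: emeasure_density nn_integral_cmult emeasure_distr vimage_def)
    have le: "emeasure unif_ball {x::'a. norm x \<le> t \<and> sgn x \<in> B} = ?c * emeasure unif_ball {x::'a. norm x \<le> t}" for t
    proof -
      consider "t < 0" | "0 \<le> t" "t \<le> 1" | "t > 1" by linarith
      then show ?thesis
      proof cases
        case 1
        then have "{x::'a. norm x \<le> t} = {}"
          by (auto simp: not_le intro: less_le_trans)
        moreover from this have "{x::'a. norm x \<le> t \<and> sgn x \<in> B} = {}" by auto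
        ultimately show ?thesis by simp
      next
        case 2
        then show ?thesis
          by (simp add: emeasure_unif_ball_cone emeasure_unif_ball_norm_le mult.commute)
      next
        case 3
        then have "emeasure unif_ball {x::'a. norm x \<le> t \<and> sgn x \<in> B} = ?c"
          by (intro emeasure_eq_AE eventually_mono[OF AE_unif_ball]) auto
        moreover have "emeasure unif_ball {x::'a. norm x \<le> t} = emeasure unif_ball (UNIV :: 'a set)"
          using 3 by (intro emeasure_eq_AE eventually_mono[OF AE_unif_ball]) auto
        ultimately show ?thesis
          using emeasure_space_1 by simp
      qed
    qed
    have "?M = ?N"
    proof (rule measure_eqI_lessThan)
      fix t
      show "emeasure ?M {t<..} < \<infinity>"
        by (subst eM) (auto simp: less_top[symmetric])
      have "?c = emeasure unif_ball ({x::'a. norm x \<in> {t<..} \<and> sgn x \<in> B} \<union> {x. norm x \<le> t \<and> sgn x \<in> B})"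
        by (intro arg_cong[where f="emeasure unif_ball"]) auto
      also have "\<dots> = emeasure unif_ball {x::'a. norm x \<in> {t<..} \<and> sgn x \<in> B} + emeasure unif_ball {x::'a. norm x \<le> t \<and> sgn x \<in> B}"
        by (rule plus_emeasure[symmetric]) auto
      finally have 1: "?c = emeasure ?M {t<..} + ?c * emeasure unif_ball {x::'a. norm x \<le> t}"
        by (simp add: eM le)
      have "1 = emeasure unif_ball ({x::'a. norm x \<in> {t<..}} \<union> {x. norm x \<le> t})"
        using emeasure_space_1 by (simp add: Un_def not_le[symmetric] )
      also have "\<dots> = emeasure unif_ball {x::'a. norm x \<in> {t<..}} + emeasure unif_ball {x::'a. norm x \<le> t}"
        by (rule plus_emeasure[symmetric]) auto
      finally have "?c = ?c * (emeasure unif_ball {x::'a. norm x \<in> {t<..}} + emeasure unif_ball {x::'a. norm x \<le> t})"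
        by simp
      then have "?c = emeasure ?N {t<..} + ?c * emeasure unif_ball {x::'a. norm x \<le> t}"
        by (simp add: eN distrib_left)
      with 1 have "?c * emeasure unif_ball {x::'a. norm x \<le> t} + emeasure ?M {t<..} =
          ?c * emeasure unif_ball {x::'a. norm x \<le> t} + emeasure ?N {t<..}"
        by (simp add: add.commute)
      moreover have "?c * emeasure unif_ball {x::'a. norm x \<le> t} \<noteq> \<infinity>"
        by (simp add: ennreal_mult_eq_top_iff)
      ultimately show "emeasure ?M {t<..} = emeasure ?N {t<..}"
        by (simp add: ennreal_add_left_cancel)
    qed simp_all
    then have "emeasure ?M A = emeasure ?N A" by (simp only:)
    then have "emeasure unif_ball {x::'a. norm x \<in> A \<and> sgn x \<in> B} = ?c * emeasure unif_ball {x::'a. norm x \<in> A}"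
      unfolding eM[OF \<open>A \<in> sets borel\<close>] eN[OF \<open>A \<in> sets borel\<close>] .
    then show "emeasure (distr (unif_ball :: 'a measure) borel norm) A * emeasure (distr (unif_ball :: 'a measure) borel sgn) B
       = emeasure (distr unif_ball (borel \<Otimes>\<^sub>M borel) (\<lambda>x::'a. (norm x, sgn x))) (A \<times> B)"
      by (simp add: emeasure_distr vimage_def mult.commute)
  qed (simp_all add: N.sigma_finite_measure_axioms S.sigma_finite_measure_axioms cong: sets_pair_measure_cong)
qed

text \<open>Polar coordinates with two independent points: \<open>x\<close> supplies the radius and
  \<open>y\<close> the direction, so that both integrals are taken over the same measure.\<close>

lemma nn_integral_unif_ball_polar:
  fixes g :: "real \<Rightarrow> 'a::euclidean_space \<Rightarrow> ennreal"
  assumes [measurable]: "case_prod g \<in> borel_measurable (borel \<Otimes>\<^sub>M borel)"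
  shows "(\<integral>\<^sup>+x. g (norm x) (sgn x) \<partial>unif_ball) = (\<integral>\<^sup>+x. \<integral>\<^sup>+y. g (norm (x::'a)) (sgn y) \<partial>unif_ball \<partial>unif_ball)"
proof -
  have [measurable]: "sgn \<in> borel_measurable (borel :: 'a measure)"
    unfolding sgn_div_norm by measurable
  interpret prob_space "unif_ball :: 'a measure" by (rule prob_space_unif_ball)
  interpret S: prob_space "distr (unif_ball :: 'a measure) borel sgn"
    by (rule prob_space_distr) simp
  have "(\<integral>\<^sup>+x. g (norm x) (sgn x) \<partial>unif_ball) =
    (\<integral>\<^sup>+p. case_prod g p \<partial>distr unif_ball (borel \<Otimes>\<^sub>M borel) (\<lambda>x::'a. (norm x, sgn x)))"
    by (subst nn_integral_distr) auto
  also have "\<dots> = (\<integral>\<^sup>+r. \<integral>\<^sup>+z. g r z \<partial>distr unif_ball borel sgn \<partial>distr (unif_ball :: 'a measure) borel norm)"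
  proof -
    have "case_prod g \<in> borel_measurable (distr (unif_ball :: 'a measure) borel norm \<Otimes>\<^sub>M distr unif_ball borel sgn)"
      using assms by (simp cong: measurable_cong_sets sets_pair_measure_cong)
    from S.nn_integral_fst[OF this] show ?thesis
      unfolding unif_ball_polar by simp
  qed
  also have "\<dots> = (\<integral>\<^sup>+x. \<integral>\<^sup>+y. g (norm (x::'a)) (sgn y) \<partial>unif_ball \<partial>unif_ball)"
    by (subst nn_integral_distr, measurable) (subst nn_integral_distr, auto)
  finally show ?thesis .
qed

section \<open>Beta integrals of powers of 1 - |x|^2\<close>

lemma distributed_unif_ball_norm_power2:
  "distributed unif_ball lborel (\<lambda>x::complex ^ 'n::finite. (norm x)^2)
     (\<lambda>s. ennreal (real CARD('n) * s ^ (CARD('n) - 1) * indicator {0..1} s))"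
proof (rule distributedI_borel_atMost)
  let ?n = "CARD('n)"
  \<comment> \<open>The distribution function of |x|^2: the real dimension is 2n, so the ball of
    radius sqrt a has probability (sqrt a)^(2n) = a^n.\<close>
  define g where "g a = (if a < 0 then 0 else if a \<le> 1 then a ^ ?n else 1)" for a :: real
  have n: "0 < ?n" by simp
  show "AE s in lborel. 0 \<le> real ?n * s ^ (?n - 1) * indicator {0..1} s"
    by (auto simp: indicator_def)
  have FTC: "(\<integral>\<^sup>+s. ennreal (real ?n * s ^ (?n - 1)) * indicator {0..b} s \<partial>lborel) = ennreal (b ^ ?n)" if "0 \<le> b" for b
  proof -
    have "(\<integral>\<^sup>+s. ennreal (real ?n * s ^ (?n - 1)) * indicator {0..b} s \<partial>lborel) = ennreal (b ^ ?n - 0 ^ ?n)"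
      using that by (intro nn_integral_FTC_Icc) (auto intro!: derivative_eq_intros)
    then show ?thesis by (simp add: zero_power)
  qed
  show "(\<integral>\<^sup>+s. ennreal (real ?n * s ^ (?n - 1) * indicator {0..1} s * indicator {..a} s) \<partial>lborel) = ennreal (g a)" for a
  proof (cases "a < 0")
    case True
    then have "(\<integral>\<^sup>+s. ennreal (real ?n * s ^ (?n - 1) * indicator {0..1} s * indicator {..a} s) \<partial>lborel) = (\<integral>\<^sup>+s. 0 \<partial>(lborel :: real measure))"
      by (intro nn_integral_cong) (auto simp: indicator_def)
    then show ?thesis using True by (simp add: g_def)
  next
    case False
    then have "(\<integral>\<^sup>+s. ennreal (real ?n * s ^ (?n - 1) * indicator {0..1} s * indicator {..a} s) \<partial>lborel) =
      (\<integral>\<^sup>+s. ennreal (real ?n * s ^ (?n - 1)) * indicator {0..min a 1} s \<partial>lborel)"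
      by (intro nn_integral_cong) (auto simp: indicator_def)
    then show ?thesis using False FTC[of "min a 1"] by (auto simp: g_def min_def)
  qed
  show "emeasure unif_ball {x \<in> space unif_ball. (norm (x::complex ^ 'n))^2 \<le> a} = ennreal (g a)" for a
  proof (cases "a < 0")
    case True
    then have "{x \<in> space unif_ball. (norm (x::complex ^ 'n))^2 \<le> a} = {}"
      using zero_le_power2 by (auto simp: not_le intro: less_le_trans)
    then show ?thesis using True by (simp add: g_def)
  next
    case False
    then have sq: "(norm (x::complex ^ 'n))^2 \<le> a \<longleftrightarrow> norm x \<le> sqrt a" for x
      using real_le_rsqrt sqrt_ge_absD by (metis abs_norm_cancel real_sqrt_abs real_sqrt_le_iff)
    show ?thesis
    proof (cases "a \<le> 1")
      case True
      then have "sqrt a ^ (?n * 2) = a ^ ?n"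
        using False by (simp add: mult.commute[of _ 2] power_mult)
      then show ?thesis
        using False True by (simp add: sq emeasure_unif_ball_norm_le g_def)
    next
      case F: False
      have "emeasure unif_ball {x::complex ^ 'n. norm x \<le> sqrt a} = emeasure unif_ball (UNIV :: (complex ^ 'n) set)"
        using F less_imp_le[of 1 "sqrt a"]
        by (intro emeasure_eq_AE eventually_mono[OF AE_unif_ball]) (auto intro: order_trans[of _ 1])
      then show ?thesis
        using F prob_space.emeasure_space_1[OF prob_space_unif_ball[where 'a="complex ^ 'n"]] by (simp add: sq g_def)
    qed
  qed
qed simp_all

lemma nn_integral_unif_ball_weight:
  assumes b: "b > 0"
  shows "(\<integral>\<^sup>+x. ennreal ((1 - (norm (x::complex ^ 'n::finite))^2) powr (b - 1)) \<partial>unif_ball) =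
    ennreal (real CARD('n) * Beta (real CARD('n)) b)"
proof -
  let ?n = "CARD('n)"
  have n: "0 < ?n" by simp
  have "(\<integral>\<^sup>+x. ennreal ((1 - (norm (x::complex ^ 'n))^2) powr (b - 1)) \<partial>unif_ball) =
    (\<integral>\<^sup>+s. ennreal (real ?n * s ^ (?n - 1) * indicator {0..1} s) * ennreal ((1 - s) powr (b - 1)) \<partial>lborel)"
    by (rule distributed_nn_integral[OF distributed_unif_ball_norm_power2, symmetric]) simp
  also have "\<dots> = (\<integral>\<^sup>+s. ennreal (real ?n) * ennreal (indicator {0..1} s * (s powr (real ?n - 1) * (1 - s) powr (b - 1))) \<partial>lborel)"
  proof (intro nn_integral_cong_AE eventually_mono[OF AE_lborel_singleton[of 0]])
    \<comment> \<open>The point 0 is excluded because for n = 1 the two powers differ there: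
      \<open>0 ^ 0 = 1\<close> but \<open>0 powr 0 = 0\<close>.\<close>
    fix s :: real assume "s \<noteq> 0"
    then show "ennreal (real ?n * s ^ (?n - 1) * indicator {0..1} s) * ennreal ((1 - s) powr (b - 1)) =
        ennreal (real ?n) * ennreal (indicator {0..1} s * (s powr (real ?n - 1) * (1 - s) powr (b - 1)))"
      using n by (auto simp: indicator_def ennreal_mult'[symmetric] powr_realpow[symmetric] of_nat_diff ac_simps)
  qed
  also have "\<dots> = ennreal (real ?n) * (\<integral>\<^sup>+s. ennreal (indicator {0..1} s * (s powr (real ?n - 1) * (1 - s) powr (b - 1))) \<partial>lborel)"
    by (rule nn_integral_cmult) simp
  also have "(\<integral>\<^sup>+s. ennreal (indicator {0..1} s * (s powr (real ?n - 1) * (1 - s) powr (b - 1))) \<partial>lborel) = ennreal (Beta (real ?n) b)"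
    using nn_integral_has_integral_lebesgue[OF _ has_integral_Beta_real[of "real ?n" b]] n b by simp
  finally show ?thesis
    by (simp add: ennreal_mult'[symmetric])
qed

text \<open>The origin of the combinatorial constant: n Beta(n, n + 1) = n Gamma(n) Gamma(n + 1) /
  Gamma(2n + 1), the reciprocal of a central binomial coefficient.\<close>

lemma nn_integral_unif_ball_power:
  "(\<integral>\<^sup>+x. ennreal ((1 - (norm (x::complex ^ 'n::finite))^2) ^ CARD('n)) \<partial>unif_ball) =
    ennreal ((fact CARD('n))^2 / fact (2 * CARD('n)))"
proof -
  let ?n = "CARD('n)"
  have "(\<integral>\<^sup>+x. ennreal ((1 - (norm (x::complex ^ 'n))^2) ^ ?n) \<partial>unif_ball) =
     (\<integral>\<^sup>+x. ennreal ((1 - (norm (x::complex ^ 'n))^2) powr (real ?n + 1 - 1)) \<partial>unif_ball)"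
  proof (intro nn_integral_cong_AE eventually_mono[OF AE_unif_ball])
    fix x :: "complex ^ 'n" assume "norm x < 1"
    then show "ennreal ((1 - (norm x)^2) ^ ?n) = ennreal ((1 - (norm x)^2) powr (real ?n + 1 - 1))"
      using one_minus_norm_pos[of x] by (simp add: powr_realpow)
  qed
  also have "\<dots> = ennreal (real ?n * Beta (real ?n) (real ?n + 1))"
    by (rule nn_integral_unif_ball_weight) simp
  also have "real ?n * Beta (real ?n) (real ?n + 1) = (fact ?n)^2 / fact (2 * ?n)"
  proof -
    have 1: "Gamma (real ?n + 1) = fact ?n"
      using Gamma_fact[of ?n, where 'a=real] by (simp add: add.commute)
    have 2: "real ?n * Gamma (real ?n) = fact ?n"
    proof -
      have "0 < real ?n" by simp
      then have "real ?n \<notin> \<int>\<^sub>\<le>\<^sub>0"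
        by (auto elim!: nonpos_Ints_cases simp del: of_nat_0_less_iff)
      from Gamma_plus1[OF this] 1 show ?thesis by simp
    qed
    have 3: "Gamma (real ?n + (real ?n + 1)) = fact (2 * ?n)"
      using Gamma_fact[of "2 * ?n", where 'a=real] by (simp add: algebra_simps)
    show ?thesis
      unfolding Beta_def 1 3 using 2 by (simp add: power2_eq_square)
  qed
  finally show ?thesis .
qed

text \<open>The factor \<open>b k\<close> cancels the pole of Gamma at 0, since b Gamma(b) = Gamma(b
  + 1). This is the limit of the total mass of b h^(b-1) dV.\<close>

lemma tendsto_unif_ball_weight:
  "(\<lambda>k. b k * (real n * Beta (real n) (b k))) \<longlonglongrightarrow> real n"
  if b: "\<And>k. b k > 0" "b \<longlonglongrightarrow> 0" and n: "0 < n"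
proof -
  have nn: "real n \<notin> \<int>\<^sub>\<le>\<^sub>0"
    using n by (auto elim!: nonpos_Ints_cases)
  have bn: "b k \<notin> \<int>\<^sub>\<le>\<^sub>0" for k
    using b(1)[of k] by (auto elim!: nonpos_Ints_cases)
  have "b k * (real n * Beta (real n) (b k)) = real n * (Gamma (real n) * Gamma (b k + 1) / Gamma (real n + b k))" for k
    using Gamma_plus1[OF bn[of k]] by (simp add: Beta_def)
  moreover have "(\<lambda>k. real n * (Gamma (real n) * Gamma (b k + 1) / Gamma (real n + b k))) \<longlonglongrightarrow>
      real n * (Gamma (real n) * Gamma (0 + 1) / Gamma (real n + 0))"
    using nn by (intro tendsto_intros b) (auto simp: Gamma_eq_zero_iff)
  ultimately show ?thesis
    using nn by (simp add: Gamma_eq_zero_iff)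
qed

section \<open>Circular means\<close>

text \<open>What matters is the uniformity in the offset \<open>t\<close>: it will be the angle of a
  point of maximum modulus, and this point depends on \<open>N\<close>. The sum is periodic in
  \<open>t\<close> with period 1 / N, so the offset can be brought into the first cell, where
  uniform continuity on the unit interval compares the sum with its mean.\<close>

lemma periodic_riemann_sum:
  fixes g :: "real \<Rightarrow> real"
  assumes cont: "continuous_on UNIV g" and per: "\<And>x. g (x + 1) = g x" and e: "e > 0"
  shows "\<exists>N0>0. \<forall>N\<ge>N0. \<forall>t. \<bar>(\<Sum>k<N. g (t + real k / real N)) / real N - integral {0..1} g\<bar> \<le> e"
proof -
  have "uniformly_continuous_on {0..1} g"
    by (intro compact_uniformly_continuous continuous_on_subset[OF cont]) auto
  then obtain d where d: "d > 0" "\<And>x y. x \<in> {0..1} \<Longrightarrow> y \<in> {0..1} \<Longrightarrow> dist x y < d \<Longrightarrow> dist (g x) (g y) < e"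
    unfolding uniformly_continuous_on_def using e by metis
  obtain N0 where N0: "real N0 > 1 / d" using reals_Archimedean2 by blast
  have N0pos: "N0 > 0" using N0 d(1) by (cases N0) (auto simp: not_less[symmetric])
  have "\<bar>(\<Sum>k<N. g (t + real k / real N)) / real N - integral {0..1} g\<bar> \<le> e" if N: "N \<ge> N0" for N t
  proof -
    have Npos: "N > 0" using N N0pos by simp
    have dN: "1 / real N < d"
    proof -
      have "1 / d < real N" using N N0 by (meson less_le_trans of_nat_le_iff)
      then show ?thesis using d(1) Npos by (simp add: field_simps)
    qed
    define T where "T t = (\<Sum>k<N. g (t + real k / real N))" for t
    have shift1: "T (t + 1 / real N) = T t" for t
    proof -
      have "T (t + 1 / real N) = (\<Sum>k<N. g (t + real (Suc k) / real N))"
        unfolding T_def by (intro sum.cong) (auto simp: add_divide_distrib ac_simps)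
      also have "\<dots> = (\<Sum>k<Suc N. g (t + real k / real N)) - g t"
        by (subst sum.lessThan_Suc_shift) simp
      also have "\<dots> = T t"
        using Npos per[of t] by (simp add: T_def)
      finally show ?thesis .
    qed
    have shift_nat: "T (t + real j / real N) = T t" for t j
    proof (induction j)
      case (Suc j)
      then show ?case
        using shift1[of "t + real j / real N"] by (simp add: add_divide_distrib ac_simps)
    qed simp
    have shift: "T (t + of_int j / real N) = T t" for t j
    proof (cases "j \<ge> 0")
      case True
      then show ?thesis using shift_nat[of t "nat j"] by simp
    next
      case False
      then show ?thesis using shift_nat[of "t + of_int j / real N" "nat (- j)"] by simp
    qed
    \<comment> \<open>The representative of \<open>t\<close> modulo 1 / N in the first cell.\<close>
    define s where "s = t - of_int \<lfloor>t * real N\<rfloor> / real N"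
    have s: "0 \<le> s" "s \<le> 1 / real N"
    proof -
      have "s = frac (t * real N) / real N"
        using Npos by (simp add: s_def frac_def field_simps)
      then show "0 \<le> s" "s \<le> 1 / real N"
        using Npos frac_lt_1[of "t * real N"] by (auto simp: divide_right_mono less_imp_le)
    qed
    have Ts: "T t = T s"
      using shift[of s "\<lfloor>t * real N\<rfloor>"] by (simp add: s_def)
    have int_on: "g integrable_on {a..b}" for a b
      by (intro integrable_continuous_interval continuous_on_subset[OF cont]) auto
    have split: "integral {0..real j / real N} g = (\<Sum>k<j. integral {0..1 / real N} (\<lambda>u. g (u + real k / real N)))" for j
    proof (induction j)
      case (Suc j)
      have "integral {0..real (Suc j) / real N} g =
          integral {0..real j / real N} g + integral {real j / real N..real (Suc j) / real N} g"
        by (subst Henstock_Kurzweil_Integration.integral_combine) (auto intro: int_on divide_right_mono)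
      also have "integral {real j / real N..real (Suc j) / real N} g = integral {0..1 / real N} (\<lambda>u. g (u + real j / real N))"
        using integral_shift_Icc_real[of 0 "1 / real N" g "real j / real N"]
        by (simp add: add_divide_distrib o_def add.commute)
      finally show ?case using Suc by simp
    qed simp
    have "integral {0..1} g = (\<Sum>k<N. integral {0..1 / real N} (\<lambda>u. g (u + real k / real N)))"
      using split[of N] Npos by simp
    also have "\<dots> = integral {0..1 / real N} T"
      unfolding T_def
      by (intro Henstock_Kurzweil_Integration.integral_sum[symmetric] integrable_continuous_interval
          continuous_intros continuous_on_compose2[OF cont]) auto
    finally have int: "integral {0..1} g = integral {0..1 / real N} T" .
    have contT: "continuous_on A T" for A
      unfolding T_def by (intro continuous_intros continuous_on_compose2[OF cont]) auto
    have close: "\<bar>T u - T s\<bar> \<le> real N * e" if u: "u \<in> {0..1 / real N}" for u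
    proof -
      have "\<bar>T u - T s\<bar> \<le> (\<Sum>k<N. \<bar>g (u + real k / real N) - g (s + real k / real N)\<bar>)"
        unfolding T_def by (subst sum_subtractf[symmetric]) (rule sum_abs)
      also have "\<dots> \<le> (\<Sum>k<N. e)"
      proof (rule sum_mono)
        fix k assume "k \<in> {..<N}"
        then have k: "real k / real N + 1 / real N \<le> 1"
          using Npos by (simp add: field_simps)
        have "dist (g (u + real k / real N)) (g (s + real k / real N)) < e"
          using k u s dN Npos by (intro d(2)) (auto simp: dist_real_def)
        then show "\<bar>g (u + real k / real N) - g (s + real k / real N)\<bar> \<le> e"
          by (simp add: dist_real_def)
      qed
      finally show ?thesis by simp
    qed
    have "\<bar>integral {0..1 / real N} (\<lambda>u. T u - T s)\<bar> \<le> (real N * e) * (1 / real N - 0)"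
      using close by (intro integral_bound[where 'a=real, unfolded real_norm_def] continuous_intros contT) auto
    also have "integral {0..1 / real N} (\<lambda>u. T u - T s) = integral {0..1} g - T s / real N"
      unfolding int by (subst Henstock_Kurzweil_Integration.integral_diff)
        (auto intro!: integrable_continuous_interval contT)
    finally show ?thesis
      using Npos unfolding T_def[symmetric] Ts by (simp add: abs_minus_commute)
  qed
  then show ?thesis using N0pos by blast
qed

text \<open>Jensen's inequality, from the tangent line of \<open>exp\<close> at the mean.\<close>

lemma mean_exp_ge:
  fixes x :: "nat \<Rightarrow> real"
  assumes "N > 0"
  shows "exp ((\<Sum>k<N. x k) / real N) \<le> (\<Sum>k<N. exp (x k)) / real N"
proof -
  define a where "a = (\<Sum>k<N. x k) / real N"
  have "exp a * real N = (\<Sum>k<N. exp a * (1 + (x k - a)))"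
    using assms by (simp add: sum_distrib_left[symmetric] sum.distrib sum_subtractf a_def)
  also have "\<dots> \<le> (\<Sum>k<N. exp (x k))"
  proof (rule sum_mono)
    fix k
    have "exp a * (1 + (x k - a)) \<le> exp a * exp (x k - a)"
      by (intro mult_left_mono exp_ge_add_one_self) auto
    then show "exp a * (1 + (x k - a)) \<le> exp (x k)"
      by (simp add: exp_diff)
  qed
  finally show ?thesis
    using assms by (simp add: a_def field_simps)
qed

text \<open>The zeros of \<open>F\<close> play no role because the logarithm is only taken of the product of the values
  of \<open>F\<close> over all rotations by \<open>N\<close>-th roots of unity, at a point of the circle where the modulus of this
  product is at least \<open>|F(0)|^N\<close>.\<close>

lemma circle_mean_exp_weight:
  fixes F :: "complex \<Rightarrow> complex" and \<psi> :: "complex \<Rightarrow> real"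
  assumes hol: "F holomorphic_on S" and S: "open S" "cball 0 1 \<subseteq> S"
    and cont: "continuous_on (sphere 0 1) \<psi>"
  shows "(cmod (F 0))^2 * exp (- integral {0..1} (\<lambda>t. \<psi> (cis (2 * pi * t)))) \<le>
    integral {0..1} (\<lambda>t. (cmod (F (cis (2 * pi * t))))^2 * exp (- \<psi> (cis (2 * pi * t))))"
proof (cases "F 0 = 0")
  case True
  \<comment> \<open>The left side is 0. The right side is nonnegative in any case, because
    \<open>integral\<close> takes the value 0 on functions that are not integrable.\<close>
  then show ?thesis
    by (cases "(\<lambda>t. (cmod (F (cis (2 * pi * t))))^2 * exp (- \<psi> (cis (2 * pi * t)))) integrable_on {0..1}")
       (auto intro: Henstock_Kurzweil_Integration.integral_nonneg simp: not_integrable_integral)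
next
  case False
  define c where "c t = cis (2 * pi * t)" for t
  define g where "g t = \<psi> (c t)" for t
  define u where "u t = (cmod (F (c t)))^2 * exp (- \<psi> (c t))" for t
  have c1: "c (t + 1) = c t" for t
    by (simp add: c_def distrib_left complex_eq_iff)
  have cc: "continuous_on UNIV c"
    unfolding c_def by (intro continuous_intros)
  have contF: "continuous_on (sphere 0 1) F"
    by (rule holomorphic_on_imp_continuous_on, rule holomorphic_on_subset[OF hol]) (use S in auto)
  have contg: "continuous_on UNIV g"
    unfolding g_def by (rule continuous_on_compose2[OF cont cc]) (auto simp: c_def)
  have contu: "continuous_on UNIV u"
    unfolding u_def g_def[symmetric]
    by (intro continuous_intros contg continuous_on_compose2[OF contF cc]) (auto simp: c_def)
  have key: "(cmod (F 0))^2 * exp (- integral {0..1} g - e) \<le> integral {0..1} u + e" if e: "e > 0" for e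
  proof -
    obtain N1 where N1: "\<forall>N\<ge>N1. \<forall>t. \<bar>(\<Sum>k<N. g (t + real k / real N)) / real N - integral {0..1} g\<bar> \<le> e"
      using periodic_riemann_sum[OF contg _ e] c1 by (auto simp: g_def)
    obtain N2 where N2: "N2 > 0" "\<forall>N\<ge>N2. \<forall>t. \<bar>(\<Sum>k<N. u (t + real k / real N)) / real N - integral {0..1} u\<bar> \<le> e"
      using periodic_riemann_sum[OF contu _ e] c1 by (auto simp: u_def)
    define N where "N = max N1 N2"
    have N: "N > 0" using N2 by (simp add: N_def)
    define P where "P z = (\<Prod>k<N. F (c (real k / real N) * z))" for z
    have rot: "c s * z \<in> cball 0 1" if "z \<in> cball 0 1" for s z
      using that by (simp add: c_def norm_mult)
    have holP: "P holomorphic_on cball 0 1"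
      unfolding P_def
    proof (intro holomorphic_intros)
      fix k
      have "F \<circ> (\<lambda>z. c (real k / real N) * z) holomorphic_on cball 0 1"
        by (intro holomorphic_on_compose_gen[OF _ hol] holomorphic_intros) (use rot S in auto)
      then show "(\<lambda>z. F (c (real k / real N) * z)) holomorphic_on cball 0 1"
        by (simp add: o_def)
    qed
    have "\<exists>z\<in>sphere 0 1. cmod (P 0) \<le> cmod (P z)"
    proof -
      obtain z where z: "z \<in> sphere 0 1" "\<And>w. w \<in> sphere 0 1 \<Longrightarrow> cmod (P w) \<le> cmod (P z)"
        using continuous_attains_sup[of "sphere (0::complex) 1" "\<lambda>z. cmod (P z)"]
          holomorphic_on_imp_continuous_on[OF holP]
        by (metis compact_sphere continuous_on_norm continuous_on_subset sphere_cball sphere_eq_empty zero_le_one not_le)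
      have "cmod (P 0) \<le> cmod (P z)"
        by (rule maximum_modulus_frontier[of P "cball 0 1"])
           (use z holomorphic_on_imp_continuous_on[OF holP] holomorphic_on_subset[OF holP ball_subset_cball] in auto)
      with z show ?thesis by auto
    qed
    then obtain z where z: "cmod z = 1" "cmod (P 0) \<le> cmod (P z)" by auto
    define t where "t = Arg z / (2 * pi)"
    have zt: "z = c t"
      using z(1) cis_Arg[of z] by (cases "z = 0") (auto simp: t_def c_def sgn_eq)
    define x where "x k = c (t + real k / real N)" for k
    have xk: "c (real k / real N) * z = x k" for k
      by (simp add: zt x_def c_def cis_mult distrib_left add.commute)
    have prod: "cmod (F 0) ^ N \<le> (\<Prod>k<N. cmod (F (x k)))"
      using z(2) by (simp add: P_def xk prod_norm[symmetric] norm_power)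
    have pos: "cmod (F (x k)) > 0" if "k < N" for k
    proof (rule ccontr)
      assume "\<not> cmod (F (x k)) > 0"
      then have "(\<Prod>k<N. cmod (F (x k))) = 0"
        using that by (intro prod_zero) auto
      with prod have "cmod (F 0) ^ N \<le> 0" by simp
      moreover have "0 < cmod (F 0) ^ N" using False by simp
      ultimately show False by linarith
    qed
    have "real N * ln (cmod (F 0)) = ln (cmod (F 0) ^ N)"
      using False by (simp add: ln_realpow)
    also have "\<dots> \<le> ln (\<Prod>k<N. cmod (F (x k)))"
      using prod False pos by (subst ln_le_cancel_iff) (auto intro!: prod_pos)
    also have "\<dots> = (\<Sum>k<N. ln (cmod (F (x k))))"
      using pos by (intro ln_prod) auto
    finally have lnF: "ln (cmod (F 0)) \<le> (\<Sum>k<N. ln (cmod (F (x k)))) / real N"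
      using N by (simp add: field_simps)
    have "(cmod (F 0))^2 * exp (- integral {0..1} g - e) = exp (2 * ln (cmod (F 0)) - integral {0..1} g - e)"
      using False by (simp add: exp_diff exp_minus exp_double divide_inverse)
    also have "\<dots> \<le> exp ((\<Sum>k<N. 2 * ln (cmod (F (x k))) - \<psi> (x k)) / real N)"
    proof -
      have "(\<Sum>k<N. \<psi> (x k)) / real N \<le> integral {0..1} g + e"
        using N1[rule_format, of N t] by (simp add: N_def x_def g_def)
      then show ?thesis
        using lnF by (simp add: sum_subtractf diff_divide_distrib sum_distrib_left[symmetric])
    qed
    also have "\<dots> \<le> (\<Sum>k<N. exp (2 * ln (cmod (F (x k))) - \<psi> (x k))) / real N"
      by (rule mean_exp_ge[OF N])
    also have "\<dots> = (\<Sum>k<N. u (t + real k / real N)) / real N"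
      using pos by (intro arg_cong2[where f="(/)"] sum.cong) (auto simp: u_def x_def exp_diff exp_minus exp_double field_simps)
    also have "\<dots> \<le> integral {0..1} u + e"
      using N2(2)[rule_format, of N t] by (simp add: N_def)
    finally show ?thesis .
  qed
  have lim1: "((\<lambda>e. (cmod (F 0))^2 * exp (- integral {0..1} g - e)) \<longlongrightarrow> (cmod (F 0))^2 * exp (- integral {0..1} g - 0)) (at_right 0)"
    by (intro tendsto_intros)
  have lim2: "((\<lambda>e. integral {0..1} u + e) \<longlongrightarrow> integral {0..1} u + 0) (at_right 0)"
    by (intro tendsto_intros)
  have "\<forall>\<^sub>F e in at_right 0. (cmod (F 0))^2 * exp (- integral {0..1} g - e) \<le> integral {0..1} u + e"
    using eventually_at_right_less[of "0::real"] by eventually_elim (rule key)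
  from tendsto_le[OF _ lim2 lim1 this]
  have "(cmod (F 0))^2 * exp (- integral {0..1} g - 0) \<le> integral {0..1} u + 0"
    by simp
  then show ?thesis
    by (simp add: g_def[abs_def] u_def[abs_def] c_def)
qed

text \<open>Every rotation leaves the integral against \<open>m\<close> unchanged, hence so does the
  average over all rotations; Fubini applies because \<open>g\<close> is bounded.\<close>

lemma integral_circle_mean:
  fixes g :: "complex ^ 'n::finite \<Rightarrow> real"
  assumes "prob_space m" and sets [measurable_cong]: "sets m = sets borel"
    and inv: "\<And>t. distr m borel (\<lambda>x. cis t *s x) = m"
    and [measurable]: "g \<in> borel_measurable borel" and bdd: "\<And>x. \<bar>g x\<bar> \<le> K"
  shows "(LINT x|m. g x) = (LINT x|m. (LINT t|restrict_space lborel {0..1}. g (cis (2 * pi * t) *s x)))"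
    and "integrable m (\<lambda>x. LINT t|restrict_space lborel {0..1}. g (cis (2 * pi * t) *s x))"
proof -
  let ?U = "restrict_space lborel {0..1::real}"
  interpret m: prob_space m by fact
  interpret U: prob_space ?U
    by (rule prob_spaceI) (simp add: space_restrict_space emeasure_restrict_space)
  interpret P: pair_prob_space m ?U ..
  have m: "(\<lambda>(x, t). g (cis (2 * pi * t) *s x)) \<in> borel_measurable (m \<Otimes>\<^sub>M ?U)"
  proof -
    have [measurable]: "(\<lambda>t. cis (2 * pi * t)) \<in> borel_measurable borel"
      by (intro borel_measurable_continuous_onI continuous_intros)
    have [measurable]: "(\<lambda>t::real. t) \<in> borel_measurable ?U"
      by (rule measurable_restrict_space1) simp
    show ?thesis
      unfolding split_beta' by measurable
  qed
  have int: "integrable (m \<Otimes>\<^sub>M ?U) (\<lambda>(x, t). g (cis (2 * pi * t) *s x))"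
    by (rule P.integrable_const_bound[OF _ m, of K]) (use bdd in auto)
  have rot: "(LINT x|m. g (cis s *s x)) = (LINT x|m. g x)" for s
    by (subst (2) inv[of s, symmetric], subst integral_distr) auto
  have "(LINT x|m. (LINT t|?U. g (cis (2 * pi * t) *s x))) = (LINT t|?U. (LINT x|m. g (cis (2 * pi * t) *s x)))"
    by (rule P.Fubini_integral[OF int, symmetric])
  also have "\<dots> = (LINT x|m. g x)"
    unfolding rot using U.prob_space by (simp add: space_restrict_space)
  finally show "(LINT x|m. g x) = (LINT x|m. (LINT t|?U. g (cis (2 * pi * t) *s x)))" ..
  show "integrable m (\<lambda>x. LINT t|?U. g (cis (2 * pi * t) *s x))"
    by (rule P.integrable_fst'[OF int, simplified])
qed

lemma integral_restrict_unit_interval: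
  fixes f :: "real \<Rightarrow> real"
  assumes "continuous_on {0..1} f"
  shows "(LINT t|restrict_space lborel {0..1}. f t) = integral {0..1} f"
proof -
  have "(LINT t|restrict_space lborel {0..1}. f t) = (LINT t:{0..1}|lborel. f t)"
    by (subst integral_restrict_space) (auto simp: set_lebesgue_integral_def)
  also have "\<dots> = integral {0..1} f"
    by (rule set_borel_integral_eq_integral(2)[OF borel_integrable_atLeastAtMost'[OF assms]])
  finally show ?thesis .
qed

text \<open>Holomorphy is recorded only along complex lines through the origin, because only circles
  centred there are averaged. For norm x < 1 the domain in \<open>c\<close> is an open disc
  containing the closed unit disc, as the maximum principle on the circle requires.\<close>

definition slice_holomorphic :: "(complex ^ 'n::finite \<Rightarrow> complex) \<Rightarrow> bool" where
  "slice_holomorphic F \<longleftrightarrow>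
     (\<forall>x. norm x < 1 \<longrightarrow> (\<lambda>c. F (c *s x)) holomorphic_on {c. norm (c *s x) < 1})"

text \<open>On each circle \<open>circle_mean_exp_weight\<close> bounds the mean from below by the
  exponential of minus the circular mean of \<open>\<psi>\<close>. The estimate exp s \<ge> 1 + s,
  with s the difference of \<open>\<psi> 0\<close> and that mean, makes the bound linear, so that
  averaging over the circles leaves only the total mean of \<open>\<psi>\<close>.\<close>

theorem circular_mean_exp_weight:
  fixes F :: "complex ^ 'n::finite \<Rightarrow> complex" and \<psi> :: "complex ^ 'n \<Rightarrow> real"
  assumes "prob_space m" and sets [measurable_cong]: "sets m = sets borel"
    and inv: "\<And>t. distr m borel (\<lambda>x. cis t *s x) = m"
    and ball: "AE x in m. norm x < 1"
    and meas [measurable]: "F \<in> borel_measurable borel" "\<psi> \<in> borel_measurable borel"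
    and cont: "continuous_on (ball 0 1) F" "continuous_on (ball 0 1) \<psi>"
    and slice: "slice_holomorphic F"
    and bdd: "\<And>x. norm x < 1 \<Longrightarrow> cmod (F x) \<le> K" "\<And>x. norm x < 1 \<Longrightarrow> \<bar>\<psi> x\<bar> \<le> K"
  shows "(cmod (F 0))^2 * exp (- \<psi> 0) * (1 + \<psi> 0 - (LINT x|m. \<psi> x)) \<le>
     (LINT x|m. (cmod (F x))^2 * exp (- \<psi> x))"
proof -
  let ?U = "restrict_space lborel {0..1::real}"
  interpret m: prob_space m by fact
  \<comment> \<open>The cut-off outside the ball makes the integrands bounded everywhere, since
    nothing is known about \<open>F\<close> and \<open>\<psi>\<close> there.\<close>
  define g1 where "g1 x = (if norm x < 1 then (cmod (F x))^2 * exp (- \<psi> x) else 0)" for x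
  define g2 where "g2 x = (if norm x < 1 then \<psi> x else 0)" for x
  have [measurable]: "g1 \<in> borel_measurable borel" "g2 \<in> borel_measurable borel"
    unfolding g1_def g2_def by measurable
  have K: "K \<ge> 0"
    using order_trans[OF norm_ge_zero bdd(1)[of 0]] by simp
  have b1: "\<bar>g1 x\<bar> \<le> K^2 * exp K" for x
    using bdd(1)[of x] bdd(2)[of x] K by (auto simp: g1_def intro!: mult_mono power_mono)
  have b2: "\<bar>g2 x\<bar> \<le> K" for x
    using bdd(2)[of x] K by (auto simp: g2_def)
  let ?I = "\<lambda>g x. LINT t|?U. g (cis (2 * pi * t) *s x)"
  let ?c = "(cmod (F 0))^2 * exp (- \<psi> 0)"
  have le: "?c * (1 + \<psi> 0 - ?I g2 x) \<le> ?I g1 x" if x: "norm x < 1" for x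
  proof -
    let ?S = "{c. norm (c *s x) < 1}"
    have nc: "norm (cis t *s x) < 1" for t
      using x by (simp add: norm_smult)
    have S: "open ?S"
      unfolding norm_smult by (intro open_Collect_less continuous_intros)
    have "cball 0 1 \<subseteq> ?S"
      using x mult_right_mono[of _ 1 "norm x"] by (force simp: norm_smult)
    moreover have "continuous_on (sphere 0 1) (\<lambda>c. \<psi> (c *s x))"
      using x by (intro continuous_on_compose2[OF cont(2)] continuous_intros) (auto simp: norm_smult)
    ultimately have J: "(cmod (F (0 *s x)))^2 * exp (- integral {0..1} (\<lambda>t. \<psi> (cis (2 * pi * t) *s x))) \<le>
      integral {0..1} (\<lambda>t. (cmod (F (cis (2 * pi * t) *s x)))^2 * exp (- \<psi> (cis (2 * pi * t) *s x)))"
      using slice x S unfolding slice_holomorphic_def by (intro circle_mean_exp_weight) auto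
    have I1: "?I g1 x = integral {0..1} (\<lambda>t. (cmod (F (cis (2 * pi * t) *s x)))^2 * exp (- \<psi> (cis (2 * pi * t) *s x)))"
      unfolding g1_def using nc
      by (simp, intro integral_restrict_unit_interval continuous_intros continuous_on_compose2[OF cont(1)]
        continuous_on_compose2[OF cont(2)]) auto
    have I2: "?I g2 x = integral {0..1} (\<lambda>t. \<psi> (cis (2 * pi * t) *s x))"
      unfolding g2_def using nc
      by (simp, intro integral_restrict_unit_interval continuous_intros continuous_on_compose2[OF cont(2)]) auto
    have "?c * (1 + \<psi> 0 - ?I g2 x) \<le> ?c * exp (\<psi> 0 - ?I g2 x)"
      by (intro mult_left_mono) (use exp_ge_add_one_self[of "\<psi> 0 - ?I g2 x"] in linarith, simp)
    also have "\<dots> = (cmod (F 0))^2 * exp (- ?I g2 x)"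
      by (simp add: exp_add[symmetric])
    also have "\<dots> \<le> ?I g1 x"
      using J unfolding I1 I2 by simp
    finally show ?thesis .
  qed
  note C1 = integral_circle_mean[OF \<open>prob_space m\<close> sets inv \<open>g1 \<in> borel_measurable borel\<close> b1]
  note C2 = integral_circle_mean[OF \<open>prob_space m\<close> sets inv \<open>g2 \<in> borel_measurable borel\<close> b2]
  have "?c * (1 + \<psi> 0 - (LINT x|m. \<psi> x)) = ?c * (1 + \<psi> 0 - (LINT x|m. g2 x))"
  proof -
    have "(LINT x|m. \<psi> x) = (LINT x|m. g2 x)"
      by (intro integral_cong_AE eventually_mono[OF ball]) (auto simp: g2_def)
    then show ?thesis by simp
  qed
  also have "\<dots> = (LINT x|m. ?c * (1 + \<psi> 0 - ?I g2 x))"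
    using C2(2) by (simp add: m.prob_space C2(1)[symmetric])
  also have "\<dots> \<le> (LINT x|m. ?I g1 x)"
    using C1(2) C2(2) by (intro integral_mono_AE eventually_mono[OF ball le]) auto
  also have "\<dots> = (LINT x|m. (cmod (F x))^2 * exp (- \<psi> x))"
    unfolding C1(1)[symmetric] by (intro integral_cong_AE eventually_mono[OF ball]) (auto simp: g1_def)
  finally show ?thesis .
qed

section \<open>Second-order expansion of the means of the kernel\<close>

lemma powr_taylor_bound:
  fixes b :: real
  shows "\<exists>C d. 0 \<le> C \<and> 0 < d \<and>
    (\<forall>x. \<bar>x\<bar> \<le> d \<longrightarrow> (1 + x) powr b \<le> 1 + b * x + b * (b - 1) / 2 * x^2 + C * \<bar>x\<bar> ^ 3)"
proof -
  have "(\<lambda>x. (1 + x) powr b - (1 + b * x + b * (b - 1) / 2 * x^2)) \<in> O[at 0](\<lambda>x::real. x ^ 3)"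
    by real_asymp
  then obtain C where C: "C > 0"
    "eventually (\<lambda>x. \<bar>(1 + x) powr b - (1 + b * x + b * (b - 1) / 2 * x^2)\<bar> \<le> C * \<bar>x ^ 3\<bar>) (at 0)"
    by (elim landau_o.bigE) auto
  then obtain d where d: "d > 0"
    "\<And>x. x \<noteq> 0 \<Longrightarrow> \<bar>x\<bar> < d \<Longrightarrow> \<bar>(1 + x) powr b - (1 + b * x + b * (b - 1) / 2 * x^2)\<bar> \<le> C * \<bar>x ^ 3\<bar>"
    by (auto simp: eventually_at dist_real_def)
  have "(1 + x) powr b \<le> 1 + b * x + b * (b - 1) / 2 * x^2 + C * \<bar>x\<bar> ^ 3" if "\<bar>x\<bar> \<le> d / 2" for x
  proof (cases "x = 0")
    case False
    then show ?thesis using d(2)[of x] d(1) that by (simp add: power_abs abs_le_iff)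
  qed simp
  then show ?thesis
    using C(1) d(1) by (intro exI[of _ C] exI[of _ "d / 2"]) auto
qed

text \<open>With w = 2 Re q - |q|^2 the quotient is (1 - s) / (1 - w) = 1 + x. Up to errors of order
  r^3, x is w - s + 4 (Re q)^2 and x^2 is 4 (Re q)^2. Inserted into the Taylor polynomial of the
  power, the coefficients of (Re q)^2 add up to 4 b + 2 b (b - 1) = 2 b (b + 1).\<close>

lemma ratio_powr_bound:
  fixes b :: real
  shows "\<exists>C d. 0 \<le> C \<and> 0 < d \<and> d \<le> 1 / 4 \<and>
    (\<forall>r s q. 0 \<le> r \<longrightarrow> r \<le> d \<longrightarrow> 0 \<le> s \<longrightarrow> s \<le> r^2 \<longrightarrow> cmod q \<le> r \<longrightarrow>
      ((1 - s) / (cmod (1 - q))^2) powr b \<le>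
        1 + b * (2 * Re q - (cmod q)^2 - s) + 2 * b * (b + 1) * (Re q)^2 + C * r ^ 3)"
proof -
  obtain C0 d0 where C0: "0 \<le> C0" "0 < d0"
    "\<And>x. \<bar>x\<bar> \<le> d0 \<Longrightarrow> (1 + x) powr b \<le> 1 + b * x + b * (b - 1) / 2 * x^2 + C0 * \<bar>x\<bar> ^ 3"
    using powr_taylor_bound[of b] by auto
  \<comment> \<open>125 = 120 + 5 bounds the third-order error of \<open>x\<close>, 738 = 41 * 18
    that of \<open>x^2\<close>, and 4096 = 16^3 comes from |x| \<le> 16 r. In \<open>d\<close>, the
    bound 1 / 4 keeps 1 - w at least 1 / 4, and d0 / 16 keeps |x| below \<open>d0\<close>.\<close>
  define C where "C = \<bar>b\<bar> * 125 + \<bar>b * (b - 1) / 2\<bar> * 738 + C0 * 4096"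
  define d where "d = min (1 / 4) (d0 / 16)"
  have bound: "((1 - s) / (cmod (1 - q))^2) powr b \<le>
        1 + b * (2 * Re q - (cmod q)^2 - s) + 2 * b * (b + 1) * (Re q)^2 + C * r ^ 3"
    if r: "0 \<le> r" "r \<le> d" and s: "0 \<le> s" "s \<le> r^2" and q: "cmod q \<le> r" for r s q
  proof -
    have r4: "r \<le> 1 / 4" "16 * r \<le> d0" using r by (auto simp: d_def)
    define a where "a = Re q"
    define t where "t = (cmod q)^2"
    define w where "w = 2 * a - t"
    define x where "x = (w - s) / (1 - w)"
    have a: "\<bar>a\<bar> \<le> r" using abs_Re_le_cmod[of q] q by (simp add: a_def)
    have t: "0 \<le> t" "t \<le> r^2" using q by (auto simp: t_def intro: power_mono)
    have r2: "r^2 \<le> r / 4" using mult_left_mono[OF r4(1) r(1)] by (simp add: power2_eq_square)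
    have r3: "0 \<le> r ^ 3" "r * r^2 = r ^ 3" using r by (auto simp: power3_eq_cube power2_eq_square)
    have w: "\<bar>w\<bar> \<le> 3 * r" unfolding w_def using a t r2 r by linarith
    have w1: "1 - w \<ge> 1 / 4" using w r4 by linarith
    have "1 - w = (cmod (1 - q))^2"
      unfolding w_def t_def a_def cmod_power2 by (simp add: algebra_simps power2_eq_square)
    then have X: "(1 - s) / (cmod (1 - q))^2 = 1 + x"
      using w1 by (simp add: x_def field_simps)
    have div4: "\<bar>z / (1 - w)\<bar> \<le> 4 * \<bar>z\<bar>" for z
    proof -
      have "\<bar>z\<bar> * 1 \<le> \<bar>z\<bar> * (4 * (1 - w))" using w1 by (intro mult_left_mono) auto
      then show ?thesis using w1 by (simp add: abs_divide field_simps)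
    qed
    have w2: "w^2 \<le> 9 * r^2" using power_mono[OF w, of 2] by (simp add: power_mult_distrib)
    have sw: "\<bar>s * w\<bar> \<le> 3 * r ^ 3"
      using mult_mono[of s "r^2" "\<bar>w\<bar>" "3 * r"] s w r3 by (simp add: abs_mult ac_simps)
    have w3: "\<bar>w ^ 3\<bar> \<le> 27 * r ^ 3"
      using power_mono[OF w, of 3] by (simp add: power_mult_distrib power_abs)
    have e: "x - (w - s + w^2) = (w ^ 3 - s * w) / (1 - w)"
      using w1 by (simp add: x_def field_simps power2_eq_square power3_eq_cube)
    have x1: "\<bar>x - (w - s + w^2)\<bar> \<le> 120 * r ^ 3"
      unfolding e
      using order_trans[OF abs_triangle_ineq4 add_mono[OF w3 sw]] by (intro order_trans[OF div4]) simp
    have "\<bar>w - s\<bar> \<le> 4 * r" using w s r2 r by linarith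
    then have xb: "\<bar>x\<bar> \<le> 16 * r"
      unfolding x_def by (intro order_trans[OF div4]) simp
    have r34: "r ^ 3 \<le> r^2 / 4" using mult_right_mono[OF r4(1), of "r^2"] r3 by simp
    have "x - 2 * a = (x - (w - s + w^2)) + (w^2 - t - s)"
      by (simp add: w_def)
    then have xa: "\<bar>x - 2 * a\<bar> \<le> 41 * r^2"
      using x1 w2 t s r34 zero_le_power2[of w] by linarith
    have xa2: "\<bar>x + 2 * a\<bar> \<le> 18 * r" using xb a by linarith
    have "x^2 - 4 * a^2 = (x - 2 * a) * (x + 2 * a)"
      by (simp add: algebra_simps power2_eq_square)
    then have x2: "\<bar>x^2 - 4 * a^2\<bar> \<le> 738 * r ^ 3"
      using mult_mono[OF xa xa2] r3 by (simp add: abs_mult ac_simps)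
    have "\<bar>t - 4 * a\<bar> \<le> 5 * r" using t a r2 r by linarith
    then have "\<bar>t * (t - 4 * a)\<bar> \<le> r^2 * (5 * r)"
      using t unfolding abs_mult by (intro mult_mono) auto
    moreover have "w^2 - 4 * a^2 = t * (t - 4 * a)"
      by (simp add: w_def algebra_simps power2_eq_square)
    ultimately have w4: "\<bar>w^2 - 4 * a^2\<bar> \<le> 5 * r ^ 3"
      using r3 by (simp add: ac_simps)
    have x3: "\<bar>x\<bar> ^ 3 \<le> 4096 * r ^ 3"
      using power_mono[OF xb, of 3] by (simp add: power_mult_distrib)
    have A: "b * x \<le> b * (w - s + 4 * a^2) + \<bar>b\<bar> * (125 * r ^ 3)"
    proof -
      have "\<bar>x - (w - s + 4 * a^2)\<bar> \<le> 125 * r ^ 3"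
        using x1 w4 by linarith
      then have "\<bar>b * (x - (w - s + 4 * a^2))\<bar> \<le> \<bar>b\<bar> * (125 * r ^ 3)"
        unfolding abs_mult by (intro mult_left_mono) auto
      moreover have "b * x = b * (w - s + 4 * a^2) + b * (x - (w - s + 4 * a^2))"
        by (simp add: algebra_simps)
      ultimately show ?thesis by linarith
    qed
    have B: "b * (b - 1) / 2 * x^2 \<le> b * (b - 1) / 2 * (4 * a^2) + \<bar>b * (b - 1) / 2\<bar> * (738 * r ^ 3)"
    proof -
      have "\<bar>b * (b - 1) / 2 * (x^2 - 4 * a^2)\<bar> \<le> \<bar>b * (b - 1) / 2\<bar> * (738 * r ^ 3)"
        unfolding abs_mult[of _ "x^2 - 4 * a^2"] using x2 by (intro mult_left_mono) auto
      moreover have "b * (b - 1) / 2 * x^2 = b * (b - 1) / 2 * (4 * a^2) + b * (b - 1) / 2 * (x^2 - 4 * a^2)"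
        by (simp add: algebra_simps)
      ultimately show ?thesis by linarith
    qed
    have "(1 + x) powr b \<le> 1 + b * x + b * (b - 1) / 2 * x^2 + C0 * \<bar>x\<bar> ^ 3"
      using xb r4 by (intro C0(3)) auto
    also have "\<dots> \<le> 1 + (b * (w - s + 4 * a^2) + \<bar>b\<bar> * (125 * r ^ 3)) +
        (b * (b - 1) / 2 * (4 * a^2) + \<bar>b * (b - 1) / 2\<bar> * (738 * r ^ 3)) + C0 * (4096 * r ^ 3)"
      using A B mult_left_mono[OF x3 C0(1)] by linarith
    also have "\<dots> = 1 + b * (2 * a - t - s) + 2 * b * (b + 1) * a^2 + C * r ^ 3"
      unfolding C_def w_def by (simp add: field_simps power2_eq_square)
    finally show ?thesis
      unfolding X by (simp add: a_def t_def)
  qed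
  show ?thesis
    using bound C0(1,2)
    by (intro exI[of _ C] exI[of _ d]) (auto simp: C_def d_def)
qed

section \<open>Second moments of normalized volume\<close>

definition ball_moment :: "'n::finite itself \<Rightarrow> real" where
  "ball_moment _ = (LINT x|unif_ball. (norm (x :: complex ^ 'n))^2)"

lemma integrable_unif_ball_bounded:
  fixes f :: "'a::euclidean_space \<Rightarrow> real"
  assumes [measurable]: "f \<in> borel_measurable borel" and "\<And>x. norm x < 1 \<Longrightarrow> \<bar>f x\<bar> \<le> K"
  shows "integrable unif_ball f"
proof -
  interpret prob_space "unif_ball :: 'a measure" by (rule prob_space_unif_ball)
  show ?thesis
    using assms(2) by (intro integrable_const_bound[where B=K] eventually_mono[OF AE_unif_ball]) auto
qed

text \<open>Positivity is what permits division: the moment is a common factor of the second-order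
  terms that are compared later, and it cancels there.\<close>

lemma ball_moment_pos: "0 < ball_moment TYPE('n::finite)"
proof -
  interpret prob_space "unif_ball :: (complex ^ 'n) measure" by (rule prob_space_unif_ball)
  have int: "integrable unif_ball (\<lambda>x::complex ^ 'n. (norm x)^2)"
    by (rule integrable_unif_ball_bounded[of _ 1]) (auto simp: power_le_one)
  have "ball_moment TYPE('n) \<noteq> 0"
  proof
    assume "ball_moment TYPE('n) = 0"
    then have "AE x::complex ^ 'n in unif_ball. (norm x)^2 = 0"
      unfolding ball_moment_def using integral_nonneg_eq_0_iff_AE[OF int] by simp
    then have "AE x::complex ^ 'n in unif_ball. norm x \<le> 0"
      by eventually_elim simp
    then have "emeasure unif_ball {x::complex ^ 'n. norm x \<le> 0} = 1"
      by (intro emeasure_eq_1_AE) auto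
    then show False
      using emeasure_unif_ball_norm_le[of 0, where 'a="complex ^ 'n"] by (simp add: power_0_left)
  qed
  moreover have "0 \<le> ball_moment TYPE('n)"
    unfolding ball_moment_def by (rule Bochner_Integration.integral_nonneg) simp
  ultimately show ?thesis by simp
qed

lemma borel_measurable_vec_nth [measurable (raw)]:
  fixes f :: "'a \<Rightarrow> complex ^ 'n::finite"
  assumes "f \<in> borel_measurable M"
  shows "(\<lambda>x. f x $ i) \<in> borel_measurable M"
  by (rule measurable_compose[OF assms]) (intro borel_measurable_continuous_onI continuous_intros)

text \<open>Transposing two coordinates is an isometry, so all coordinates have the same second
  moment, and these moments add up to \<open>ball_moment\<close>.\<close>

lemma unif_ball_coordinate_moment:
  "(LINT x|unif_ball. (cmod ((x :: complex ^ 'n::finite) $ i))^2) = ball_moment TYPE('n) / real CARD('n)"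
proof -
  let ?e = "\<lambda>i. LINT x|unif_ball. (cmod ((x :: complex ^ 'n) $ i))^2"
  have le1: "(cmod (x $ i))^2 \<le> 1" if "norm x < 1" for x :: "complex ^ 'n" and i
    using Finite_Cartesian_Product.norm_nth_le[of x i] that by (intro power_le_one norm_ge_zero) linarith
  have eq: "?e j = ?e i" for j
  proof -
    let ?T = "\<lambda>x :: complex ^ 'n. \<chi> k. x $ Transposition.transpose i j k"
    have "norm (?T x) = norm x" for x
    proof -
      have "(\<Sum>k\<in>UNIV. (cmod (x $ Transposition.transpose i j k))^2) = (\<Sum>k\<in>UNIV. (cmod (x $ k))^2)"
        by (rule sum.reindex_bij_betw[OF bij_transpose])
      then have "(norm (?T x))^2 = (norm x)^2"
        by (simp add: norm_power2_vec)
      then show ?thesis by (simp add: power2_eq_iff_nonneg)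
    qed
    moreover have "linear ?T"
      by (rule linearI) (simp_all add: vec_eq_iff)
    ultimately show ?thesis
      using integral_unif_ball_isometry[of ?T "\<lambda>x. (cmod (x $ i))^2"] by simp
  qed
  have "ball_moment TYPE('n) = (\<Sum>j\<in>UNIV. ?e j)"
    unfolding ball_moment_def norm_power2_vec
    by (rule Bochner_Integration.integral_sum, rule integrable_unif_ball_bounded[of _ 1]) (simp_all add: le1)
  also have "\<dots> = (\<Sum>j\<in>(UNIV :: 'n set). ?e i)"
    by (rule sum.cong[OF refl eq])
  finally show ?thesis
    by simp
qed

text \<open>Changing the sign of the coordinate \<open>i\<close> is an isometry that reverses the
  sign of the integrand.\<close>

lemma unif_ball_cross_moment:
  assumes "i \<noteq> j"
  shows "(LINT x|unif_ball. Re (a * ((x :: complex ^ 'n::finite) $ i * cnj (x $ j)))) = 0"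
proof -
  let ?T = "\<lambda>x :: complex ^ 'n. \<chi> k. if k = i then - x $ k else x $ k"
  have "norm (?T x) = norm x" for x
  proof -
    have "(norm (?T x))^2 = (norm x)^2"
      unfolding norm_power2_vec by (intro sum.cong) auto
    then show ?thesis by (simp add: power2_eq_iff_nonneg)
  qed
  moreover have "linear ?T"
    by (rule linearI) (simp_all add: vec_eq_iff)
  ultimately have "(LINT x|unif_ball. Re (a * (?T x $ i * cnj (?T x $ j)))) =
      (LINT x|unif_ball. Re (a * ((x :: complex ^ 'n) $ i * cnj (x $ j))))"
    by (intro integral_unif_ball_isometry) auto
  moreover have eq: "Re (a * (?T x $ i * cnj (?T x $ j))) = - Re (a * (x $ i * cnj (x $ j)))" for x
    using assms by simp
  ultimately show ?thesis
    unfolding eq Bochner_Integration.integral_minus by linarith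
qed

text \<open>The reflection x -> -x kills the first moment. Multiplication by the imaginary unit
  interchanges the squares of real and imaginary part, so the real part carries half of the second
  moment.\<close>

lemma unif_ball_herm_moments:
  fixes v :: "complex ^ 'n::finite"
  shows "(LINT x|unif_ball. Re (herm x v)) = 0"
    and "(LINT x|unif_ball. (cmod (herm x v))^2) = (norm v)^2 * ball_moment TYPE('n) / real CARD('n)"
    and "(LINT x|unif_ball. (Re (herm x v))^2) = (norm v)^2 * ball_moment TYPE('n) / (2 * real CARD('n))"
proof -
  have rot: "(LINT x|unif_ball. f (c *s x)) = (LINT x|unif_ball. f x)" if "cmod c = 1" "f \<in> borel_measurable borel"
    for c and f :: "complex ^ 'n \<Rightarrow> real"
    using that by (intro integral_unif_ball_isometry linear_smult) (auto simp: norm_smult)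
  show "(LINT x|unif_ball. Re (herm x v)) = 0"
    using rot[of "-1" "\<lambda>x. Re (herm x v)"] by (simp add: herm_def sum_negf)
  have cb: "cmod (herm x v) \<le> norm v" if "norm x < 1" for x
    using cmod_herm_le[of x v] mult_right_mono[of "norm x" 1 "norm v"] that by simp
  have cb2: "(cmod (herm x v))^2 \<le> (norm v)^2" if "norm x < 1" for x
    using cb[OF that] by (intro power_mono) auto
  have comp: "cmod (x $ i) \<le> 1" if "norm x < 1" for x :: "complex ^ 'n" and i
    using Finite_Cartesian_Product.norm_nth_le[of x i] that by linarith
  let ?t = "\<lambda>x i j. Re ((cnj (v $ i) * v $ j) * (x $ i * cnj (x $ j)))"
  have expand: "(cmod (herm x v))^2 = (\<Sum>i\<in>UNIV. \<Sum>j\<in>UNIV. ?t x i j)" for x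
  proof -
    have "complex_of_real ((cmod (herm x v))^2) = herm x v * cnj (herm x v)"
      by (rule complex_norm_square)
    also have "\<dots> = (\<Sum>i\<in>UNIV. \<Sum>j\<in>UNIV. (cnj (v $ i) * v $ j) * (x $ i * cnj (x $ j)))"
      unfolding herm_def cnj_sum sum_product by (intro sum.cong refl) simp
    finally have "Re (complex_of_real ((cmod (herm x v))^2)) = Re (\<Sum>i\<in>UNIV. \<Sum>j\<in>UNIV. (cnj (v $ i) * v $ j) * (x $ i * cnj (x $ j)))"
      by (rule arg_cong)
    then show ?thesis by simp
  qed
  have int: "integrable unif_ball (\<lambda>x::complex ^ 'n. ?t x i j)" for i j
  proof (rule integrable_unif_ball_bounded[of _ "cmod (cnj (v $ i) * v $ j)"])
    fix x :: "complex ^ 'n" assume "norm x < 1"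
    then have "cmod (x $ i * cnj (x $ j)) \<le> 1"
      using comp[of x i] comp[of x j] by (simp add: norm_mult mult_le_one)
    then have "cmod (cnj (v $ i) * v $ j) * cmod (x $ i * cnj (x $ j)) \<le> cmod (cnj (v $ i) * v $ j)"
      by (rule mult_left_le) simp
    then show "\<bar>?t x i j\<bar> \<le> cmod (cnj (v $ i) * v $ j)"
      using abs_Re_le_cmod[of "(cnj (v $ i) * v $ j) * (x $ i * cnj (x $ j))"]
      unfolding norm_mult[of "cnj (v $ i) * v $ j"] by linarith
  qed simp
  have diag: "(LINT x|unif_ball. ?t x i j) = (if i = j then (cmod (v $ i))^2 * (ball_moment TYPE('n) / real CARD('n)) else 0)" for i j
  proof (cases "i = j")
    case True
    have "?t x i i = (cmod (v $ i))^2 * (cmod (x $ i))^2" for x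
      by (simp add: cmod_power2) (simp add: algebra_simps power2_eq_square)
    then show ?thesis
      using True unif_ball_coordinate_moment[of i] by simp
  next
    case False
    then show ?thesis unfolding unif_ball_cross_moment[OF False] by simp
  qed
  have "(LINT x|unif_ball. (cmod (herm x v))^2) = (\<Sum>i\<in>UNIV. \<Sum>j\<in>UNIV. LINT x|unif_ball. ?t x i j)"
    unfolding expand using int by (simp add: Bochner_Integration.integral_sum)
  also have "\<dots> = (\<Sum>i\<in>UNIV. (cmod (v $ i))^2 * (ball_moment TYPE('n) / real CARD('n)))"
    unfolding diag by simp
  also have "\<dots> = (norm v)^2 * ball_moment TYPE('n) / real CARD('n)"
    by (simp add: norm_power2_vec sum_distrib_right sum_divide_distrib)
  finally show E: "(LINT x|unif_ball. (cmod (herm x v))^2) = (norm v)^2 * ball_moment TYPE('n) / real CARD('n)" .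
  have "(LINT x|unif_ball. (Im (herm x v))^2) = (LINT x|unif_ball. (Re (herm x v))^2)"
    using rot[of \<i> "\<lambda>x. (Re (herm x v))^2"] by (simp add: herm_smult_left)
  moreover have "(LINT x|unif_ball. (cmod (herm x v))^2) = (LINT x|unif_ball. (Re (herm x v))^2) + (LINT x|unif_ball. (Im (herm x v))^2)"
    unfolding cmod_power2
  proof (intro Bochner_Integration.integral_add; rule integrable_unif_ball_bounded[of _ "(norm v)^2"])
    fix x :: "complex ^ 'n" assume x: "norm x < 1"
    show "\<bar>(Re (herm x v))^2\<bar> \<le> (norm v)^2" "\<bar>(Im (herm x v))^2\<bar> \<le> (norm v)^2"
      using cb2[OF x] zero_le_power2[of "Re (herm x v)"] zero_le_power2[of "Im (herm x v)"]
      unfolding cmod_power2 by linarith+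
  qed simp_all
  ultimately show "(LINT x|unif_ball. (Re (herm x v))^2) = (norm v)^2 * ball_moment TYPE('n) / (2 * real CARD('n))"
    using E by simp
qed

text \<open>The linear term has mean 0, and the quadratic ones combine to b^2 |v|^2 / n - b. Two
  exponents are used later: b = n gives - n (1 - |v|^2), the decrease of the potential, and b = n +
  e with |v| \<le> 1 gives at most (n + e) e / n, the small growth of the weight. The right side is
  nonnegative because it dominates the mean of a nonnegative function.\<close>

lemma unif_ball_mean_ratio_bound:
  fixes b :: real
  shows "\<exists>C d. 0 \<le> C \<and> 0 < d \<and> d \<le> 1 / 4 \<and>
    (\<forall>r (v :: complex ^ 'n::finite). 0 < r \<longrightarrow> r \<le> d \<longrightarrow> norm v \<le> 1 \<longrightarrow>
      0 \<le> 1 + ball_moment TYPE('n) * r^2 * (b^2 * (norm v)^2 / real CARD('n) - b) + C * r ^ 3 \<and>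
      (\<integral>\<^sup>+x. ennreal (((1 - (norm (r *\<^sub>R x))^2) / (cmod (1 - herm (r *\<^sub>R x) v))^2) powr b) \<partial>unif_ball) \<le>
      ennreal (1 + ball_moment TYPE('n) * r^2 * (b^2 * (norm v)^2 / real CARD('n) - b) + C * r ^ 3))"
proof -
  interpret prob_space "unif_ball :: (complex ^ 'n) measure" by (rule prob_space_unif_ball)
  obtain C d where Cd: "0 \<le> C" "0 < d" "d \<le> 1 / 4"
    "\<And>r s q. 0 \<le> r \<Longrightarrow> r \<le> d \<Longrightarrow> 0 \<le> s \<Longrightarrow> s \<le> r^2 \<Longrightarrow> cmod q \<le> r \<Longrightarrow>
      ((1 - s) / (cmod (1 - q))^2) powr b \<le>
        1 + b * (2 * Re q - (cmod q)^2 - s) + 2 * b * (b + 1) * (Re q)^2 + C * r ^ 3"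
    using ratio_powr_bound[of b] by blast
  have main: "0 \<le> 1 + ball_moment TYPE('n) * r^2 * (b^2 * (norm v)^2 / real CARD('n) - b) + C * r ^ 3 \<and>
      (\<integral>\<^sup>+x. ennreal (((1 - (norm (r *\<^sub>R x))^2) / (cmod (1 - herm (r *\<^sub>R x) v))^2) powr b) \<partial>unif_ball) \<le>
      ennreal (1 + ball_moment TYPE('n) * r^2 * (b^2 * (norm v)^2 / real CARD('n) - b) + C * r ^ 3)"
    if r: "0 < r" "r \<le> d" and v: "norm v \<le> 1" for r and v :: "complex ^ 'n"
  proof -
    let ?A = "\<lambda>x. Re (herm x v)" and ?B = "\<lambda>x. (cmod (herm x v))^2" and ?D = "\<lambda>x. (Re (herm x v))^2"
    let ?g = "\<lambda>x. 1 + b * (2 * (r * ?A x) - r^2 * ?B x - r^2 * (norm x)^2) + 2 * b * (b + 1) * (r^2 * ?D x) + C * r ^ 3"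
    have cb: "cmod (herm x v) \<le> 1" if "norm x < 1" for x
      using cmod_herm_lt_1[of x v] that v by simp
    have int: "integrable unif_ball ?A" "integrable unif_ball ?B" "integrable unif_ball ?D"
        "integrable unif_ball (\<lambda>x::complex ^ 'n. (norm x)^2)"
    proof -
      have "\<bar>Re (herm x v)\<bar> \<le> 1" if "norm x < 1" for x
        using abs_Re_le_cmod[of "herm x v"] cb[OF that] by linarith
      then show "integrable unif_ball ?A" "integrable unif_ball ?D"
        by (auto intro!: integrable_unif_ball_bounded[of _ 1] simp: abs_square_le_1)
      show "integrable unif_ball ?B" "integrable unif_ball (\<lambda>x::complex ^ 'n. (norm x)^2)"
        using cb by (auto intro!: integrable_unif_ball_bounded[of _ 1] simp: power_le_one)
    qed
    have le: "((1 - (norm (r *\<^sub>R x))^2) / (cmod (1 - herm (r *\<^sub>R x) v))^2) powr b \<le> ?g x" if x: "norm x < 1" for x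
    proof -
      have "(norm (r *\<^sub>R x))^2 \<le> r^2"
        using x r by (simp add: power_mult_distrib mult_left_le power_le_one)
      moreover have "cmod (herm (r *\<^sub>R x) v) \<le> r"
        using cb[OF x] r by (simp add: herm_scaleR_left norm_mult mult_left_le)
      ultimately have "((1 - (norm (r *\<^sub>R x))^2) / (cmod (1 - herm (r *\<^sub>R x) v))^2) powr b \<le>
        1 + b * (2 * Re (herm (r *\<^sub>R x) v) - (cmod (herm (r *\<^sub>R x) v))^2 - (norm (r *\<^sub>R x))^2)
          + 2 * b * (b + 1) * (Re (herm (r *\<^sub>R x) v))^2 + C * r ^ 3"
        using r by (intro Cd(4)) auto
      also have "\<dots> = ?g x"
        using r by (simp add: herm_scaleR_left norm_mult power_mult_distrib)
      finally show ?thesis .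
    qed
    have "(\<integral>\<^sup>+x. ennreal (((1 - (norm (r *\<^sub>R x))^2) / (cmod (1 - herm (r *\<^sub>R x) v))^2) powr b) \<partial>unif_ball) \<le>
        (\<integral>\<^sup>+x. ennreal (?g x) \<partial>unif_ball)"
      by (intro nn_integral_mono_AE eventually_mono[OF AE_unif_ball] ennreal_leI le)
    also have "\<dots> = ennreal (LINT x|unif_ball. ?g x)"
      using int by (intro nn_integral_eq_integral eventually_mono[OF AE_unif_ball])
        (auto intro!: order_trans[OF powr_ge_zero le])
    finally have le_int: "(\<integral>\<^sup>+x. ennreal (((1 - (norm (r *\<^sub>R x))^2) / (cmod (1 - herm (r *\<^sub>R x) v))^2) powr b) \<partial>unif_ball) \<le>
        ennreal (LINT x|unif_ball. ?g x)" .
    have nonneg: "0 \<le> (LINT x|unif_ball. ?g x)"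
      by (intro Bochner_Integration.integral_nonneg_AE eventually_mono[OF AE_unif_ball])
         (auto intro!: order_trans[OF powr_ge_zero le])
    have "(LINT x|unif_ball. ?g x) = 1 + b * (2 * (r * (LINT x|unif_ball. ?A x)) - r^2 * (LINT x|unif_ball. ?B x)
        - r^2 * ball_moment TYPE('n)) + 2 * b * (b + 1) * (r^2 * (LINT x|unif_ball. ?D x)) + C * r ^ 3"
      using int prob_space unfolding ball_moment_def by simp
    also have "\<dots> = 1 + ball_moment TYPE('n) * r^2 * (b^2 * (norm v)^2 / real CARD('n) - b) + C * r ^ 3"
      unfolding unif_ball_herm_moments by (simp add: field_simps power2_eq_square)
    finally show ?thesis using le_int nonneg by simp
  qed
  show ?thesis
    using Cd(1-3) main by (intro exI[of _ C] exI[of _ d]) auto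
qed

section \<open>Potentials\<close>

text \<open>The n-th root of |k_l(z)|^2, where k_l is the normalized reproducing kernel.\<close>

definition herm_kernel :: "complex ^ 'n::finite \<Rightarrow> complex ^ 'n \<Rightarrow> real" where
  "herm_kernel l z = (1 - (norm l)^2) / (cmod (1 - herm l z))^2"

lemma borel_measurable_herm_kernel [measurable (raw)]:
  assumes [measurable]: "f \<in> borel_measurable M" "g \<in> borel_measurable M"
  shows "(\<lambda>x. herm_kernel (f x) (g x)) \<in> borel_measurable M"
  unfolding herm_kernel_def by measurable

lemma cmod_one_minus_herm_commute: "cmod (1 - herm x y) = cmod (1 - herm y x)"
  by (subst herm_commute) (metis complex_cnj_diff complex_cnj_one complex_mod_cnj)

lemma herm_kernel_nonneg: "norm l < 1 \<Longrightarrow> 0 \<le> herm_kernel l z"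
  unfolding herm_kernel_def using one_minus_norm_pos[of l] by simp

lemma herm_kernel_bound:
  assumes "norm l < 1" "norm z \<le> R" "R < 1"
  shows "herm_kernel l z \<le> 1 / (1 - R)^2"
proof -
  have "cmod (herm l z) \<le> R"
    using cmod_herm_le[of l z] mult_mono[of "norm l" 1 "norm z" R] assms by simp
  then have "1 - R \<le> cmod (1 - herm l z)"
    using norm_triangle_ineq2[of 1 "herm l z"] by simp
  then have "(1 - R)^2 \<le> (cmod (1 - herm l z))^2"
    using assms by (intro power_mono) auto
  then show ?thesis
    unfolding herm_kernel_def using assms by (intro frac_le) auto
qed

lemma herm_kernel_moebius_norm:
  assumes "norm l < 1" "norm z < 1"
  shows "herm_kernel l z * (1 - (norm z)^2) = 1 - (norm (ball_moebius l z))^2"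
  unfolding one_minus_norm_moebius[OF assms] herm_kernel_def
  by (simp add: cmod_one_minus_herm_commute[of l z])

text \<open>The transformation law of the kernel: a mean over a Moebius ball around \<open>l\<close>
  becomes a mean over a ball around the origin, with \<open>z\<close> replaced by its image and a
  factor that does not depend on \<open>y\<close>.\<close>

lemma herm_kernel_moebius:
  assumes "norm l < 1" "norm y < 1" "norm z < 1"
  shows "herm_kernel (ball_moebius l y) z = herm_kernel l z * herm_kernel y (ball_moebius l z)"
proof -
  let ?N = "cmod (1 - herm y l)"
  have N: "?N \<noteq> 0"
    using one_minus_herm_nonzero[of y l] assms by simp
  have "?N * cmod (1 - herm (ball_moebius l y) z) = cmod (1 - herm l z) * cmod (1 - herm y (ball_moebius l z))"
    unfolding norm_mult[symmetric] herm_moebius[OF assms] ..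
  then have e: "cmod (1 - herm (ball_moebius l y) z) = cmod (1 - herm l z) * cmod (1 - herm y (ball_moebius l z)) / ?N"
    using N by (simp add: field_simps)
  show ?thesis
    unfolding herm_kernel_def one_minus_norm_moebius[OF assms(1,2)] e power_divide power_mult_distrib
    using N by simp
qed

lemma continuous_on_moebius:
  assumes "norm l < 1"
  shows "continuous_on (ball 0 1) (ball_moebius l)"
proof -
  have "0 < 1 + sqrt (1 - (norm l)^2)"
    using one_minus_norm_pos[OF assms] by (simp add: add_pos_pos)
  then have "complex_of_real (1 + sqrt (1 - (norm l)^2)) \<noteq> 0"
    unfolding of_real_eq_0_iff by simp
  moreover have "1 - herm y l \<noteq> 0" if "y \<in> ball 0 1" for y
    using one_minus_herm_nonzero[of y l] that assms by simp
  ultimately show ?thesis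
    unfolding ball_moebius_def by (intro continuous_intros) blast+
qed

text \<open>Here \<open>\<nu>\<close> stands for \<mu> divided by the bound of the theorem and cut
  to the closed ball of radius \<open>R\<close>. Since R < 1, the kernel is bounded uniformly in
  \<open>l\<close>, which makes every integral finite.\<close>

locale ball_potential =
  fixes \<nu> :: "(complex ^ 'n::finite) measure" and R :: real
  assumes finite_nu: "finite_measure \<nu>" and sets_nu [simp, measurable_cong]: "sets \<nu> = sets borel"
    and R: "R < 1" and nu_ball: "AE z in \<nu>. norm z \<le> R"
begin

sublocale finite_measure \<nu> by (rule finite_nu)

definition pot :: "complex ^ 'n \<Rightarrow> real" where
  "pot l = (LINT z|\<nu>. herm_kernel l z ^ CARD('n))"

text \<open>Up to a positive factor this is minus the invariant Laplacian of \<open>pot\<close>: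
  averaging \<open>pot\<close> over the Moebius ball of radius r around \<open>l\<close> decreases
  it by m n r^2 \<open>pot_deriv l\<close>, up to order r^3, where m is
  \<open>ball_moment\<close>.\<close>

definition pot_deriv :: "complex ^ 'n \<Rightarrow> real" where
  "pot_deriv l = (LINT z|\<nu>. herm_kernel l z ^ CARD('n) * (1 - (norm (ball_moebius l z))^2))"

lemma space_nu [simp]: "space \<nu> = UNIV"
  using sets_eq_imp_space_eq[OF sets_nu] by simp

definition pot_bound :: real where
  "pot_bound = (1 / (1 - R)^2) ^ CARD('n)"

lemma kernel_power_bounds:
  assumes "norm l < 1" "norm z \<le> R"
  shows "0 \<le> herm_kernel l z ^ CARD('n)" "herm_kernel l z ^ CARD('n) \<le> pot_bound"
  unfolding pot_bound_def using assms R
  by (auto intro!: zero_le_power power_mono herm_kernel_nonneg herm_kernel_bound)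

lemma integrable_kernel:
  assumes "norm l < 1"
  shows "integrable \<nu> (\<lambda>z. herm_kernel l z ^ CARD('n))"
  using kernel_power_bounds[OF assms]
  by (intro integrable_const_bound[where B=pot_bound] eventually_mono[OF nu_ball]) auto

lemma one_minus_norm_moebius_bounds:
  assumes "norm l < 1" "norm z < 1"
  shows "0 \<le> 1 - (norm (ball_moebius l z))^2" "1 - (norm (ball_moebius l z))^2 \<le> 1"
  using norm_moebius_less_1[OF assms] by (auto simp: power_le_one less_imp_le)

lemma integrable_kernel_deriv:
  assumes "norm l < 1"
  shows "integrable \<nu> (\<lambda>z. herm_kernel l z ^ CARD('n) * (1 - (norm (ball_moebius l z))^2))"
proof (intro integrable_const_bound[where B=pot_bound] eventually_mono[OF nu_ball])
  fix z :: "complex ^ 'n" assume z: "norm z \<le> R"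
  then have "norm z < 1" using R by simp
  note b = one_minus_norm_moebius_bounds[OF assms this]
  show "norm (herm_kernel l z ^ CARD('n) * (1 - (norm (ball_moebius l z))^2)) \<le> pot_bound"
    using kernel_power_bounds[OF assms z] mult_left_le[OF b(2) kernel_power_bounds(1)[OF assms z]] b
    by (simp add: abs_mult)
qed simp

lemma pot_nonneg: "norm l < 1 \<Longrightarrow> 0 \<le> pot l"
  unfolding pot_def
  by (intro Bochner_Integration.integral_nonneg_AE eventually_mono[OF nu_ball] kernel_power_bounds(1))

lemma pot_deriv_nonneg: "norm l < 1 \<Longrightarrow> 0 \<le> pot_deriv l"
  unfolding pot_deriv_def
  using one_minus_norm_moebius_bounds(1)[of l] R kernel_power_bounds(1)
  by (intro Bochner_Integration.integral_nonneg_AE eventually_mono[OF nu_ball] mult_nonneg_nonneg) auto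

definition pot_max :: real where "pot_max = pot_bound * measure \<nu> UNIV"

lemma pot_le: assumes "norm l < 1" shows "pot l \<le> pot_max"
proof -
  have "pot l \<le> (LINT z|\<nu>. pot_bound)"
    unfolding pot_def using kernel_power_bounds[OF assms]
    by (intro integral_mono_AE integrable_kernel assms eventually_mono[OF nu_ball]) auto
  then show ?thesis by (simp add: pot_max_def mult.commute)
qed

lemma pot_deriv_le: assumes "norm l < 1" shows "pot_deriv l \<le> pot_max"
proof -
  have "pot_deriv l \<le> pot l"
    unfolding pot_deriv_def pot_def
  proof (intro integral_mono_AE integrable_kernel integrable_kernel_deriv assms eventually_mono[OF nu_ball])
    fix z :: "complex ^ 'n" assume z: "norm z \<le> R"
    then have "norm z < 1" using R by simp
    then show "herm_kernel l z ^ CARD('n) * (1 - (norm (ball_moebius l z))^2) \<le> herm_kernel l z ^ CARD('n)"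
      using kernel_power_bounds[OF assms z] one_minus_norm_moebius_bounds[OF assms] by (intro mult_left_le) auto
  qed
  then show ?thesis using pot_le[OF assms] by simp
qed

lemma borel_measurable_pot [measurable]: "pot \<in> borel_measurable borel"
  unfolding pot_def[abs_def] by measurable

lemma borel_measurable_pot_deriv [measurable]: "pot_deriv \<in> borel_measurable borel"
  unfolding pot_deriv_def[abs_def] by measurable

lemma nn_integral_pot:
  "norm l < 1 \<Longrightarrow> ennreal (pot l) = (\<integral>\<^sup>+z. ennreal (herm_kernel l z ^ CARD('n)) \<partial>\<nu>)"
  unfolding pot_def
  by (intro nn_integral_eq_integral[symmetric] integrable_kernel eventually_mono[OF nu_ball] kernel_power_bounds(1))

lemma continuous_on_pot: "continuous_on (ball 0 1) pot"
proof (rule continuous_on_sequentiallyI)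
  fix s :: "nat \<Rightarrow> complex ^ 'n" and l assume s: "\<forall>k. s k \<in> ball 0 1" and l: "l \<in> ball 0 1" and lim: "s \<longlonglongrightarrow> l"
  show "(\<lambda>k. pot (s k)) \<longlonglongrightarrow> pot l"
    unfolding pot_def
  proof (rule integral_dominated_convergence[where w="\<lambda>_. pot_bound"])
    show "AE z in \<nu>. (\<lambda>k. herm_kernel (s k) z ^ CARD('n)) \<longlonglongrightarrow> herm_kernel l z ^ CARD('n)"
    proof (rule eventually_mono[OF nu_ball])
      fix z :: "complex ^ 'n" assume z: "norm z \<le> R"
      have cont: "continuous_on (ball 0 1) (\<lambda>l. herm_kernel l z ^ CARD('n))"
        unfolding herm_kernel_def using z R one_minus_herm_nonzero[of _ z]
        by (intro continuous_intros) auto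
      show "(\<lambda>k. herm_kernel (s k) z ^ CARD('n)) \<longlonglongrightarrow> herm_kernel l z ^ CARD('n)"
        by (rule continuous_on_tendsto_compose[OF cont lim l]) (use s in auto)
    qed
    show "AE z in \<nu>. norm (herm_kernel (s k) z ^ CARD('n)) \<le> pot_bound" for k
      using s kernel_power_bounds[of "s k"] by (intro eventually_mono[OF nu_ball]) auto
  qed simp_all
qed

text \<open>Tonelli and the transformation law reduce a weighted mean of the potential to means of a
  single kernel around the origin. It is applied with small \<open>r\<close> and constant weight,
  and with \<open>r = 1\<close> and the weight h^n.\<close>

lemma nn_integral_pot_mean:
  fixes w :: "complex ^ 'n \<Rightarrow> real" and r :: real
  assumes l: "norm l < 1" and r: "0 < r" "r \<le> 1" and [measurable]: "w \<in> borel_measurable borel"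
    and w: "\<And>x. norm x < 1 \<Longrightarrow> 0 \<le> w x"
    and B: "\<And>z. norm z \<le> R \<Longrightarrow> 0 \<le> B z"
     "\<And>z. norm z \<le> R \<Longrightarrow> (\<integral>\<^sup>+x. ennreal (herm_kernel (r *\<^sub>R x) (ball_moebius l z) ^ CARD('n) * w x) \<partial>unif_ball) \<le> ennreal (B z)"
    and int: "integrable \<nu> (\<lambda>z. herm_kernel l z ^ CARD('n) * B z)"
  shows "(LINT x|unif_ball. pot (ball_moebius l (r *\<^sub>R x)) * w x) \<le> (LINT z|\<nu>. herm_kernel l z ^ CARD('n) * B z)"
proof -
  interpret U: prob_space "unif_ball :: (complex ^ 'n) measure" by (rule prob_space_unif_ball)
  interpret pair_sigma_finite "unif_ball :: (complex ^ 'n) measure" \<nu> ..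
  have rx: "norm (r *\<^sub>R x) < 1" if "norm x < 1" for x :: "complex ^ 'n"
    using mult_right_mono[of r 1 "norm x"] r that by simp
  have reassoc: "ennreal (a * b) * ennreal c = ennreal a * ennreal (b * c)" if "0 \<le> a" "0 \<le> b" "0 \<le> c" for a b c :: real
    using that by (simp add: ennreal_mult'[symmetric] mult.assoc)
  have mb: "norm (ball_moebius l (r *\<^sub>R x)) < 1" if "norm x < 1" for x
    by (rule norm_moebius_less_1[OF l rx[OF that]])
  have step: "(\<integral>\<^sup>+x. ennreal (herm_kernel (ball_moebius l (r *\<^sub>R x)) z ^ CARD('n)) * ennreal (w x) \<partial>unif_ball)
      \<le> ennreal (herm_kernel l z ^ CARD('n) * B z)" if z: "norm z \<le> R" for z
  proof -
    have z1: "norm z < 1" using z R by simp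
    have "(\<integral>\<^sup>+x. ennreal (herm_kernel (ball_moebius l (r *\<^sub>R x)) z ^ CARD('n)) * ennreal (w x) \<partial>unif_ball) =
      (\<integral>\<^sup>+x. ennreal (herm_kernel l z ^ CARD('n)) * ennreal (herm_kernel (r *\<^sub>R x) (ball_moebius l z) ^ CARD('n) * w x) \<partial>unif_ball)"
    proof (intro nn_integral_cong_AE eventually_mono[OF AE_unif_ball])
      fix x :: "complex ^ 'n" assume x: "norm x < 1"
      show "ennreal (herm_kernel (ball_moebius l (r *\<^sub>R x)) z ^ CARD('n)) * ennreal (w x) =
        ennreal (herm_kernel l z ^ CARD('n)) * ennreal (herm_kernel (r *\<^sub>R x) (ball_moebius l z) ^ CARD('n) * w x)"
        unfolding herm_kernel_moebius[OF l rx[OF x] z1] power_mult_distrib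
        by (intro reassoc kernel_power_bounds(1)[OF l z] zero_le_power herm_kernel_nonneg[OF rx[OF x]] w[OF x])
    qed
    also have "\<dots> = ennreal (herm_kernel l z ^ CARD('n)) *
        (\<integral>\<^sup>+x. ennreal (herm_kernel (r *\<^sub>R x) (ball_moebius l z) ^ CARD('n) * w x) \<partial>unif_ball)"
      by (rule nn_integral_cmult) measurable
    also have "\<dots> \<le> ennreal (herm_kernel l z ^ CARD('n)) * ennreal (B z)"
      by (intro mult_left_mono B(2)[OF z]) simp
    also have "\<dots> = ennreal (herm_kernel l z ^ CARD('n) * B z)"
      using kernel_power_bounds(1)[OF l z] by (simp add: ennreal_mult')
    finally show ?thesis .
  qed
  have "(\<integral>\<^sup>+x. ennreal (pot (ball_moebius l (r *\<^sub>R x)) * w x) \<partial>unif_ball) =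
    (\<integral>\<^sup>+x. (\<integral>\<^sup>+z. ennreal (herm_kernel (ball_moebius l (r *\<^sub>R x)) z ^ CARD('n)) * ennreal (w x) \<partial>\<nu>) \<partial>unif_ball)"
  proof (intro nn_integral_cong_AE eventually_mono[OF AE_unif_ball])
    fix x :: "complex ^ 'n" assume x: "norm x < 1"
    have "ennreal (pot (ball_moebius l (r *\<^sub>R x)) * w x) = ennreal (pot (ball_moebius l (r *\<^sub>R x))) * ennreal (w x)"
      using pot_nonneg[OF mb[OF x]] by (rule ennreal_mult')
    then show "ennreal (pot (ball_moebius l (r *\<^sub>R x)) * w x) =
      (\<integral>\<^sup>+z. ennreal (herm_kernel (ball_moebius l (r *\<^sub>R x)) z ^ CARD('n)) * ennreal (w x) \<partial>\<nu>)"
      unfolding nn_integral_pot[OF mb[OF x]] by (subst nn_integral_multc) auto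
  qed
  also have "\<dots> = (\<integral>\<^sup>+z. (\<integral>\<^sup>+x. ennreal (herm_kernel (ball_moebius l (r *\<^sub>R x)) z ^ CARD('n)) * ennreal (w x) \<partial>unif_ball) \<partial>\<nu>)"
    by (rule Fubini'[symmetric]) measurable
  also have "\<dots> \<le> (\<integral>\<^sup>+z. ennreal (herm_kernel l z ^ CARD('n) * B z) \<partial>\<nu>)"
    by (intro nn_integral_mono_AE eventually_mono[OF nu_ball] step)
  also have "\<dots> = ennreal (LINT z|\<nu>. herm_kernel l z ^ CARD('n) * B z)"
    using kernel_power_bounds(1)[OF l] B(1)
    by (intro nn_integral_eq_integral int eventually_mono[OF nu_ball]) auto
  finally have "(\<integral>\<^sup>+x. ennreal (pot (ball_moebius l (r *\<^sub>R x)) * w x) \<partial>unif_ball) \<le> ennreal (LINT z|\<nu>. herm_kernel l z ^ CARD('n) * B z)" .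
  moreover have "0 \<le> (LINT z|\<nu>. herm_kernel l z ^ CARD('n) * B z)"
    using kernel_power_bounds(1)[OF l] B(1)
    by (intro Bochner_Integration.integral_nonneg_AE eventually_mono[OF nu_ball]) auto
  moreover have "AE x in unif_ball. 0 \<le> pot (ball_moebius l (r *\<^sub>R x)) * w x"
    by (intro eventually_mono[OF AE_unif_ball] mult_nonneg_nonneg pot_nonneg mb w)
  ultimately show ?thesis
    by (subst integral_eq_nn_integral) (auto intro: enn2real_leI)
qed

end

section \<open>Integration against the invariant measure\<close>

lemma nn_integral_unif_ball_scaleR:
  fixes g :: "'a::euclidean_space \<Rightarrow> ennreal"
  assumes [measurable]: "g \<in> borel_measurable borel" and r: "0 < r" "r \<le> 1"
  shows "ennreal (r ^ DIM('a)) * (\<integral>\<^sup>+x. g (r *\<^sub>R x) \<partial>unif_ball) = (\<integral>\<^sup>+x. indicator (ball 0 r) x * g x \<partial>unif_ball)"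
proof -
  let ?v = "emeasure lborel (ball (0::'a) 1)"
  have "?v * (\<integral>\<^sup>+x. indicator (ball 0 r) x * g x \<partial>unif_ball) = (\<integral>\<^sup>+x. indicator (ball 0 r) x * g x * indicator (ball 0 1) x \<partial>lborel)"
    by (rule nn_integral_unif_ball) measurable
  also have "\<dots> = (\<integral>\<^sup>+x. indicator (ball 0 r) x * g x \<partial>lborel)"
    using r by (intro nn_integral_cong) (auto simp: indicator_def)
  also have "\<dots> = ennreal (r ^ DIM('a)) * (\<integral>\<^sup>+x. indicator (ball 0 r) (r *\<^sub>R x) * g (r *\<^sub>R x) \<partial>lborel)"
    using nn_integral_lborel_affine[of "\<lambda>x. indicator (ball 0 r) x * g x" r 0] r by simp
  also have "(\<integral>\<^sup>+x. indicator (ball 0 r) (r *\<^sub>R x) * g (r *\<^sub>R x) \<partial>lborel) = (\<integral>\<^sup>+x. g (r *\<^sub>R x) * indicator (ball 0 1) x \<partial>lborel)"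
    using r by (intro nn_integral_cong) (auto simp: indicator_def)
  also have "\<dots> = ?v * (\<integral>\<^sup>+x. g (r *\<^sub>R x) \<partial>unif_ball)"
    by (rule nn_integral_unif_ball[symmetric]) measurable
  finally have "?v * (\<integral>\<^sup>+x. indicator (ball 0 r) x * g x \<partial>unif_ball) = ?v * (ennreal (r ^ DIM('a)) * (\<integral>\<^sup>+x. g (r *\<^sub>R x) \<partial>unif_ball))"
    by (simp add: ac_simps)
  then show ?thesis
    using emeasure_unit_ball_pos[where 'a='a] emeasure_unit_ball_finite[where 'a='a]
    by (simp add: ennreal_mult_cancel_left)
qed

lemma sigma_finite_tau: "sigma_finite_measure (invariant_measure :: (complex ^ 'n::finite) measure)"
proof -
  interpret prob_space "unif_ball :: (complex ^ 'n) measure" by (rule prob_space_unif_ball)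
  show ?thesis
    unfolding invariant_measure_def by (subst sigma_finite_iff_density_finite) auto
qed

lemma AE_tau: "AE y in (invariant_measure :: (complex ^ 'n::finite) measure). norm y < 1"
  unfolding invariant_measure_def by (subst AE_density) (auto intro: eventually_mono[OF AE_unif_ball])

lemma nn_integral_tau_cancel:
  fixes g :: "complex ^ 'n::finite \<Rightarrow> ennreal"
  assumes [measurable]: "g \<in> borel_measurable borel"
  shows "(\<integral>\<^sup>+y. ennreal ((1 - (norm y)^2) ^ (CARD('n) + 1)) * g y \<partial>invariant_measure) = (\<integral>\<^sup>+y. g y \<partial>unif_ball)"
proof (subst nn_integral_tau, measurable, intro nn_integral_cong_AE eventually_mono[OF AE_unif_ball])
  fix y :: "complex ^ 'n" assume "norm y < 1"
  then have "0 < (1 - (norm y)^2) ^ (CARD('n) + 1)"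
    by (intro zero_less_power one_minus_norm_pos)
  moreover have "ennreal (1 / t) * (ennreal t * g y) = g y" if "0 < t" for t
    using that by (simp add: mult.assoc[symmetric] ennreal_mult'[symmetric])
  ultimately show "ennreal (1 / (1 - (norm y)^2) ^ (CARD('n) + 1)) * (ennreal ((1 - (norm y)^2) ^ (CARD('n) + 1)) * g y) = g y"
    by blast
qed

lemma nn_integral_weight_tau:
  fixes g :: "complex ^ 'n::finite \<Rightarrow> ennreal"
  assumes [measurable]: "g \<in> borel_measurable borel"
  shows "(\<integral>\<^sup>+l. g l * ennreal ((1 - (norm l)^2) powr (real CARD('n) + e)) \<partial>invariant_measure) =
    (\<integral>\<^sup>+l. g l * ennreal ((1 - (norm l)^2) powr (e - 1)) \<partial>unif_ball)"
proof (subst nn_integral_tau, measurable, intro nn_integral_cong_AE eventually_mono[OF AE_unif_ball])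
  fix l :: "complex ^ 'n" assume l: "norm l < 1"
  let ?h = "1 - (norm l)^2"
  have h: "?h > 0" by (rule one_minus_norm_pos[OF l])
  have "1 / ?h ^ (CARD('n) + 1) * ?h powr (real CARD('n) + e) = ?h powr (e - 1)"
    unfolding powr_realpow[OF h, symmetric] using h by (simp add: powr_diff[symmetric] field_simps powr_add[symmetric] powr_minus[symmetric] flip: powr_minus_divide)
  then have "ennreal (1 / ?h ^ (CARD('n) + 1)) * ennreal (?h powr (real CARD('n) + e)) = ennreal (?h powr (e - 1))"
    using h by (subst ennreal_mult'[symmetric]) (auto simp del: power_Suc)
  then show "ennreal (1 / ?h ^ (CARD('n) + 1)) * (g l * ennreal (?h powr (real CARD('n) + e))) = g l * ennreal (?h powr (e - 1))"
    by (metis mult.left_commute)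
qed

text \<open>Averaging over small Moebius balls is self-adjoint with respect to the invariant measure, since
  its kernel depends on \<open>l\<close> and \<open>y\<close> only through the symmetric quantity
  \<open>(1 - |l|^2) (1 - |y|^2) / |1 - <l,y>|^2\<close>.\<close>

lemma moebius_average_symmetric:
  fixes U W :: "complex ^ 'n::finite \<Rightarrow> ennreal"
  assumes [measurable]: "U \<in> borel_measurable borel" "W \<in> borel_measurable borel" and r: "0 < r" "r \<le> 1"
  shows "(\<integral>\<^sup>+l. (\<integral>\<^sup>+x. U (ball_moebius l (r *\<^sub>R x)) \<partial>unif_ball) * W l \<partial>invariant_measure) =
    (\<integral>\<^sup>+l. U l * (\<integral>\<^sup>+x. W (ball_moebius l (r *\<^sub>R x)) \<partial>unif_ball) \<partial>invariant_measure)"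
proof -
  interpret T: sigma_finite_measure "invariant_measure :: (complex ^ 'n) measure" by (rule sigma_finite_tau)
  interpret B: prob_space "unif_ball :: (complex ^ 'n) measure" by (rule prob_space_unif_ball)
  interpret TT: pair_sigma_finite "invariant_measure :: (complex ^ 'n) measure" "invariant_measure :: (complex ^ 'n) measure" ..
  \<comment> \<open>Evaluated at 1 minus the squared norm of the image of \<open>y\<close>: the
    indicator says that this image lies in the ball of radius \<open>r\<close>, and the power undoes
    the density of the invariant measure.\<close>
  define k :: "real \<Rightarrow> ennreal" where "k t = indicator {t. 1 - r^2 < t} t * ennreal (t ^ (CARD('n) + 1))" for t
  define c where "c = ennreal (r ^ DIM(complex ^ 'n))"
  have [measurable]: "k \<in> borel_measurable borel"
    unfolding k_def by measurable
  let ?H = "\<lambda>l y. herm_kernel l y * (1 - (norm y)^2)"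
  have avg: "c * (\<integral>\<^sup>+x. V (ball_moebius l (r *\<^sub>R x)) \<partial>unif_ball) = (\<integral>\<^sup>+y. k (?H l y) * V y \<partial>invariant_measure)"
    if l: "norm l < 1" and [measurable]: "V \<in> borel_measurable borel" for l and V :: "complex ^ 'n \<Rightarrow> ennreal"
  proof -
    have "c * (\<integral>\<^sup>+x. V (ball_moebius l (r *\<^sub>R x)) \<partial>unif_ball) = (\<integral>\<^sup>+y. indicator (ball 0 r) y * V (ball_moebius l y) \<partial>unif_ball)"
      unfolding c_def by (rule nn_integral_unif_ball_scaleR[OF _ r]) measurable
    also have "\<dots> = (\<integral>\<^sup>+y. ennreal ((1 - (norm y)^2) ^ (CARD('n) + 1)) * (indicator (ball 0 r) y * V (ball_moebius l y)) \<partial>invariant_measure)"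
      by (rule nn_integral_tau_cancel[symmetric]) measurable
    \<comment> \<open>The norm of \<open>y\<close> is rewritten through the twofold automorphism, so
      that the whole integrand is a function of \<open>ball_moebius l y\<close> and the invariance
      of the measure applies.\<close>
    also have "\<dots> = (\<integral>\<^sup>+y. k (1 - (norm (ball_moebius l (ball_moebius l y)))^2) * V (ball_moebius l y) \<partial>invariant_measure)"
    proof (intro nn_integral_cong_AE eventually_mono[OF AE_tau])
      fix y :: "complex ^ 'n" assume y: "norm y < 1"
      have "(norm y)^2 < r^2 \<longleftrightarrow> norm y < r"
        using r power_mono_iff[of r "norm y" 2] by (simp add: linorder_not_le[symmetric])
      then show "ennreal ((1 - (norm y)^2) ^ (CARD('n) + 1)) * (indicator (ball 0 r) y * V (ball_moebius l y)) =
        k (1 - (norm (ball_moebius l (ball_moebius l y)))^2) * V (ball_moebius l y)"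
        unfolding one_minus_norm_moebius_moebius[OF l y] k_def by (simp add: indicator_def del: power_Suc)
    qed
    also have "\<dots> = (\<integral>\<^sup>+y. k (1 - (norm (ball_moebius l y))^2) * V y \<partial>invariant_measure)"
      by (rule nn_integral_tau_moebius[OF l, of "\<lambda>y. k (1 - (norm (ball_moebius l y))^2) * V y"]) measurable
    also have "\<dots> = (\<integral>\<^sup>+y. k (?H l y) * V y \<partial>invariant_measure)"
      by (intro nn_integral_cong_AE eventually_mono[OF AE_tau]) (simp add: herm_kernel_moebius_norm[OF l])
    finally show ?thesis .
  qed
  have "c * (\<integral>\<^sup>+l. (\<integral>\<^sup>+x. U (ball_moebius l (r *\<^sub>R x)) \<partial>unif_ball) * W l \<partial>invariant_measure) =
      (\<integral>\<^sup>+l. (c * (\<integral>\<^sup>+x. U (ball_moebius l (r *\<^sub>R x)) \<partial>unif_ball)) * W l \<partial>invariant_measure)"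
    by (subst nn_integral_cmult[symmetric]) (auto simp: mult.assoc)
  also have "\<dots> = (\<integral>\<^sup>+l. (\<integral>\<^sup>+y. k (?H l y) * U y \<partial>invariant_measure) * W l \<partial>invariant_measure)"
    by (intro nn_integral_cong_AE eventually_mono[OF AE_tau]) (simp add: avg)
  also have "\<dots> = (\<integral>\<^sup>+l. (\<integral>\<^sup>+y. k (?H l y) * U y * W l \<partial>invariant_measure) \<partial>invariant_measure)"
    by (subst nn_integral_multc) auto
  also have "\<dots> = (\<integral>\<^sup>+y. (\<integral>\<^sup>+l. k (?H l y) * U y * W l \<partial>invariant_measure) \<partial>invariant_measure)"
    by (rule TT.Fubini') measurable
  also have "\<dots> = (\<integral>\<^sup>+y. U y * (\<integral>\<^sup>+l. k (?H y l) * W l \<partial>invariant_measure) \<partial>invariant_measure)"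
  proof (intro nn_integral_cong)
    fix y :: "complex ^ 'n"
    have "k (?H l y) * U y * W l = U y * (k (?H y l) * W l)" for l
      unfolding herm_kernel_def by (simp add: cmod_one_minus_herm_commute[of l y] ac_simps)
    then show "(\<integral>\<^sup>+l. k (?H l y) * U y * W l \<partial>invariant_measure) = U y * (\<integral>\<^sup>+l. k (?H y l) * W l \<partial>invariant_measure)"
      by (simp add: nn_integral_cmult)
  qed
  also have "\<dots> = (\<integral>\<^sup>+l. U l * (c * (\<integral>\<^sup>+x. W (ball_moebius l (r *\<^sub>R x)) \<partial>unif_ball)) \<partial>invariant_measure)"
    by (intro nn_integral_cong_AE eventually_mono[OF AE_tau]) (simp add: avg)
  also have "\<dots> = c * (\<integral>\<^sup>+l. U l * (\<integral>\<^sup>+x. W (ball_moebius l (r *\<^sub>R x)) \<partial>unif_ball) \<partial>invariant_measure)"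
    by (subst nn_integral_cmult[symmetric]) (auto simp: ac_simps)
  finally have eq: "c * (\<integral>\<^sup>+l. (\<integral>\<^sup>+x. U (ball_moebius l (r *\<^sub>R x)) \<partial>unif_ball) * W l \<partial>invariant_measure) =
    c * (\<integral>\<^sup>+l. U l * (\<integral>\<^sup>+x. W (ball_moebius l (r *\<^sub>R x)) \<partial>unif_ball) \<partial>invariant_measure)" .
  have "0 < r ^ DIM(complex ^ 'n)"
    using r(1) by (rule zero_less_power)
  then have "c \<noteq> 0" "c \<noteq> top"
    by (auto simp: c_def ennreal_eq_0_iff)
  with eq show ?thesis
    by (simp add: ennreal_mult_cancel_left)
qed

lemma norm_scaleR_less_1: "norm (x :: 'a::real_normed_vector) < 1 \<Longrightarrow> 0 < r \<Longrightarrow> r \<le> 1 \<Longrightarrow> norm (r *\<^sub>R x) < 1"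
  using mult_right_mono[of r 1 "norm x"] by simp

lemma herm_kernel_pos: "norm l < 1 \<Longrightarrow> norm z \<le> 1 \<Longrightarrow> 0 < herm_kernel l z"
  unfolding herm_kernel_def using one_minus_norm_pos[of l] one_minus_herm_nonzero[of l z]
  by (intro divide_pos_pos) auto

text \<open>The weight at \<open>ball_moebius l (r *\<^sub>R x)\<close> is its value at
  \<open>l\<close> times the quotient treated in \<open>unif_ball_mean_ratio_bound\<close> with
  \<open>v = l\<close>. Bounding |l|^2 by 1 makes the coefficient independent of \<open>l\<close>,
  and it is small when \<open>b\<close> is close to n.\<close>

lemma moebius_average_weight:
  fixes b :: real
  assumes b: "0 \<le> b"
  shows "\<exists>C d. 0 \<le> C \<and> 0 < d \<and> d \<le> 1 / 4 \<and> (\<forall>r (l :: complex ^ 'n::finite). 0 < r \<longrightarrow> r \<le> d \<longrightarrow> norm l < 1 \<longrightarrow>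
    (\<integral>\<^sup>+x. ennreal ((1 - (norm (ball_moebius l (r *\<^sub>R x)))^2) powr b) \<partial>unif_ball) \<le>
    ennreal ((1 - (norm l)^2) powr b) * ennreal (1 + ball_moment TYPE('n) * r^2 * (b^2 / real CARD('n) - b) + C * r ^ 3))"
proof -
  obtain C d where Cd: "0 \<le> C" "0 < d" "d \<le> 1 / 4" and
    bound: "\<And>r (v :: complex ^ 'n). 0 < r \<Longrightarrow> r \<le> d \<Longrightarrow> norm v \<le> 1 \<Longrightarrow>
      (\<integral>\<^sup>+x. ennreal (((1 - (norm (r *\<^sub>R x))^2) / (cmod (1 - herm (r *\<^sub>R x) v))^2) powr b) \<partial>unif_ball) \<le>
      ennreal (1 + ball_moment TYPE('n) * r^2 * (b^2 * (norm v)^2 / real CARD('n) - b) + C * r ^ 3)"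
    using unif_ball_mean_ratio_bound[of b, where 'n='n] by blast
  have "(\<integral>\<^sup>+x. ennreal ((1 - (norm (ball_moebius l (r *\<^sub>R x)))^2) powr b) \<partial>unif_ball) \<le>
    ennreal ((1 - (norm l)^2) powr b) * ennreal (1 + ball_moment TYPE('n) * r^2 * (b^2 / real CARD('n) - b) + C * r ^ 3)"
    if r: "0 < r" "r \<le> d" and l: "norm l < 1" for r and l :: "complex ^ 'n"
  proof -
    let ?g = "\<lambda>x. ((1 - (norm (r *\<^sub>R x))^2) / (cmod (1 - herm (r *\<^sub>R x) l))^2) powr b"
    have "(\<integral>\<^sup>+x. ennreal ((1 - (norm (ball_moebius l (r *\<^sub>R x)))^2) powr b) \<partial>unif_ball) =
      (\<integral>\<^sup>+x. ennreal ((1 - (norm l)^2) powr b) * ennreal (?g x) \<partial>unif_ball)"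
    proof (intro nn_integral_cong_AE eventually_mono[OF AE_unif_ball])
      fix x :: "complex ^ 'n" assume x: "norm x < 1"
      have rx: "norm (r *\<^sub>R x) < 1"
        using r Cd(3) by (intro norm_scaleR_less_1[OF x]) auto
      have "0 \<le> 1 - (norm l)^2" "0 \<le> (1 - (norm (r *\<^sub>R x))^2) / (cmod (1 - herm (r *\<^sub>R x) l))^2"
        using one_minus_norm_pos[OF l] one_minus_norm_pos[OF rx] by auto
      then have "(1 - (norm (ball_moebius l (r *\<^sub>R x)))^2) powr b = (1 - (norm l)^2) powr b * ?g x"
        unfolding one_minus_norm_moebius[OF l rx] times_divide_eq_right[symmetric] by (simp only: powr_mult)
      then show "ennreal ((1 - (norm (ball_moebius l (r *\<^sub>R x)))^2) powr b) = ennreal ((1 - (norm l)^2) powr b) * ennreal (?g x)"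
        by (simp add: ennreal_mult')
    qed
    also have "\<dots> = ennreal ((1 - (norm l)^2) powr b) * (\<integral>\<^sup>+x. ennreal (?g x) \<partial>unif_ball)"
      by (rule nn_integral_cmult) measurable
    also have "\<dots> \<le> ennreal ((1 - (norm l)^2) powr b) * ennreal (1 + ball_moment TYPE('n) * r^2 * (b^2 / real CARD('n) - b) + C * r ^ 3)"
    proof (intro mult_left_mono order_trans[OF bound] ennreal_leI)
      have "b^2 * (norm l)^2 \<le> b^2"
        using l by (intro mult_left_le) (auto simp: power_le_one)
      then show "1 + ball_moment TYPE('n) * r^2 * (b^2 * (norm l)^2 / real CARD('n) - b) + C * r ^ 3
        \<le> 1 + ball_moment TYPE('n) * r^2 * (b^2 / real CARD('n) - b) + C * r ^ 3"
        using ball_moment_pos[where 'n='n]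
        by (intro add_right_mono add_left_mono mult_left_mono diff_right_mono divide_right_mono) auto
    qed (use r l in auto)
    finally show ?thesis .
  qed
  then show ?thesis
    using Cd by (intro exI[of _ C] exI[of _ d]) auto
qed

text \<open>The properties of a holomorphic polynomial that the argument uses. Continuity on the
  whole space bounds \<open>f\<close> on the closed ball and provides its boundary values.\<close>

locale ball_potential_function = ball_potential \<nu> R for \<nu> :: "(complex ^ 'n::finite) measure" and R +
  fixes f :: "complex ^ 'n \<Rightarrow> complex"
  assumes cont_f: "continuous_on UNIV f"
    and slice_f: "\<And>l. norm l < 1 \<Longrightarrow> slice_holomorphic (\<lambda>y. f (ball_moebius l y))"
begin

definition damped :: "complex ^ 'n \<Rightarrow> real" where
  "damped l = (cmod (f l))^2 * exp (- pot l)"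

lemma borel_measurable_f [measurable]: "f \<in> borel_measurable borel"
  by (rule borel_measurable_continuous_onI[OF cont_f])

lemma borel_measurable_damped [measurable]: "damped \<in> borel_measurable borel"
  unfolding damped_def[abs_def] by measurable

lemma f_bounded: "\<exists>K\<ge>0. \<forall>x. norm x \<le> 1 \<longrightarrow> cmod (f x) \<le> K"
proof -
  have "bounded (f ` cball 0 1)"
    by (intro compact_imp_bounded compact_continuous_image continuous_on_subset[OF cont_f]) auto
  then obtain K where "\<forall>y\<in>f ` cball 0 1. norm y \<le> K"
    unfolding bounded_iff by blast
  then have "\<forall>x. norm x \<le> 1 \<longrightarrow> cmod (f x) \<le> K" by auto
  moreover from this have "0 \<le> K" using order_trans[OF norm_ge_zero, of "f 0" K] by simp
  ultimately show ?thesis by blast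
qed

lemma damped_nonneg: "0 \<le> damped l"
  by (simp add: damped_def)

lemma damped_bounded: "\<exists>K. \<forall>x. norm x < 1 \<longrightarrow> damped x \<le> K"
proof -
  obtain K where K: "K \<ge> 0" "\<And>x. norm x \<le> 1 \<Longrightarrow> cmod (f x) \<le> K" using f_bounded by auto
  have "damped x \<le> K^2 * 1" if "norm x < 1" for x
    unfolding damped_def using K that pot_nonneg[OF that] by (intro mult_mono power_mono) auto
  then show ?thesis by auto
qed

lemma damped_local_mean:
  assumes l: "norm l < 1" and r: "0 < r" "r \<le> 1"
  shows "damped l * (1 + pot l - (LINT x|unif_ball. pot (ball_moebius l (r *\<^sub>R x)))) \<le>
    (LINT x|unif_ball. damped (ball_moebius l (r *\<^sub>R x)))"
proof -
  obtain K where K: "K \<ge> 0" "\<And>x. norm x \<le> 1 \<Longrightarrow> cmod (f x) \<le> K" using f_bounded by auto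
  let ?F = "\<lambda>x. f (ball_moebius l (r *\<^sub>R x))" and ?p = "\<lambda>x. pot (ball_moebius l (r *\<^sub>R x))"
  have mb: "norm (ball_moebius l (r *\<^sub>R x)) < 1" if "norm x < 1" for x
    by (rule norm_moebius_less_1[OF l norm_scaleR_less_1[OF that r]])
  have rb: "(\<lambda>x. r *\<^sub>R x) ` ball 0 1 \<subseteq> ball (0 :: complex ^ 'n) 1"
    using norm_scaleR_less_1[OF _ r] by auto
  have cm: "continuous_on (ball 0 1) (\<lambda>x. ball_moebius l (r *\<^sub>R x))"
    by (rule continuous_on_compose2[OF continuous_on_moebius[OF l] _ rb]) (intro continuous_intros)
  have "(cmod (?F 0))^2 * exp (- ?p 0) * (1 + ?p 0 - (LINT x|unif_ball. ?p x)) \<le>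
     (LINT x|unif_ball. (cmod (?F x))^2 * exp (- ?p x))"
  proof (rule circular_mean_exp_weight[where K="K + pot_max"])
    show "prob_space (unif_ball :: (complex ^ 'n) measure)" by (rule prob_space_unif_ball)
    show "distr unif_ball borel (\<lambda>x. cis t *s x) = (unif_ball :: (complex ^ 'n) measure)" for t
      by (rule unif_ball_isometry) (simp_all add: linear_smult norm_smult)
    show "AE x :: complex ^ 'n in unif_ball. norm x < 1" by (rule AE_unif_ball)
    show "continuous_on (ball 0 1) ?F"
      by (rule continuous_on_compose2[OF cont_f cm]) simp
    show "continuous_on (ball 0 1) ?p"
      by (rule continuous_on_compose2[OF continuous_on_pot cm]) (use mb in auto)
    show "slice_holomorphic ?F"
      unfolding slice_holomorphic_def
    proof (intro allI impI)
      fix x :: "complex ^ 'n" assume x: "norm x < 1"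
      have "(\<lambda>c. f (ball_moebius l (c *s (r *\<^sub>R x)))) holomorphic_on {c. norm (c *s (r *\<^sub>R x)) < 1}"
        using slice_f[OF l] norm_scaleR_less_1[OF x r] unfolding slice_holomorphic_def by auto
      moreover have "c *s (r *\<^sub>R x) = r *\<^sub>R (c *s x)" for c
        by (simp add: scaleR_eq_smult vector_smult_assoc mult.commute)
      ultimately have "(\<lambda>c. f (ball_moebius l (r *\<^sub>R (c *s x)))) holomorphic_on {c. norm (r *\<^sub>R (c *s x)) < 1}"
        by simp
      then show "(\<lambda>c. f (ball_moebius l (r *\<^sub>R (c *s x)))) holomorphic_on {c. norm (c *s x) < 1}"
        by (rule holomorphic_on_subset) (use norm_scaleR_less_1[OF _ r] in blast)
    qed
    show "cmod (?F x) \<le> K + pot_max" if "norm x < 1" for x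
      using K(2)[OF less_imp_le[OF mb[OF that]]] pot_nonneg[OF mb[OF that]] pot_le[OF mb[OF that]] by linarith
    show "\<bar>?p x\<bar> \<le> K + pot_max" if "norm x < 1" for x
      using K(1) pot_nonneg[OF mb[OF that]] pot_le[OF mb[OF that]] by linarith
  qed simp_all
  then show ?thesis
    by (simp add: damped_def)
qed

text \<open>In \<open>damped_local_mean\<close> the mean of the potential is expanded to second
  order with exponent n and \<open>v = ball_moebius l z\<close>. The cubic error is a multiple of
  \<open>damped l\<close>, with a constant uniform in \<open>l\<close>, so it stays under control
  when integrated against an unbounded weight.\<close>

lemma damped_local_inequality:
  "\<exists>C d. 0 \<le> C \<and> 0 < d \<and> d \<le> 1 / 4 \<and> (\<forall>r l. 0 < r \<longrightarrow> r \<le> d \<longrightarrow> norm l < 1 \<longrightarrow>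
    damped l * (1 + ball_moment TYPE('n) * real CARD('n) * r^2 * pot_deriv l) \<le>
    (LINT x|unif_ball. damped (ball_moebius l (r *\<^sub>R x))) + C * r ^ 3 * damped l)"
proof -
  let ?n = "real CARD('n)" and ?m = "ball_moment TYPE('n)"
  obtain C d where Cd: "0 \<le> C" "0 < d" "d \<le> 1 / 4" and
    bound0: "\<And>r (v :: complex ^ 'n). 0 < r \<Longrightarrow> r \<le> d \<Longrightarrow> norm v \<le> 1 \<Longrightarrow>
      0 \<le> 1 + ?m * r^2 * (?n^2 * (norm v)^2 / ?n - ?n) + C * r ^ 3 \<and>
      (\<integral>\<^sup>+x. ennreal (((1 - (norm (r *\<^sub>R x))^2) / (cmod (1 - herm (r *\<^sub>R x) v))^2) powr ?n) \<partial>unif_ball) \<le>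
      ennreal (1 + ?m * r^2 * (?n^2 * (norm v)^2 / ?n - ?n) + C * r ^ 3)"
    using unif_ball_mean_ratio_bound[of ?n, where 'n='n] by blast
  have main: "damped l * (1 + ?m * ?n * r^2 * pot_deriv l) \<le>
      (LINT x|unif_ball. damped (ball_moebius l (r *\<^sub>R x))) + C * pot_max * r ^ 3 * damped l"
    if r: "0 < r" "r \<le> d" and l: "norm l < 1" for r l
  proof -
    have r1: "r \<le> 1" using r Cd by simp
    define B where "B z = 1 - ?m * ?n * r^2 * (1 - (norm (ball_moebius l z))^2) + C * r ^ 3" for z
    have B_eq: "1 + ?m * r^2 * (?n^2 * (norm (ball_moebius l z))^2 / ?n - ?n) + C * r ^ 3 = B z" for z
      by (simp add: B_def power2_eq_square algebra_simps)
    have mb: "norm (ball_moebius l z) \<le> 1" if "norm z \<le> R" for z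
      using norm_moebius_less_1[OF l, of z] that R by simp
    have "(LINT x|unif_ball. pot (ball_moebius l (r *\<^sub>R x)) * 1) \<le> (LINT z|\<nu>. herm_kernel l z ^ CARD('n) * B z)"
    proof (rule nn_integral_pot_mean[OF l r(1) r1])
      fix z :: "complex ^ 'n" assume z: "norm z \<le> R"
      note b = bound0[OF r mb[OF z], unfolded B_eq]
      show "0 \<le> B z" using b by blast
      have "(\<integral>\<^sup>+x. ennreal (herm_kernel (r *\<^sub>R x) (ball_moebius l z) ^ CARD('n) * 1) \<partial>unif_ball) =
        (\<integral>\<^sup>+x. ennreal (((1 - (norm (r *\<^sub>R x))^2) / (cmod (1 - herm (r *\<^sub>R x) (ball_moebius l z)))^2) powr ?n) \<partial>unif_ball)"
      proof (intro nn_integral_cong_AE eventually_mono[OF AE_unif_ball])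
        fix x :: "complex ^ 'n" assume x: "norm x < 1"
        have "0 < herm_kernel (r *\<^sub>R x) (ball_moebius l z)"
          by (rule herm_kernel_pos[OF norm_scaleR_less_1[OF x r(1) r1] mb[OF z]])
        then have "herm_kernel (r *\<^sub>R x) (ball_moebius l z) powr ?n = herm_kernel (r *\<^sub>R x) (ball_moebius l z) ^ CARD('n)"
          by (rule powr_realpow)
        then show "ennreal (herm_kernel (r *\<^sub>R x) (ball_moebius l z) ^ CARD('n) * 1) =
          ennreal (((1 - (norm (r *\<^sub>R x))^2) / (cmod (1 - herm (r *\<^sub>R x) (ball_moebius l z)))^2) powr ?n)"
          unfolding herm_kernel_def[symmetric] by simp
      qed
      with b show "(\<integral>\<^sup>+x. ennreal (herm_kernel (r *\<^sub>R x) (ball_moebius l z) ^ CARD('n) * 1) \<partial>unif_ball) \<le> ennreal (B z)"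
        by simp
    next
      have "integrable \<nu> (\<lambda>z. (1 + C * r ^ 3) * herm_kernel l z ^ CARD('n)
          - ?m * ?n * r^2 * (herm_kernel l z ^ CARD('n) * (1 - (norm (ball_moebius l z))^2)))"
        using integrable_kernel[OF l] integrable_kernel_deriv[OF l] by auto
      then show "integrable \<nu> (\<lambda>z. herm_kernel l z ^ CARD('n) * B z)"
        by (simp add: B_def algebra_simps)
    qed simp_all
    also have "\<dots> = (LINT z|\<nu>. (1 + C * r ^ 3) * herm_kernel l z ^ CARD('n)
          - ?m * ?n * r^2 * (herm_kernel l z ^ CARD('n) * (1 - (norm (ball_moebius l z))^2)))"
      by (simp add: B_def algebra_simps)
    also have "\<dots> = (1 + C * r ^ 3) * pot l - ?m * ?n * r^2 * pot_deriv l"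
      unfolding pot_def pot_deriv_def using integrable_kernel[OF l] integrable_kernel_deriv[OF l]
      by (subst Bochner_Integration.integral_diff) auto
    finally have "(LINT x|unif_ball. pot (ball_moebius l (r *\<^sub>R x))) \<le> (1 + C * r ^ 3) * pot l - ?m * ?n * r^2 * pot_deriv l"
      by simp
    moreover have "C * r ^ 3 * pot l \<le> C * r ^ 3 * pot_max"
      using Cd r pot_le[OF l] by (intro mult_left_mono) auto
    ultimately have "1 + ?m * ?n * r^2 * pot_deriv l - C * pot_max * r ^ 3 \<le> 1 + pot l - (LINT x|unif_ball. pot (ball_moebius l (r *\<^sub>R x)))"
      by (simp add: algebra_simps)
    then have "damped l * (1 + ?m * ?n * r^2 * pot_deriv l - C * pot_max * r ^ 3) \<le>
      damped l * (1 + pot l - (LINT x|unif_ball. pot (ball_moebius l (r *\<^sub>R x))))"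
      by (intro mult_left_mono damped_nonneg)
    also have "\<dots> \<le> (LINT x|unif_ball. damped (ball_moebius l (r *\<^sub>R x)))"
      by (rule damped_local_mean[OF l r(1) r1])
    finally show ?thesis
      by (simp add: algebra_simps)
  qed
  have "0 \<le> pot_max"
    unfolding pot_max_def pot_bound_def by simp
  then show ?thesis
    using main Cd by (intro exI[of _ "C * pot_max"] exI[of _ d]) auto
qed

text \<open>The local inequality is integrated against h^(n+e) and the invariant measure.
  Self-adjointness moves the averaging from \<open>damped\<close> to the weight, where it costs a
  factor 1 + m r^2 (n + e) e / n up to order r^3. The zeroth-order terms cancel; dividing by m r^2
  and letting r tend to 0 leaves the claim.\<close>

theorem damped_derivative_bound:
  assumes e: "e > 0"
  shows "ennreal (real CARD('n)) * (\<integral>\<^sup>+l. ennreal (damped l * pot_deriv l) * ennreal ((1 - (norm l)^2) powr (e - 1)) \<partial>unif_ball) \<le>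
    ennreal ((real CARD('n) + e) * e / real CARD('n)) * (\<integral>\<^sup>+l. ennreal (damped l) * ennreal ((1 - (norm l)^2) powr (e - 1)) \<partial>unif_ball)"
proof -
  interpret U: prob_space "unif_ball :: (complex ^ 'n) measure" by (rule prob_space_unif_ball)
  let ?n = "real CARD('n)" and ?m = "ball_moment TYPE('n)"
  define b where "b = ?n + e"
  define W where "W l = ennreal ((1 - (norm l)^2) powr b)" for l :: "complex ^ 'n"
  define k where "k = b * e / ?n"
  have k: "k \<ge> 0" using e by (simp add: k_def b_def)
  have bk: "b^2 / ?n - b = k"
    by (simp add: k_def b_def power2_eq_square field_simps)
  have m: "?m > 0" by (rule ball_moment_pos)
  have [measurable]: "W \<in> borel_measurable borel"
    unfolding W_def by measurable
  obtain C1 d1 where 1: "0 \<le> C1" "0 < d1" "d1 \<le> 1 / 4" "\<And>r l. 0 < r \<Longrightarrow> r \<le> d1 \<Longrightarrow> norm l < 1 \<Longrightarrow>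
    damped l * (1 + ?m * ?n * r^2 * pot_deriv l) \<le>
    (LINT x|unif_ball. damped (ball_moebius l (r *\<^sub>R x))) + C1 * r ^ 3 * damped l"
    using damped_local_inequality by blast
  have b0: "0 \<le> b" using e by (simp add: b_def)
  obtain C2 d2 where 2: "0 \<le> C2" "0 < d2" "d2 \<le> 1 / 4" "\<And>r l. 0 < r \<Longrightarrow> r \<le> d2 \<Longrightarrow> norm l < 1 \<Longrightarrow>
    (\<integral>\<^sup>+x. W (ball_moebius l (r *\<^sub>R x)) \<partial>unif_ball) \<le> W l * ennreal (1 + ?m * r^2 * k + C2 * r ^ 3)"
    using moebius_average_weight[OF b0, where 'n='n] unfolding W_def bk by blast
  obtain K where K: "\<And>x. norm x < 1 \<Longrightarrow> damped x \<le> K" using damped_bounded by blast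
  define J where "J g = (\<integral>\<^sup>+l. ennreal (g l) * W l \<partial>invariant_measure)" for g
  have W_fin: "(\<integral>\<^sup>+l. W l \<partial>invariant_measure) < \<infinity>"
  proof -
    have "(\<integral>\<^sup>+l. W l \<partial>invariant_measure) = (\<integral>\<^sup>+l. ennreal ((1 - (norm (l :: complex ^ 'n))^2) powr (e - 1)) \<partial>unif_ball)"
      using nn_integral_weight_tau[of "\<lambda>_. 1" e] by (simp add: W_def b_def)
    then show ?thesis using nn_integral_unif_ball_weight[OF e, where 'n='n] by simp
  qed
  have J_fin: "J g < \<infinity>" if "\<And>l. norm l < 1 \<Longrightarrow> g l \<le> A" for g A
  proof -
    have "J g \<le> (\<integral>\<^sup>+l. ennreal A * W l \<partial>invariant_measure)"
      unfolding J_def by (intro nn_integral_mono_AE eventually_mono[OF AE_tau] mult_right_mono ennreal_leI that) auto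
    also have "\<dots> = ennreal A * (\<integral>\<^sup>+l. W l \<partial>invariant_measure)"
      by (rule nn_integral_cmult) measurable
    also have "\<dots> < \<infinity>" using W_fin by (simp add: ennreal_mult_less_top)
    finally show ?thesis .
  qed
  \<comment> \<open>Both integrals are finite because e > 0 and the integrands are bounded. They are
    turned into reals so that the common term \<open>a\<close> can be cancelled.\<close>
  define a where "a = enn2real (J damped)"
  define p where "p = enn2real (J (\<lambda>l. damped l * pot_deriv l))"
  have a: "J damped = ennreal a"
    using J_fin[of damped K] K by (simp add: a_def less_top)
  have "damped l * pot_deriv l \<le> K * pot_max" if "norm l < 1" for l
    using K[OF that] damped_nonneg[of l] pot_deriv_nonneg[OF that] pot_deriv_le[OF that]
    by (intro mult_mono) auto
  then have p: "J (\<lambda>l. damped l * pot_deriv l) = ennreal p"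
    using J_fin[of "\<lambda>l. damped l * pot_deriv l" "K * pot_max"] by (simp add: p_def less_top)
  have ap: "0 \<le> a" "0 \<le> p" by (simp_all add: a_def p_def)
  have ineq: "?n * p \<le> k * a + r * ((C1 + C2) * a / ?m)" if r: "0 < r" "r \<le> min d1 d2" for r
  proof -
    have r12: "r \<le> d1" "r \<le> d2" "r \<le> 1" using r 1 by auto
    let ?A = "\<lambda>l. \<integral>\<^sup>+x. ennreal (damped (ball_moebius l (r *\<^sub>R x))) \<partial>unif_ball"
    have loc: "ennreal (damped l) + ennreal (?m * ?n * r^2) * ennreal (damped l * pot_deriv l) \<le>
        ?A l + ennreal (C1 * r ^ 3) * ennreal (damped l)" if l: "norm l < 1" for l
    proof -
      have pd: "0 \<le> damped l * pot_deriv l" using damped_nonneg pot_deriv_nonneg[OF l] by simp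
      have mb: "norm (ball_moebius l (r *\<^sub>R x)) < 1" if "norm x < 1" for x
        by (rule norm_moebius_less_1[OF l norm_scaleR_less_1[OF that r(1) r12(3)]])
      have "integrable unif_ball (\<lambda>x. damped (ball_moebius l (r *\<^sub>R x)))"
        by (rule integrable_unif_ball_bounded[of _ K]) (use K mb damped_nonneg in auto)
      then have A: "?A l = ennreal (LINT x|unif_ball. damped (ball_moebius l (r *\<^sub>R x)))"
        by (rule nn_integral_eq_integral) (simp add: damped_nonneg)
      have "ennreal (damped l) + ennreal (?m * ?n * r^2) * ennreal (damped l * pot_deriv l) =
        ennreal (damped l * (1 + ?m * ?n * r^2 * pot_deriv l))"
      proof -
        have X: "damped l * (1 + ?m * ?n * r^2 * pot_deriv l) = damped l + ?m * ?n * r^2 * (damped l * pot_deriv l)"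
          by (simp add: algebra_simps)
        have c: "0 \<le> ?m * ?n * r^2" using m by simp
        show ?thesis
          unfolding X ennreal_mult'[OF c, symmetric]
          by (rule ennreal_plus[symmetric, OF damped_nonneg mult_nonneg_nonneg[OF c pd]])
      qed
      also have "\<dots> \<le> ennreal ((LINT x|unif_ball. damped (ball_moebius l (r *\<^sub>R x))) + C1 * r ^ 3 * damped l)"
        by (intro ennreal_leI 1(4) r(1) r12 l)
      also have "\<dots> = ?A l + ennreal (C1 * r ^ 3) * ennreal (damped l)"
        unfolding A using damped_nonneg 1(1) r(1)
        by (subst ennreal_plus) (auto simp: ennreal_mult'[symmetric])
      finally show ?thesis .
    qed
    have "J damped + ennreal (?m * ?n * r^2) * J (\<lambda>l. damped l * pot_deriv l) =
      (\<integral>\<^sup>+l. (ennreal (damped l) + ennreal (?m * ?n * r^2) * ennreal (damped l * pot_deriv l)) * W l \<partial>invariant_measure)"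
      unfolding J_def distrib_right mult.assoc
      by (subst nn_integral_add, measurable) (subst nn_integral_cmult, auto)
    also have "\<dots> \<le> (\<integral>\<^sup>+l. (?A l + ennreal (C1 * r ^ 3) * ennreal (damped l)) * W l \<partial>invariant_measure)"
      by (intro nn_integral_mono_AE eventually_mono[OF AE_tau] mult_right_mono loc) auto
    also have "\<dots> = (\<integral>\<^sup>+l. ?A l * W l \<partial>invariant_measure) + ennreal (C1 * r ^ 3) * J damped"
      unfolding J_def distrib_right mult.assoc
      by (subst nn_integral_add, measurable) (subst nn_integral_cmult, auto)
    also have "(\<integral>\<^sup>+l. ?A l * W l \<partial>invariant_measure) = (\<integral>\<^sup>+l. ennreal (damped l) * (\<integral>\<^sup>+x. W (ball_moebius l (r *\<^sub>R x)) \<partial>unif_ball) \<partial>invariant_measure)"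
      using moebius_average_symmetric[of "\<lambda>l. ennreal (damped l)" W r] r r12 by simp
    also have "\<dots> \<le> (\<integral>\<^sup>+l. ennreal (damped l) * (W l * ennreal (1 + ?m * r^2 * k + C2 * r ^ 3)) \<partial>invariant_measure)"
      using r r12 by (intro nn_integral_mono_AE eventually_mono[OF AE_tau] mult_left_mono 2(4)) auto
    also have "\<dots> = J damped * ennreal (1 + ?m * r^2 * k + C2 * r ^ 3)"
      unfolding J_def mult.assoc[symmetric] by (rule nn_integral_multc) measurable
    finally have "ennreal a + ennreal (?m * ?n * r^2) * ennreal p \<le>
        ennreal a * ennreal (1 + ?m * r^2 * k + C2 * r ^ 3) + ennreal (C1 * r ^ 3) * ennreal a"
      unfolding a p by (simp add: add_mono)
    then have "a + ?m * ?n * r^2 * p \<le> a * (1 + ?m * r^2 * k + C2 * r ^ 3) + C1 * r ^ 3 * a"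
      using ap m k 1(1) 2(1) r
      by (simp add: ennreal_mult'[symmetric] ennreal_plus[symmetric] del: ennreal_plus)
    moreover have E: "(?m * r^2) * (k * a + r * ((C1 + C2) * a / ?m)) = ?m * r^2 * k * a + (C1 + C2) * r ^ 3 * a"
      using m by (simp add: field_simps power2_eq_square power3_eq_cube)
    ultimately have "(?m * r^2) * (?n * p) \<le> (?m * r^2) * (k * a + r * ((C1 + C2) * a / ?m))"
      unfolding E by (simp add: algebra_simps)
    then show ?thesis
      using m r by (simp add: mult_le_cancel_left_pos)
  qed
  have lim: "((\<lambda>r. k * a + r * ((C1 + C2) * a / ?m)) \<longlongrightarrow> k * a + 0 * ((C1 + C2) * a / ?m)) (at_right 0)"
    by (intro tendsto_intros)
  have "\<forall>\<^sub>F r in at_right 0. ?n * p \<le> k * a + r * ((C1 + C2) * a / ?m)"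
  proof (rule eventually_mono[OF eventually_at_right_real[of 0 "min d1 d2"]])
    show "0 < min d1 d2" using 1(2) 2(2) by simp
    show "?n * p \<le> k * a + r * ((C1 + C2) * a / ?m)" if "r \<in> {0<..<min d1 d2}" for r
      using that by (intro ineq) auto
  qed
  from tendsto_lowerbound[OF lim this] have "?n * p \<le> k * a" by simp
  then have "ennreal ?n * ennreal p \<le> ennreal k * ennreal a"
    using ap k by (simp add: ennreal_mult'[symmetric])
  moreover have "J g = (\<integral>\<^sup>+l. ennreal (g l) * ennreal ((1 - (norm l)^2) powr (e - 1)) \<partial>unif_ball)"
    if [measurable]: "g \<in> borel_measurable borel" for g
    unfolding J_def W_def b_def by (rule nn_integral_weight_tau) measurable
  ultimately show ?thesis
    unfolding a[symmetric] p[symmetric] by (simp add: k_def b_def)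
qed

end

section \<open>Boundary limits\<close>

lemma borel_measurable_sgn_vec [measurable]: "sgn \<in> borel_measurable (borel :: 'a::euclidean_space measure)"
  unfolding sgn_div_norm by measurable

lemma integrable_unif_ball_weight:
  fixes g :: "complex ^ 'n::finite \<Rightarrow> real"
  assumes e: "e > 0" and [measurable]: "g \<in> borel_measurable borel" and K: "\<And>x. norm x < 1 \<Longrightarrow> \<bar>g x\<bar> \<le> K"
  shows "integrable unif_ball (\<lambda>x. g x * (1 - (norm x)^2) powr (e - 1))"
proof (rule Bochner_Integration.integrable_bound[where f="\<lambda>x. K * (1 - (norm x)^2) powr (e - 1)"])
  have "integrable unif_ball (\<lambda>x::complex ^ 'n. (1 - (norm x)^2) powr (e - 1))"
    by (rule integrableI_nonneg) (simp_all add: nn_integral_unif_ball_weight[OF e])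
  then show "integrable unif_ball (\<lambda>x::complex ^ 'n. K * (1 - (norm x)^2) powr (e - 1))"
    by simp
  show "AE x in unif_ball. norm (g x * (1 - (norm x)^2) powr (e - 1)) \<le> norm (K * (1 - (norm x)^2) powr (e - 1))"
    by (intro eventually_mono[OF AE_unif_ball]) (auto simp: abs_mult intro!: mult_right_mono dest: K)
qed measurable

lemma integral_unif_ball_weight:
  assumes e: "e > 0"
  shows "(LINT x|unif_ball. (1 - (norm (x :: complex ^ 'n::finite))^2) powr (e - 1)) = real CARD('n) * Beta (real CARD('n)) e"
proof -
  have "0 \<le> real CARD('n) * Beta (real CARD('n)) e"
    using e by (simp add: Beta_def Gamma_real_nonneg)
  then show ?thesis
    by (subst integral_eq_nn_integral) (simp_all add: nn_integral_unif_ball_weight[OF e])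
qed

text \<open>The weight depends only on the norm and \<open>g (sgn x)\<close> only on the direction,
  and these are independent.\<close>

lemma integral_unif_ball_weight_sgn:
  fixes g :: "complex ^ 'n::finite \<Rightarrow> real"
  assumes e: "e > 0" and [measurable]: "g \<in> borel_measurable borel"
    and g: "\<And>x. 0 \<le> g x" "\<And>x. norm x \<le> 1 \<Longrightarrow> g x \<le> K"
  shows "(LINT x|unif_ball. g (sgn x) * (1 - (norm x)^2) powr (e - 1)) =
    (real CARD('n) * Beta (real CARD('n)) e) * (LINT x|unif_ball. g (sgn x))"
proof -
  have ns: "norm (sgn x) \<le> 1" for x :: "complex ^ 'n"
    by (simp add: norm_sgn)
  have int: "integrable unif_ball (\<lambda>x. g (sgn x))"
    by (rule integrable_unif_ball_bounded[of _ K]) (use g ns in auto)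
  have "(\<integral>\<^sup>+x. ennreal (g (sgn x) * (1 - (norm x)^2) powr (e - 1)) \<partial>unif_ball) =
    (\<integral>\<^sup>+x. (\<lambda>r z. ennreal ((1 - r^2) powr (e - 1)) * ennreal (g z)) (norm x) (sgn x) \<partial>unif_ball)"
    by (intro nn_integral_cong) (simp add: ennreal_mult g(1) mult.commute)
  also have "\<dots> = (\<integral>\<^sup>+x. \<integral>\<^sup>+y. ennreal ((1 - (norm (x :: complex ^ 'n))^2) powr (e - 1)) * ennreal (g (sgn y)) \<partial>unif_ball \<partial>unif_ball)"
    by (subst nn_integral_unif_ball_polar) auto
  also have "\<dots> = (\<integral>\<^sup>+x. ennreal ((1 - (norm (x :: complex ^ 'n))^2) powr (e - 1)) * ennreal (LINT y|unif_ball. g (sgn y)) \<partial>unif_ball)"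
    by (subst nn_integral_cmult) (auto simp: nn_integral_eq_integral[OF int] g)
  also have "\<dots> = ennreal (real CARD('n) * Beta (real CARD('n)) e) * ennreal (LINT y|unif_ball. g (sgn y))"
    by (subst nn_integral_multc) (auto simp: nn_integral_unif_ball_weight[OF e])
  also have "\<dots> = ennreal ((real CARD('n) * Beta (real CARD('n)) e) * (LINT y|unif_ball. g (sgn y)))"
    using e g by (intro ennreal_mult[symmetric] Bochner_Integration.integral_nonneg mult_nonneg_nonneg) (auto simp: Beta_def Gamma_real_nonneg)
  finally show ?thesis
    using e g by (subst integral_eq_nn_integral)
      (auto intro!: enn2real_ennreal mult_nonneg_nonneg Bochner_Integration.integral_nonneg simp: Beta_def Gamma_real_nonneg)
qed

text \<open>The measures e h^(e-1) dV have total mass tending to n and concentrate on the sphere.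
  Replacing \<open>g x\<close> by \<open>g (sgn x)\<close> costs at most \<eta> + A h(x); the second
  part contributes at most e A, because the integral of h^e is at most 1.\<close>

lemma boundary_concentration:
  fixes g :: "complex ^ 'n::finite \<Rightarrow> real" and e :: "nat \<Rightarrow> real"
  assumes meas [measurable]: "g \<in> borel_measurable borel" and cont: "continuous_on (cball 0 1) g"
    and g0: "\<And>x. 0 \<le> g x" and e: "\<And>k. e k > 0" "e \<longlonglongrightarrow> 0"
  shows "(\<lambda>k. e k * (LINT x|unif_ball. g x * (1 - (norm x)^2) powr (e k - 1)))
    \<longlonglongrightarrow> real CARD('n) * (LINT x|unif_ball. g (sgn x))"
proof -
  interpret U: prob_space "unif_ball :: (complex ^ 'n) measure" by (rule prob_space_unif_ball)
  let ?n = "real CARD('n)" and ?h = "\<lambda>x :: complex ^ 'n. 1 - (norm x)^2"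
  define N where "N k = ?n * Beta ?n (e k)" for k
  have N: "(\<lambda>k. e k * N k) \<longlonglongrightarrow> ?n"
    unfolding N_def by (rule tendsto_unif_ball_weight[OF e]) simp
  have "bounded (g ` cball 0 1)"
    by (intro compact_imp_bounded compact_continuous_image cont) auto
  then obtain K where "\<forall>y\<in>g ` cball 0 1. norm y \<le> K"
    unfolding bounded_iff by blast
  then have K: "g x \<le> K" if "norm x \<le> 1" for x
    using that by (auto simp: abs_le_iff)
  have K0: "0 \<le> K" using order_trans[OF g0 K[of 0]] by simp
  have ns: "norm (sgn x) \<le> 1" for x :: "complex ^ 'n"
    by (simp add: norm_sgn)
  have gb: "\<bar>g x\<bar> \<le> K" if "norm x \<le> 1" for x
    using g0 K[OF that] by simp
  define B where "B = (LINT x|unif_ball. g (sgn x))"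
  define D where "D k = e k * (LINT x|unif_ball. g x * ?h x powr (e k - 1)) - e k * N k * B" for k
  have "D \<longlonglongrightarrow> 0"
  proof (rule LIMSEQ_I)
    fix \<epsilon> :: real assume eps: "\<epsilon> > 0"
    \<comment> \<open>The total mass tends to n, so this part of the error tends to n \<eta> <
      \<epsilon>.\<close>
    define \<eta> where "\<eta> = \<epsilon> / (2 * (?n + 1))"
    have eta: "\<eta> > 0" using eps by (simp add: \<eta>_def)
    have "uniformly_continuous_on (cball 0 1) g"
      by (intro compact_uniformly_continuous cont) auto
    then obtain d where d: "d > 0" "\<And>x y. norm x \<le> 1 \<Longrightarrow> norm y \<le> 1 \<Longrightarrow> dist x y < d \<Longrightarrow> dist (g x) (g y) < \<eta>"
      unfolding uniformly_continuous_on_def using eta by (metis mem_cball dist_0_norm)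
    \<comment> \<open>If 1 - |x| \<ge> d then also h(x) \<ge> d, so A h(x) dominates the trivial
      bound K for the difference.\<close>
    define A where "A = K / d"
    have A: "A \<ge> 0" using K0 d by (simp add: A_def)
    have diff: "\<bar>g x - g (sgn x)\<bar> \<le> \<eta> + A * ?h x" if x: "norm x < 1" for x
    \<comment> \<open>The origin joins the first case because \<open>sgn 0 = 0\<close>, so the
      difference vanishes there.\<close>
    proof (cases "x = 0 \<or> 1 - norm x < d")
      case True
      have "dist x (sgn x) < d"
      proof (cases "x = 0")
        case False
        have "x - sgn x = (1 - 1 / norm x) *\<^sub>R x"
          by (simp add: sgn_div_norm algebra_simps divide_inverse)
        then have "dist x (sgn x) = \<bar>1 - 1 / norm x\<bar> * norm x"
          by (simp add: dist_norm)
        also have "\<dots> = 1 - norm x"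
          using False x by (simp add: abs_if field_simps)
        finally show ?thesis using True False by simp
      qed (use d in simp)
      then have "\<bar>g x - g (sgn x)\<bar> < \<eta>"
        using d(2)[of x "sgn x"] x ns by (simp add: dist_real_def)
      then show ?thesis
        using mult_nonneg_nonneg[OF A less_imp_le[OF one_minus_norm_pos[OF x]]] by linarith
    next
      case False
      then have "d \<le> 1 - norm x" by simp
      also have "\<dots> \<le> ?h x"
        using mult_left_le[of "norm x" "norm x"] x by (simp add: power2_eq_square)
      finally have "K / d * d \<le> K / d * ?h x"
        using K0 d by (intro mult_left_mono) auto
      then have "K \<le> A * ?h x" using d by (simp add: A_def)
      moreover have "\<bar>g x - g (sgn x)\<bar> \<le> K"
        using g0[of x] g0[of "sgn x"] K[of x] K[of "sgn x"] x ns[of x] by (auto simp: abs_le_iff intro: order_trans)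
      ultimately show ?thesis using eta by linarith
    qed
    have bound: "\<bar>D k\<bar> \<le> \<eta> * (e k * N k) + e k * A" for k
    proof -
      let ?w = "\<lambda>x. ?h x powr (e k - 1)"
      have i1: "integrable unif_ball (\<lambda>x. g x * ?w x)"
        by (rule integrable_unif_ball_weight[where K=K, OF e(1)]) (use gb in auto)
      have i2: "integrable unif_ball (\<lambda>x. g (sgn x) * ?w x)"
        by (rule integrable_unif_ball_weight[where K=K, OF e(1)]) (use gb ns in auto)
      have i3: "integrable unif_ball (\<lambda>x. (\<eta> + A * ?h x) * ?w x)"
        using eta A by (intro integrable_unif_ball_weight[where K="\<eta> + A", OF e(1)])
          (auto simp: abs_mult power_le_one intro!: order_trans[OF abs_triangle_ineq] mult_left_le)
      have i4: "integrable unif_ball ?w"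
        using integrable_unif_ball_weight[where g="\<lambda>_. 1" and K=1, OF e(1)[of k]] by simp
      have i5: "integrable unif_ball (\<lambda>x. ?h x * ?w x)"
        by (intro integrable_unif_ball_weight[where K=1, OF e(1)]) (auto simp: power_le_one)
      have "(LINT x|unif_ball. g x * ?w x) - N k * B = (LINT x|unif_ball. g x * ?w x) - (LINT x|unif_ball. g (sgn x) * ?w x)"
        unfolding N_def B_def using integral_unif_ball_weight_sgn[OF e(1) meas g0 K] by simp
      also have "\<dots> = (LINT x|unif_ball. (g x - g (sgn x)) * ?w x)"
        using i1 i2 by (simp add: left_diff_distrib)
      finally have "\<bar>(LINT x|unif_ball. g x * ?w x) - N k * B\<bar> \<le> (LINT x|unif_ball. \<bar>(g x - g (sgn x)) * ?w x\<bar>)"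
        by (simp add: integral_abs_bound)
      also have "\<dots> \<le> (LINT x|unif_ball. (\<eta> + A * ?h x) * ?w x)"
      proof (intro integral_mono_AE i3 eventually_mono[OF AE_unif_ball])
        show "integrable unif_ball (\<lambda>x. \<bar>(g x - g (sgn x)) * ?w x\<bar>)"
          using i1 i2 by (simp add: left_diff_distrib)
        show "\<bar>(g x - g (sgn x)) * ?w x\<bar> \<le> (\<eta> + A * ?h x) * ?w x" if "norm x < 1" for x
          unfolding abs_mult using diff[OF that] by (simp add: mult_right_mono)
      qed
      also have "\<dots> = \<eta> * N k + A * (LINT x|unif_ball. ?h x * ?w x)"
      proof -
        have "(\<lambda>x. (\<eta> + A * ?h x) * ?w x) = (\<lambda>x. \<eta> * ?w x + A * (?h x * ?w x))"
          by (simp add: algebra_simps)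
        then show ?thesis
          using i4 i5 by (simp add: N_def integral_unif_ball_weight[OF e(1)])
      qed
      also have "(LINT x|unif_ball. ?h x * ?w x) \<le> (LINT x|(unif_ball :: (complex ^ 'n) measure). 1)"
      proof (intro integral_mono_AE i5 eventually_mono[OF AE_unif_ball])
        fix x :: "complex ^ 'n" assume x: "norm x < 1"
        have "?h x * ?w x = ?h x powr (e k)"
          using one_minus_norm_pos[OF x] by (simp add: powr_mult_base)
        also have "\<dots> \<le> 1"
          using one_minus_norm_pos[OF x] less_imp_le[OF e(1)] by (intro powr_le1) auto
        finally show "?h x * ?w x \<le> 1" .
      qed simp
      finally have "\<bar>(LINT x|unif_ball. g x * ?w x) - N k * B\<bar> \<le> \<eta> * N k + A"
        using A U.prob_space by (simp add: mult_left_mono)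
      then have "e k * \<bar>(LINT x|unif_ball. g x * ?w x) - N k * B\<bar> \<le> e k * (\<eta> * N k + A)"
        using e(1)[of k] by (intro mult_left_mono) auto
      moreover have "D k = e k * ((LINT x|unif_ball. g x * ?w x) - N k * B)"
        by (simp add: D_def algebra_simps)
      then have "\<bar>D k\<bar> = e k * \<bar>(LINT x|unif_ball. g x * ?w x) - N k * B\<bar>"
        using e(1)[of k] by (simp only: abs_mult abs_of_pos)
      moreover have "e k * (\<eta> * N k + A) = \<eta> * (e k * N k) + e k * A"
        by (simp add: algebra_simps)
      ultimately show ?thesis by linarith
    qed
    have "(\<lambda>k. \<eta> * (e k * N k) + e k * A) \<longlonglongrightarrow> \<eta> * ?n + 0 * A"
      by (intro tendsto_intros N e)
    moreover have "\<eta> * ?n + 0 * A < \<epsilon>"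
    proof -
      have "\<eta> * (2 * (?n + 1)) = \<epsilon>" by (simp add: \<eta>_def)
      moreover have "\<eta> * ?n < \<eta> * (2 * (?n + 1))" using eta by (intro mult_strict_left_mono) auto
      ultimately show ?thesis by simp
    qed
    ultimately have "\<forall>\<^sub>F k in sequentially. \<eta> * (e k * N k) + e k * A < \<epsilon>"
      by (rule order_tendstoD)
    then have "\<forall>\<^sub>F k in sequentially. norm (D k - 0) < \<epsilon>"
      by eventually_elim (use bound in \<open>auto intro: le_less_trans\<close>)
    then show "\<exists>no. \<forall>k\<ge>no. norm (D k - 0) < \<epsilon>"
      unfolding eventually_sequentially .
  qed
  then have "(\<lambda>k. D k + e k * N k * B) \<longlonglongrightarrow> 0 + ?n * B"
    by (intro tendsto_intros N)
  then show ?thesis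
    by (simp add: D_def B_def)
qed

lemma inverse_nat_Suc_props: "0 < inverse (real (Suc k))" "(\<lambda>k. inverse (real (Suc k))) \<longlonglongrightarrow> 0"
  by simp (rule LIMSEQ_inverse_real_of_nat)

text \<open>This is what the invariance of the measure says about the integral of \<open>(1 - |x|^2)^(n+e)\<close> in the
  limit where \<open>e\<close> tends to \<open>0\<close>.\<close>

lemma sphere_mean_kernel_le:
  fixes v :: "complex ^ 'n::finite"
  assumes v: "norm v < 1"
  shows "(\<integral>\<^sup>+x. ennreal (1 / cmod (1 - herm (sgn x) v) ^ (2 * CARD('n))) \<partial>unif_ball) \<le> ennreal (1 / (1 - (norm v)^2) ^ CARD('n))"
proof -
  let ?n = "real CARD('n)" and ?h = "\<lambda>x :: complex ^ 'n. 1 - (norm x)^2"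
  define g where "g x = 1 / cmod (1 - herm x v) ^ (2 * CARD('n))" for x
  have hv: "0 < ?h v" by (rule one_minus_norm_pos[OF v])
  have nz: "1 - herm x v \<noteq> 0" if "norm x \<le> 1" for x
    using one_minus_herm_nonzero[of v x] that v by (metis cmod_one_minus_herm_commute norm_eq_zero)
  have [measurable]: "g \<in> borel_measurable borel"
    unfolding g_def by measurable
  have cont: "continuous_on (cball 0 1) g"
    unfolding g_def using nz by (intro continuous_intros) auto
  have g0: "0 \<le> g x" for x by (simp add: g_def)
  have ns: "norm (sgn x) \<le> 1" for x :: "complex ^ 'n"
    by (simp add: norm_sgn)
  have "bounded (g ` cball 0 1)"
    by (intro compact_imp_bounded compact_continuous_image cont) auto
  then obtain K where "\<forall>y\<in>g ` cball 0 1. norm y \<le> K"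
    unfolding bounded_iff by blast
  then have K: "\<bar>g x\<bar> \<le> K" if "norm x \<le> 1" for x
    using that by auto
  define e where "e k = inverse (real (Suc k))" for k
  have e: "e k > 0" "e \<longlonglongrightarrow> 0" for k
    using inverse_nat_Suc_props unfolding e_def by auto
  define N where "N k = ?n * Beta ?n (e k)" for k
  have N: "(\<lambda>k. e k * N k) \<longlonglongrightarrow> ?n"
    unfolding N_def by (rule tendsto_unif_ball_weight[OF e]) simp
  have N0: "0 \<le> N k" for k
    using e(1)[of k] by (simp add: N_def Beta_def Gamma_real_nonneg)
  have le: "(LINT x|unif_ball. g x * ?h x powr (e k - 1)) \<le> N k * (4 powr e k * ?h v powr (- (?n + e k)))" for k
  proof -
    \<comment> \<open>The function \<open>g\<close> has the fixed exponent n, whereas h(ball_moebius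
      v x)^(n+e) carries the power n + e of |1 - <x,v>|^(-2). Since |1 - <x,v>|^2 \<le> 4, the
      factor 4^(-e) makes up for the missing power; it tends to 1.\<close>
    let ?c = "?h v powr (?n + e k) * 4 powr (- e k)"
    have c: "?c > 0" using hv by simp
    have "(\<integral>\<^sup>+x. ennreal ?c * ennreal (g x * ?h x powr (e k - 1)) \<partial>unif_ball) =
      (\<integral>\<^sup>+x. ennreal (?c * g x) * ennreal (?h x powr (e k - 1)) \<partial>unif_ball)"
      using hv g0 by (intro nn_integral_cong) (simp add: ennreal_mult mult.assoc)
    also have "\<dots> = (\<integral>\<^sup>+x. ennreal (?c * g x) * ennreal (?h x powr (?n + e k)) \<partial>invariant_measure)"
      by (rule nn_integral_weight_tau[symmetric]) measurable
    also have "\<dots> \<le> (\<integral>\<^sup>+x. ennreal (?h (ball_moebius v x) powr (?n + e k)) \<partial>invariant_measure)"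
    proof (intro nn_integral_mono_AE eventually_mono[OF AE_tau])
      fix x :: "complex ^ 'n" assume x: "norm x < 1"
      let ?M = "cmod (1 - herm x v)"
      have M: "0 < ?M" using nz[of x] x by simp
      have "?M \<le> 2"
        using norm_triangle_ineq4[of 1 "herm x v"] cmod_herm_lt_1[of x v] x v by simp
      then have M4: "?M^2 \<le> 4"
        using power_mono[of ?M 2 2] by simp
      have hx: "0 < ?h x" by (rule one_minus_norm_pos[OF x])
      have "4 powr (- e k) \<le> (?M^2) powr (- e k)"
        using M M4 e(1)[of k] by (intro powr_mono2') auto
      then have "?c * g x * ?h x powr (?n + e k) \<le> ?h v powr (?n + e k) * (?M^2) powr (- e k) * g x * ?h x powr (?n + e k)"
        using g0 by (intro mult_right_mono mult_left_mono) auto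
      also have "\<dots> = (?h v * ?h x / ?M^2) powr (?n + e k)"
      proof -
        have gx: "g x = (?M^2) powr (- ?n)"
          using M by (simp add: g_def powr_minus powr_realpow power_mult inverse_eq_divide)
        have "a powr (c + d) * m powr (- d) * m powr (- c) * b powr (c + d) = (a * b / m) powr (c + d)"
          if "0 < a" "0 < b" "0 < m" for a b c d m :: real
          using that by (simp add: powr_mult powr_divide powr_add powr_minus field_simps)
        then show ?thesis unfolding gx using hv hx zero_less_power[OF M] by blast
      qed
      also have "\<dots> = ?h (ball_moebius v x) powr (?n + e k)"
        unfolding one_minus_norm_moebius[OF v x] ..
      finally have le: "?c * g x * ?h x powr (?n + e k) \<le> ?h (ball_moebius v x) powr (?n + e k)" .
      have nn: "0 \<le> ?c * g x"
        by (rule mult_nonneg_nonneg[OF less_imp_le[OF c] g0])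
      show "ennreal (?c * g x) * ennreal (?h x powr (?n + e k)) \<le> ennreal (?h (ball_moebius v x) powr (?n + e k))"
        unfolding ennreal_mult'[OF nn, symmetric] by (rule ennreal_leI[OF le])
    qed
    also have "\<dots> = (\<integral>\<^sup>+x. ennreal (?h x powr (?n + e k)) \<partial>invariant_measure)"
      by (rule nn_integral_tau_moebius[OF v, of "\<lambda>x. ennreal (?h x powr (?n + e k))"]) measurable
    also have "\<dots> = (\<integral>\<^sup>+x. ennreal (?h x powr (e k - 1)) \<partial>unif_ball)"
      using nn_integral_weight_tau[of "\<lambda>_. 1" "e k"] by simp
    also have "\<dots> = ennreal (N k)"
      unfolding N_def by (rule nn_integral_unif_ball_weight[OF e(1)])
    finally have "(\<integral>\<^sup>+x. ennreal (?c * (g x * ?h x powr (e k - 1))) \<partial>unif_ball) \<le> ennreal (N k)"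
      using c by (simp add: ennreal_mult'[OF less_imp_le])
    then have "(LINT x|unif_ball. ?c * (g x * ?h x powr (e k - 1))) \<le> N k"
      using N0 c g0 by (subst integral_eq_nn_integral) (auto intro!: enn2real_leI)
    then have le: "?c * (LINT x|unif_ball. g x * ?h x powr (e k - 1)) \<le> N k"
      by simp
    have one: "?c * (4 powr e k * ?h v powr (- (?n + e k))) = 1"
    proof -
      have "a powr s * 4 powr (- t) * (4 powr t * a powr (- s)) = 1" if "0 < a" for a s t :: real
        using that by (simp add: powr_minus field_simps)
      then show ?thesis using hv by blast
    qed
    have "?c * (LINT x|unif_ball. g x * ?h x powr (e k - 1)) \<le> ?c * (N k * (4 powr e k * ?h v powr (- (?n + e k))))"
      unfolding mult.left_commute[of ?c "N k"] one mult_1_right by (rule le)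
    then show ?thesis
      using c by (rule mult_left_le_imp_le)
  qed
  have "(\<lambda>k. e k * N k * (4 powr e k * ?h v powr (- (?n + e k)))) \<longlonglongrightarrow> ?n * (4 powr 0 * ?h v powr (- (?n + 0)))"
    using hv by (intro tendsto_intros N e(2)) auto
  moreover have "e k * (LINT x|unif_ball. g x * ?h x powr (e k - 1)) \<le> e k * N k * (4 powr e k * ?h v powr (- (?n + e k)))" for k
    using mult_left_mono[OF le less_imp_le[OF e(1)]] by (simp add: mult.assoc)
  ultimately have "?n * (LINT x|unif_ball. g (sgn x)) \<le> ?n * (4 powr 0 * ?h v powr (- (?n + 0)))"
    using boundary_concentration[OF \<open>g \<in> borel_measurable borel\<close> cont g0 e] by (intro LIMSEQ_le) auto
  moreover have "?h v powr (- ?n) = 1 / ?h v ^ CARD('n)"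
    using hv by (simp add: powr_minus powr_realpow inverse_eq_divide)
  ultimately have "?n * (LINT x|unif_ball. g (sgn x)) \<le> ?n * (1 / ?h v ^ CARD('n))"
    by simp
  then have "(LINT x|unif_ball. g (sgn x)) \<le> 1 / ?h v ^ CARD('n)"
    by (rule mult_left_le_imp_le) simp
  moreover have "integrable unif_ball (\<lambda>x. g (sgn x))"
    by (rule integrable_unif_ball_bounded[of _ K]) (use K ns in auto)
  ultimately show ?thesis
    unfolding g_def[symmetric] using g0 by (subst nn_integral_eq_integral) (auto intro: ennreal_leI)
qed

text \<open>On the sphere of radius \<rho> the factor \<rho> moves from \<open>x\<close> to
  \<open>v\<close>, and the spherical estimate at the point \<rho> v bounds the mean of the n-th
  power of the kernel by 1, its value at the centre. What remains is the integral of h^n.\<close>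

lemma weighted_mean_kernel_le:
  fixes v :: "complex ^ 'n::finite"
  assumes v: "norm v < 1"
  shows "(\<integral>\<^sup>+x. ennreal (herm_kernel x v ^ CARD('n) * (1 - (norm x)^2) ^ CARD('n)) \<partial>unif_ball) \<le>
    ennreal ((fact CARD('n))^2 / fact (2 * CARD('n)))"
proof -
  let ?g = "\<lambda>r z. ennreal (((1 - r^2) / (cmod (1 - herm (r *\<^sub>R z) v))^2) ^ CARD('n) * (1 - r^2) ^ CARD('n))"
  have ns: "norm x *\<^sub>R sgn x = x" for x :: "complex ^ 'n"
    by (cases "x = 0") (simp_all add: sgn_div_norm)
  have "(\<integral>\<^sup>+x. ennreal (herm_kernel x v ^ CARD('n) * (1 - (norm x)^2) ^ CARD('n)) \<partial>unif_ball) =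
      (\<integral>\<^sup>+x. ?g (norm x) (sgn x) \<partial>unif_ball)"
    by (intro nn_integral_cong) (simp add: ns herm_kernel_def)
  also have "\<dots> = (\<integral>\<^sup>+x. \<integral>\<^sup>+y. ?g (norm (x :: complex ^ 'n)) (sgn y) \<partial>unif_ball \<partial>unif_ball)"
    by (rule nn_integral_unif_ball_polar) measurable
  also have "\<dots> \<le> (\<integral>\<^sup>+x. ennreal ((1 - (norm (x :: complex ^ 'n))^2) ^ CARD('n)) \<partial>unif_ball)"
  proof (intro nn_integral_mono_AE eventually_mono[OF AE_unif_ball])
    fix x :: "complex ^ 'n" assume x: "norm x < 1"
    let ?r = "norm x"
    let ?h = "1 - ?r^2"
    have h: "0 < ?h" by (rule one_minus_norm_pos[OF x])
    have rv: "norm (?r *\<^sub>R v) \<le> ?r" using v by (simp add: mult_left_le)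
    have herm: "herm (?r *\<^sub>R z) v = herm z (?r *\<^sub>R v)" for z
      by (simp add: scaleR_eq_smult herm_smult_left herm_smult_right)
    have "(\<integral>\<^sup>+y. ?g ?r (sgn y) \<partial>unif_ball) =
      (\<integral>\<^sup>+y. ennreal (?h ^ CARD('n) * ?h ^ CARD('n)) * ennreal (1 / cmod (1 - herm (sgn y) (?r *\<^sub>R v)) ^ (2 * CARD('n))) \<partial>unif_ball)"
      using h by (intro nn_integral_cong) (simp add: herm power_divide power_mult ennreal_mult'[symmetric])
    also have "\<dots> = ennreal (?h ^ CARD('n) * ?h ^ CARD('n)) * (\<integral>\<^sup>+y. ennreal (1 / cmod (1 - herm (sgn y) (?r *\<^sub>R v)) ^ (2 * CARD('n))) \<partial>unif_ball)"
      by (rule nn_integral_cmult) measurable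
    also have "\<dots> \<le> ennreal (?h ^ CARD('n) * ?h ^ CARD('n)) * ennreal (1 / (1 - (norm (?r *\<^sub>R v))^2) ^ CARD('n))"
      using rv x by (intro mult_left_mono sphere_mean_kernel_le) auto
    also have "\<dots> \<le> ennreal (?h ^ CARD('n) * ?h ^ CARD('n)) * ennreal (1 / ?h ^ CARD('n))"
    proof -
      have "norm (?r *\<^sub>R v) < 1" using rv x by linarith
      then have "0 < 1 - (norm (?r *\<^sub>R v))^2" by (rule one_minus_norm_pos)
      moreover have "?h \<le> 1 - (norm (?r *\<^sub>R v))^2"
        using power_mono[OF rv norm_ge_zero, of 2] by linarith
      ultimately show ?thesis
        using h by (intro mult_left_mono ennreal_leI divide_left_mono power_mono mult_pos_pos zero_less_power) simp_all
    qed
    also have "\<dots> = ennreal (?h ^ CARD('n))"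
      using h by (simp add: ennreal_mult'[symmetric])
    finally show "(\<integral>\<^sup>+y. ?g ?r (sgn y) \<partial>unif_ball) \<le> ennreal (?h ^ CARD('n))" .
  qed
  also have "\<dots> = ennreal ((fact CARD('n))^2 / fact (2 * CARD('n)))"
    by (rule nn_integral_unif_ball_power)
  finally show ?thesis .
qed

section \<open>Embedding inequality for damped functions\<close>

lemma ennreal_le_divide:
  assumes "ennreal n * I \<le> ennreal t" "0 < n" "0 \<le> t"
  shows "I \<le> ennreal (t / n)"
proof (cases I rule: ennreal_cases)
  case (real i)
  then have "n * i \<le> t"
    using assms by (simp add: ennreal_mult'[symmetric])
  then show ?thesis
    using real assms by (auto simp: field_simps intro!: ennreal_leI)
next
  case top
  then show ?thesis using assms by (simp add: ennreal_mult_top top_unique)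
qed

section \<open>The rotation invariant probability measure proportional to (1 - |x|^2)^n dV\<close>

definition weight_const :: "'n::finite itself \<Rightarrow> real" where
  "weight_const _ = (fact CARD('n))^2 / fact (2 * CARD('n))"

lemma weight_const_pos: "0 < weight_const TYPE('n::finite)"
  by (simp add: weight_const_def)

definition weighted_ball :: "(complex ^ 'n::finite) measure" where
  "weighted_ball = density unif_ball (\<lambda>x. ennreal ((1 - (norm x)^2) ^ CARD('n) / weight_const TYPE('n)))"

lemma sets_weighted_ball [simp, measurable_cong]: "sets weighted_ball = sets borel"
  by (simp add: weighted_ball_def)

lemma AE_weighted_ball: "AE x in (weighted_ball :: (complex ^ 'n::finite) measure). norm x < 1"
  unfolding weighted_ball_def by (subst AE_density) (auto intro: eventually_mono[OF AE_unif_ball])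

lemma nn_integral_weighted_ball:
  fixes g :: "complex ^ 'n::finite \<Rightarrow> ennreal"
  assumes [measurable]: "g \<in> borel_measurable borel"
  shows "(\<integral>\<^sup>+x. g x \<partial>weighted_ball) = (\<integral>\<^sup>+x. ennreal ((1 - (norm x)^2) ^ CARD('n) / weight_const TYPE('n)) * g x \<partial>unif_ball)"
  unfolding weighted_ball_def by (rule nn_integral_density) measurable

lemma prob_space_weighted_ball: "prob_space (weighted_ball :: (complex ^ 'n::finite) measure)"
proof (rule prob_spaceI)
  let ?c = "weight_const TYPE('n)"
  have "emeasure (weighted_ball :: (complex ^ 'n) measure) (space weighted_ball) = (\<integral>\<^sup>+x. 1 \<partial>(weighted_ball :: (complex ^ 'n) measure))"
    by simp
  also have "\<dots> = (\<integral>\<^sup>+x. ennreal (1 / ?c) * ennreal ((1 - (norm (x :: complex ^ 'n))^2) ^ CARD('n)) \<partial>unif_ball)"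
    using weight_const_pos[where 'n='n]
    by (subst nn_integral_weighted_ball) (auto intro!: nn_integral_cong simp: ennreal_mult'[symmetric])
  also have "\<dots> = ennreal (1 / ?c) * ennreal ?c"
    by (subst nn_integral_cmult) (auto simp: nn_integral_unif_ball_power weight_const_def)
  also have "\<dots> = 1"
    using weight_const_pos[where 'n='n] by (simp add: ennreal_mult'[symmetric])
  finally show "emeasure (weighted_ball :: (complex ^ 'n) measure) (space weighted_ball) = 1" .
qed

lemma weighted_ball_rotation:
  "distr weighted_ball borel (\<lambda>x. cis t *s x) = (weighted_ball :: (complex ^ 'n::finite) measure)"
proof (rule measure_eqI)
  fix A assume "A \<in> sets (distr weighted_ball borel (\<lambda>x::complex ^ 'n. cis t *s x))"
  then have A[measurable]: "A \<in> sets borel" by simp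
  let ?g = "\<lambda>x. ennreal ((1 - (norm x)^2) ^ CARD('n) / weight_const TYPE('n)) * indicator A x"
  have "emeasure (distr weighted_ball borel (\<lambda>x. cis t *s x)) A = (\<integral>\<^sup>+x. indicator A (cis t *s x) \<partial>(weighted_ball :: (complex ^ 'n) measure))"
    by (subst nn_integral_indicator[symmetric], simp, subst nn_integral_distr) auto
  also have "\<dots> = (\<integral>\<^sup>+x. ?g (cis t *s x) \<partial>unif_ball)"
  proof -
    have [measurable]: "(\<lambda>x :: complex ^ 'n. indicator A (cis t *s x) :: ennreal) \<in> borel_measurable borel"
      by (rule measurable_compose[of "\<lambda>x. cis t *s x" _ borel]) auto
    show ?thesis
      by (subst nn_integral_weighted_ball) (auto simp: norm_smult)
  qed
  also have "\<dots> = (\<integral>\<^sup>+x. ?g x \<partial>unif_ball)"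
    by (rule nn_integral_unif_ball_isometry) (simp_all add: linear_smult norm_smult)
  also have "\<dots> = (\<integral>\<^sup>+x. indicator A x \<partial>weighted_ball)"
    by (subst nn_integral_weighted_ball) auto
  also have "\<dots> = emeasure weighted_ball A"
    by simp
  finally show "emeasure (distr weighted_ball borel (\<lambda>x. cis t *s x)) A = emeasure weighted_ball A" .
qed simp

lemma integral_weighted_ball:
  fixes g :: "complex ^ 'n::finite \<Rightarrow> real"
  assumes [measurable]: "g \<in> borel_measurable borel"
  shows "(LINT x|weighted_ball. g x) = (LINT x|unif_ball. g x * (1 - (norm x)^2) ^ CARD('n)) / weight_const TYPE('n)"
proof -
  have "(LINT x|weighted_ball. g x) = (LINT x|unif_ball. (1 - (norm x)^2) ^ CARD('n) / weight_const TYPE('n) * g x)"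
    unfolding weighted_ball_def using weight_const_pos[where 'n='n]
    by (subst integral_real_density) (auto intro!: eventually_mono[OF AE_unif_ball] simp: power_le_one)
  also have "\<dots> = (LINT x|unif_ball. g x * (1 - (norm x)^2) ^ CARD('n) / weight_const TYPE('n))"
    by (simp add: mult.commute)
  finally show ?thesis by simp
qed

lemma herm_kernel_moebius_center:
  assumes "norm z < 1" "norm y < 1"
  shows "herm_kernel (ball_moebius z y) z = (1 - (norm y)^2) / (1 - (norm z)^2)"
proof -
  let ?N = "cmod (1 - herm y z)"
  have N: "?N \<noteq> 0"
    using one_minus_herm_nonzero[of y z] assms by simp
  have hz: "0 < 1 - (norm z)^2" by (rule one_minus_norm_pos[OF assms(1)])
  have "?N * cmod (1 - herm (ball_moebius z y) z) = 1 - (norm z)^2"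
    unfolding norm_mult[symmetric] herm_moebius_self[OF assms] norm_of_real using hz by simp
  then have e: "cmod (1 - herm (ball_moebius z y) z) = (1 - (norm z)^2) / ?N"
    using N by (simp add: field_simps)
  have "a * b / N^2 / (a / N)^2 = b / a" if "a \<noteq> 0" "N \<noteq> 0" for a b N :: real
    using that by (simp add: field_simps power2_eq_square)
  then show ?thesis
    unfolding herm_kernel_def one_minus_norm_moebius[OF assms] e using N hz by simp
qed

context ball_potential_function
begin

text \<open>The limit e -> 0 of \<open>damped_derivative_bound\<close>. Fatou's lemma handles the
  left side. On the right the damping is dropped first, because |f|^2 is continuous up to the
  sphere; then (n + e) e / n times its integral tends to n times the boundary integral, and this n
  cancels the one on the left.\<close>

theorem damped_derivative_integral_le:
  "(\<integral>\<^sup>+l. ennreal (damped l * pot_deriv l) * ennreal (1 / (1 - (norm l)^2)) \<partial>unif_ball) \<le>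
    ennreal (LINT x|unif_ball. (cmod (f (sgn x)))^2)"
proof -
  let ?n = "real CARD('n)" and ?h = "\<lambda>x :: complex ^ 'n. 1 - (norm x)^2"
  define B where "B = (LINT x|unif_ball. (cmod (f (sgn x)))^2)"
  define e where "e k = inverse (real (Suc k))" for k
  have e: "e k > 0" "e \<longlonglongrightarrow> 0" for k
    using inverse_nat_Suc_props unfolding e_def by auto
  define I where "I k = (\<integral>\<^sup>+l. ennreal (damped l * pot_deriv l) * ennreal (?h l powr (e k - 1)) \<partial>unif_ball)" for k
  define L where "L k = (LINT x|unif_ball. (cmod (f x))^2 * ?h x powr (e k - 1))" for k
  define t where "t k = (?n + e k) / ?n * (e k * L k)" for k
  obtain K where K: "K \<ge> 0" "\<And>x. norm x \<le> 1 \<Longrightarrow> cmod (f x) \<le> K" using f_bounded by auto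
  have f2: "(\<lambda>x. (cmod (f x))^2) \<in> borel_measurable borel" by measurable
  have L0: "0 \<le> L k" for k
    unfolding L_def by (intro Bochner_Integration.integral_nonneg) simp
  have lim: "(\<lambda>k. e k * L k) \<longlonglongrightarrow> ?n * B"
    unfolding L_def B_def using e
    by (intro boundary_concentration f2 continuous_intros continuous_on_subset[OF cont_f]) auto
  have "(\<lambda>k. t k / ?n) \<longlonglongrightarrow> (?n + 0) / ?n * (?n * B) / ?n"
    unfolding t_def
    by (intro tendsto_divide[OF tendsto_mult[OF tendsto_divide[OF tendsto_add[OF tendsto_const e(2)] tendsto_const] lim] tendsto_const]) auto
  then have t_lim: "(\<lambda>k. ennreal (t k / ?n)) \<longlonglongrightarrow> ennreal B"
    by (intro tendsto_ennrealI) simp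
  have I_le: "I k \<le> ennreal (t k / ?n)" for k
  proof (rule ennreal_le_divide)
    have "ennreal ?n * I k \<le> ennreal ((?n + e k) * e k / ?n) * (\<integral>\<^sup>+l. ennreal (damped l) * ennreal (?h l powr (e k - 1)) \<partial>unif_ball)"
      unfolding I_def by (rule damped_derivative_bound[OF e(1)])
    also have "(\<integral>\<^sup>+l. ennreal (damped l) * ennreal (?h l powr (e k - 1)) \<partial>unif_ball) \<le> (\<integral>\<^sup>+x. ennreal ((cmod (f x))^2 * ?h x powr (e k - 1)) \<partial>unif_ball)"
    proof (intro nn_integral_mono_AE eventually_mono[OF AE_unif_ball])
      fix x :: "complex ^ 'n" assume x: "norm x < 1"
      have "damped x \<le> (cmod (f x))^2"
        unfolding damped_def using pot_nonneg[OF x] by (intro mult_left_le) auto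
      then show "ennreal (damped x) * ennreal (?h x powr (e k - 1)) \<le> ennreal ((cmod (f x))^2 * ?h x powr (e k - 1))"
        using damped_nonneg[of x] by (subst ennreal_mult[symmetric]) (auto intro!: ennreal_leI mult_right_mono)
    qed
    also have "\<dots> = ennreal (L k)"
      unfolding L_def using K
      by (intro nn_integral_eq_integral integrable_unif_ball_weight[where K="K^2", OF e(1)]) (auto intro!: power_mono)
    also have "ennreal ((?n + e k) * e k / ?n) * ennreal (L k) = ennreal (t k)"
      using less_imp_le[OF e(1)] by (subst ennreal_mult'[symmetric]) (auto simp: t_def mult.assoc)
    finally show "ennreal ?n * I k \<le> ennreal (t k)"
      by (simp add: mult_left_mono)
    show "0 \<le> t k"
      using less_imp_le[OF e(1)] L0 by (simp add: t_def)
  qed simp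
  have "(\<integral>\<^sup>+l. ennreal (damped l * pot_deriv l) * ennreal (1 / ?h l) \<partial>unif_ball) =
    (\<integral>\<^sup>+l. liminf (\<lambda>k. ennreal (damped l * pot_deriv l) * ennreal (?h l powr (e k - 1))) \<partial>unif_ball)"
  proof (intro nn_integral_cong_AE eventually_mono[OF AE_unif_ball])
    fix l :: "complex ^ 'n" assume l: "norm l < 1"
    have h: "0 < ?h l" by (rule one_minus_norm_pos[OF l])
    have "(\<lambda>k. ?h l powr (e k - 1)) \<longlonglongrightarrow> ?h l powr (0 - 1)"
      using h e(2) by (intro tendsto_intros) auto
    also have "?h l powr (0 - 1) = 1 / ?h l"
      using h by (simp add: powr_minus_divide)
    finally have "(\<lambda>k. ennreal (damped l * pot_deriv l * ?h l powr (e k - 1))) \<longlonglongrightarrow> ennreal (damped l * pot_deriv l * (1 / ?h l))"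
      by (intro tendsto_ennrealI tendsto_mult_left)
    moreover have "0 \<le> damped l * pot_deriv l"
      using damped_nonneg pot_deriv_nonneg[OF l] by simp
    ultimately have "(\<lambda>k. ennreal (damped l * pot_deriv l) * ennreal (?h l powr (e k - 1))) \<longlonglongrightarrow> ennreal (damped l * pot_deriv l) * ennreal (1 / ?h l)"
      by (simp only: ennreal_mult')
    from lim_imp_Liminf[OF _ this]
    show "ennreal (damped l * pot_deriv l) * ennreal (1 / ?h l) = liminf (\<lambda>k. ennreal (damped l * pot_deriv l) * ennreal (?h l powr (e k - 1)))"
      by simp
  qed
  also have "\<dots> \<le> liminf I"
    unfolding I_def by (rule nn_integral_liminf) measurable
  also have "\<dots> \<le> liminf (\<lambda>k. ennreal (t k / ?n))"
    using I_le by (intro Liminf_mono) auto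
  also have "\<dots> = ennreal B"
    by (rule lim_imp_Liminf[OF _ t_lim]) simp
  finally show ?thesis
    by (simp add: B_def)
qed

text \<open>The mean value inequality on the whole ball, after moving \<open>z\<close> to its
  centre. The weighted mean of the transported potential is at most \<open>pot z\<close>, so the
  factor 1 + \<psi>(0) minus the mean is at least 1. Changing variables back turns the weight h^n
  into the kernel of \<open>pot_deriv\<close> divided by h(l).\<close>

lemma damped_le_kernel_mean:
  assumes z: "norm z \<le> R"
  shows "ennreal (weight_const TYPE('n) * damped z) \<le>
    (\<integral>\<^sup>+l. ennreal (damped l * (herm_kernel l z ^ CARD('n) * (1 - (norm (ball_moebius l z))^2)) / (1 - (norm l)^2)) \<partial>unif_ball)"
proof -
  let ?n = "CARD('n)" and ?h = "\<lambda>x :: complex ^ 'n. 1 - (norm x)^2" and ?c = "weight_const TYPE('n)"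
  let ?N = "\<lambda>y. cmod (1 - herm y z)"
  have z1: "norm z < 1" using z R by simp
  have hz: "0 < ?h z" by (rule one_minus_norm_pos[OF z1])
  have c: "0 < ?c" by (rule weight_const_pos)
  have mb: "norm (ball_moebius z y) < 1" if "norm y < 1" for y
    by (rule norm_moebius_less_1[OF z1 that])
  have nz: "1 - herm y z \<noteq> 0" if "norm y < 1" for y
    using one_minus_herm_nonzero[of y z] that z1 by simp
  \<comment> \<open>The holomorphic factor is 1 at the centre. Its squared modulus completes h(y)^n
    to a power of h at the image point, since h(y) / |1 - <y,z>|^2 = h(l) / h(z) for
    \<open>l = ball_moebius z y\<close>.\<close>
  let ?F = "\<lambda>y. f (ball_moebius z y) / (1 - herm y z) ^ ?n" and ?p = "\<lambda>y. pot (ball_moebius z y)"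
  obtain K where K: "K \<ge> 0" "\<And>x. norm x \<le> 1 \<Longrightarrow> cmod (f x) \<le> K" using f_bounded by auto
  have RN: "(1 - R) ^ ?n \<le> ?N y ^ ?n" if y: "norm y < 1" for y
  proof (intro power_mono)
    have "cmod (herm y z) \<le> R"
      using cmod_herm_le[of y z] mult_mono[of "norm y" 1 "norm z" R] y z by simp
    then show "1 - R \<le> ?N y"
      using norm_triangle_ineq2[of 1 "herm y z"] by simp
  qed (use R in simp)
  have Fb: "cmod (?F y) \<le> K / (1 - R) ^ ?n" if y: "norm y < 1" for y
    unfolding norm_divide norm_power
    using K(2)[OF less_imp_le[OF mb[OF y]]] RN[OF y] R K(1) by (intro frac_le) auto
  have cm: "continuous_on (ball 0 1) (ball_moebius z)" by (rule continuous_on_moebius[OF z1])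
  have circ: "(cmod (?F 0))^2 * exp (- ?p 0) * (1 + ?p 0 - (LINT x|weighted_ball. ?p x)) \<le>
     (LINT x|weighted_ball. (cmod (?F x))^2 * exp (- ?p x))"
  proof (rule circular_mean_exp_weight[where K="K / (1 - R) ^ ?n + pot_max"])
    show "prob_space (weighted_ball :: (complex ^ 'n) measure)" by (rule prob_space_weighted_ball)
    show "distr weighted_ball borel (\<lambda>x. cis t *s x) = (weighted_ball :: (complex ^ 'n) measure)" for t
      by (rule weighted_ball_rotation)
    show "AE x :: complex ^ 'n in weighted_ball. norm x < 1" by (rule AE_weighted_ball)
    show "continuous_on (ball 0 1) ?F"
      using nz by (intro continuous_intros continuous_on_compose2[OF cont_f cm]) auto
    show "continuous_on (ball 0 1) ?p"
      by (rule continuous_on_compose2[OF continuous_on_pot cm]) (use mb in auto)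
    show "slice_holomorphic ?F"
      unfolding slice_holomorphic_def
    proof (intro allI impI)
      fix x :: "complex ^ 'n" assume x: "norm x < 1"
      have "(\<lambda>c. f (ball_moebius z (c *s x))) holomorphic_on {c. norm (c *s x) < 1}"
        using slice_f[OF z1] x unfolding slice_holomorphic_def by blast
      then show "(\<lambda>c. f (ball_moebius z (c *s x)) / (1 - herm (c *s x) z) ^ ?n) holomorphic_on {c. norm (c *s x) < 1}"
        using nz unfolding herm_smult_left by (intro holomorphic_intros) (auto simp: herm_smult_left[symmetric])
    qed
    show "cmod (?F x) \<le> K / (1 - R) ^ ?n + pot_max" if "norm x < 1" for x
      using Fb[OF that] pot_nonneg[OF mb[OF that]] pot_le[OF mb[OF that]] by linarith
    show "\<bar>?p x\<bar> \<le> K / (1 - R) ^ ?n + pot_max" if "norm x < 1" for x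
    proof -
      have "0 \<le> K / (1 - R) ^ ?n" using K(1) R by simp
      then show ?thesis
        using pot_nonneg[OF mb[OF that]] pot_le[OF mb[OF that]] by linarith
    qed
  qed simp_all
  have "(LINT x|unif_ball. pot (ball_moebius z (1 *\<^sub>R x)) * ?h x ^ ?n) \<le> (LINT w|\<nu>. herm_kernel z w ^ ?n * ?c)"
  proof (rule nn_integral_pot_mean[OF z1])
    show "integrable \<nu> (\<lambda>w. herm_kernel z w ^ ?n * ?c)"
      using integrable_kernel[OF z1] by simp
    show "0 \<le> ?h x ^ ?n" if "norm x < 1" for x
      using one_minus_norm_pos[OF that] by simp
    show "0 \<le> ?c" using c by simp
    fix w :: "complex ^ 'n" assume "norm w \<le> R"
    then have "norm (ball_moebius z w) < 1" using R by (intro norm_moebius_less_1[OF z1]) simp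
    from weighted_mean_kernel_le[OF this]
    show "(\<integral>\<^sup>+x. ennreal (herm_kernel (1 *\<^sub>R x) (ball_moebius z w) ^ ?n * ?h x ^ ?n) \<partial>unif_ball) \<le> ennreal ?c"
      by (simp add: weight_const_def)
  qed simp_all
  also have "\<dots> = ?c * pot z"
    by (simp add: pot_def)
  finally have "(LINT x|weighted_ball. ?p x) \<le> pot z"
    using c by (subst integral_weighted_ball) (auto simp: field_simps)
  then have "damped z * 1 \<le> damped z * (1 + pot z - (LINT x|weighted_ball. ?p x))"
    by (intro mult_left_mono damped_nonneg) simp
  also have "\<dots> \<le> (LINT x|weighted_ball. (cmod (?F x))^2 * exp (- ?p x))"
    using circ by (simp add: damped_def)
  also have "\<dots> = (LINT x|unif_ball. (cmod (?F x))^2 * exp (- ?p x) * ?h x ^ ?n) / ?c"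
    by (rule integral_weighted_ball) measurable
  finally have "?c * damped z \<le> (LINT x|unif_ball. (cmod (?F x))^2 * exp (- ?p x) * ?h x ^ ?n)"
    using c by (simp add: field_simps)
  then have "ennreal (?c * damped z) \<le> ennreal (LINT x|unif_ball. (cmod (?F x))^2 * exp (- ?p x) * ?h x ^ ?n)"
    by (rule ennreal_leI)
  also have "\<dots> = (\<integral>\<^sup>+x. ennreal ((cmod (?F x))^2 * exp (- ?p x) * ?h x ^ ?n) \<partial>unif_ball)"
  proof (rule nn_integral_eq_integral[symmetric])
    show "integrable unif_ball (\<lambda>x. (cmod (?F x))^2 * exp (- ?p x) * ?h x ^ ?n)"
    proof (rule integrable_unif_ball_bounded[where K="(K / (1 - R) ^ ?n)^2 * 1 * 1"])
      fix x :: "complex ^ 'n" assume x: "norm x < 1"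
      have "0 \<le> ?h x" "?h x \<le> 1" using one_minus_norm_pos[OF x] by auto
      then have "(cmod (?F x))^2 * exp (- ?p x) * ?h x ^ ?n \<le> (K / (1 - R) ^ ?n)^2 * 1 * 1"
        using Fb[OF x] pot_nonneg[OF mb[OF x]] by (intro mult_mono power_mono power_le_one) auto
      then show "\<bar>(cmod (?F x))^2 * exp (- ?p x) * ?h x ^ ?n\<bar> \<le> (K / (1 - R) ^ ?n)^2 * 1 * 1"
        using \<open>0 \<le> ?h x\<close> by simp
    qed measurable
    show "AE x in unif_ball. 0 \<le> (cmod (?F x))^2 * exp (- ?p x) * ?h x ^ ?n"
      by (intro eventually_mono[OF AE_unif_ball]) (simp add: power_le_one)
  qed
  \<comment> \<open>With \<open>l = ball_moebius z y\<close> the kernel at \<open>(l, z)\<close>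
    equals h(y) / h(z). The powers are arranged so that the integrand is the invariant density in
    \<open>y\<close> times a function of \<open>l\<close>; the invariance of the measure then
    replaces \<open>l\<close> by the integration variable.\<close>
  also have "\<dots> = (\<integral>\<^sup>+y. ennreal (1 / ?h y ^ (?n + 1)) * (\<lambda>l. ennreal (?h l ^ (?n + 1)) *
      ennreal (damped l * (herm_kernel l z ^ ?n * (herm_kernel l z * ?h z)) / ?h l)) (ball_moebius z y) \<partial>unif_ball)"
  proof (intro nn_integral_cong_AE eventually_mono[OF AE_unif_ball])
    fix y :: "complex ^ 'n" assume y: "norm y < 1"
    let ?l = "ball_moebius z y"
    have hy: "0 < ?h y" and hl: "0 < ?h ?l" by (rule one_minus_norm_pos[OF y], rule one_minus_norm_pos[OF mb[OF y]])
    have N: "0 < ?N y" using nz[OF y] by simp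
    have k: "herm_kernel ?l z = ?h y / ?h z" by (rule herm_kernel_moebius_center[OF z1 y])
    have hle: "?h ?l = ?h z * ?h y / (?N y)^2" by (rule one_minus_norm_moebius[OF z1 y])
    have D: "(cmod (?F y))^2 * exp (- ?p y) = damped ?l / ((?N y)^2) ^ ?n"
      unfolding damped_def norm_divide norm_power power_divide by (simp add: power_mult[symmetric] mult.commute)
    have alg: "d / m ^ k * b ^ k = 1 / b ^ (k + 1) * (l ^ (k + 1) * (d * ((b / a) ^ k * (b / a * a)) / l))"
      if "0 < a" "0 < b" "0 < m" "l = a * b / m" for a b d l m :: real and k :: nat
    proof -
      have l: "0 < l" "l * m = a * b" using that by auto
      have "l ^ k * m ^ k = a ^ k * b ^ k"
        unfolding power_mult_distrib[symmetric] l(2) ..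
      then show ?thesis
        using that(1-3) l(1) by (simp add: power_divide power_mult_distrib field_simps)
    qed
    have "(cmod (?F y))^2 * exp (- ?p y) * ?h y ^ ?n =
      1 / ?h y ^ (?n + 1) * (?h ?l ^ (?n + 1) * (damped ?l * (herm_kernel ?l z ^ ?n * (herm_kernel ?l z * ?h z)) / ?h ?l))"
      unfolding D k by (rule alg[OF hz hy _ hle]) (use N in simp)
    then show "ennreal ((cmod (?F y))^2 * exp (- ?p y) * ?h y ^ ?n) =
      ennreal (1 / ?h y ^ (?n + 1)) * (ennreal (?h ?l ^ (?n + 1)) *
      ennreal (damped ?l * (herm_kernel ?l z ^ ?n * (herm_kernel ?l z * ?h z)) / ?h ?l))"
      using hy hl by (simp only: ennreal_mult'[symmetric] zero_le_divide_1_iff zero_le_power less_imp_le)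
  qed
  also have "\<dots> = (\<integral>\<^sup>+y. (\<lambda>l. ennreal (?h l ^ (?n + 1)) *
      ennreal (damped l * (herm_kernel l z ^ ?n * (herm_kernel l z * ?h z)) / ?h l)) (ball_moebius z y) \<partial>invariant_measure)"
    by (rule nn_integral_tau[symmetric]) measurable
  also have "\<dots> = (\<integral>\<^sup>+l. ennreal (?h l ^ (?n + 1)) *
      ennreal (damped l * (herm_kernel l z ^ ?n * (herm_kernel l z * ?h z)) / ?h l) \<partial>invariant_measure)"
    by (rule nn_integral_tau_moebius[OF z1]) measurable
  also have "\<dots> = (\<integral>\<^sup>+l. ennreal (damped l * (herm_kernel l z ^ ?n * (herm_kernel l z * ?h z)) / ?h l) \<partial>unif_ball)"
    by (rule nn_integral_tau_cancel) measurable
  also have "\<dots> = (\<integral>\<^sup>+l. ennreal (damped l * (herm_kernel l z ^ ?n * (1 - (norm (ball_moebius l z))^2)) / ?h l) \<partial>unif_ball)"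
    by (intro nn_integral_cong_AE eventually_mono[OF AE_unif_ball]) (simp add: herm_kernel_moebius_norm z1)
  finally show ?thesis .
qed

text \<open>Integrating \<open>damped_le_kernel_mean\<close> against \<open>\<nu>\<close> and
  exchanging the integrals, the inner integral over \<open>z\<close> is exactly
  \<open>pot_deriv l\<close>, and \<open>damped_derivative_integral_le\<close> bounds what is
  left.\<close>

theorem damped_embedding:
  "ennreal (weight_const TYPE('n)) * (\<integral>\<^sup>+z. ennreal (damped z) \<partial>\<nu>) \<le>
    ennreal (LINT x|unif_ball. (cmod (f (sgn x)))^2)"
proof -
  interpret U: prob_space "unif_ball :: (complex ^ 'n) measure" by (rule prob_space_unif_ball)
  interpret pair_sigma_finite "unif_ball :: (complex ^ 'n) measure" \<nu> ..
  let ?h = "\<lambda>x :: complex ^ 'n. 1 - (norm x)^2"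
  let ?k = "\<lambda>l z. herm_kernel l z ^ CARD('n) * (1 - (norm (ball_moebius l z))^2)"
  have "ennreal (weight_const TYPE('n)) * (\<integral>\<^sup>+z. ennreal (damped z) \<partial>\<nu>) =
      (\<integral>\<^sup>+z. ennreal (weight_const TYPE('n) * damped z) \<partial>\<nu>)"
    using weight_const_pos[where 'n='n]
    by (subst nn_integral_cmult[symmetric]) (auto simp: ennreal_mult')
  also have "\<dots> \<le> (\<integral>\<^sup>+z. (\<integral>\<^sup>+l. ennreal (damped l * ?k l z / ?h l) \<partial>unif_ball) \<partial>\<nu>)"
    by (intro nn_integral_mono_AE eventually_mono[OF nu_ball] damped_le_kernel_mean)
  also have "\<dots> = (\<integral>\<^sup>+l. (\<integral>\<^sup>+z. ennreal (damped l * ?k l z / ?h l) \<partial>\<nu>) \<partial>unif_ball)"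
    by (rule Fubini') measurable
  also have "\<dots> = (\<integral>\<^sup>+l. ennreal (damped l * pot_deriv l) * ennreal (1 / ?h l) \<partial>unif_ball)"
  proof (intro nn_integral_cong_AE eventually_mono[OF AE_unif_ball])
    fix l :: "complex ^ 'n" assume l: "norm l < 1"
    have h: "0 < ?h l" by (rule one_minus_norm_pos[OF l])
    have "(\<integral>\<^sup>+z. ennreal (damped l * ?k l z / ?h l) \<partial>\<nu>) = (\<integral>\<^sup>+z. ennreal (damped l / ?h l) * ennreal (?k l z) \<partial>\<nu>)"
      using h damped_nonneg[of l] by (intro nn_integral_cong) (simp add: ennreal_mult'[symmetric])
    also have "\<dots> = ennreal (damped l / ?h l) * (\<integral>\<^sup>+z. ennreal (?k l z) \<partial>\<nu>)"
      by (rule nn_integral_cmult) measurable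
    also have "(\<integral>\<^sup>+z. ennreal (?k l z) \<partial>\<nu>) = ennreal (pot_deriv l)"
      unfolding pot_deriv_def
    proof (intro nn_integral_eq_integral integrable_kernel_deriv[OF l] eventually_mono[OF nu_ball])
      fix z :: "complex ^ 'n" assume z: "norm z \<le> R"
      then have "norm z < 1" using R by simp
      then show "0 \<le> ?k l z"
        using kernel_power_bounds(1)[OF l z] one_minus_norm_moebius_bounds(1)[OF l] by (intro mult_nonneg_nonneg)
    qed
    also have "ennreal (damped l / ?h l) * ennreal (pot_deriv l) = ennreal (damped l * pot_deriv l) * ennreal (1 / ?h l)"
      using h damped_nonneg[of l] pot_deriv_nonneg[OF l] by (simp add: ennreal_mult'[symmetric])
    finally show "(\<integral>\<^sup>+z. ennreal (damped l * ?k l z / ?h l) \<partial>\<nu>) = ennreal (damped l * pot_deriv l) * ennreal (1 / ?h l)" .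
  qed
  also have "\<dots> \<le> ennreal (LINT x|unif_ball. (cmod (f (sgn x)))^2)"
    by (rule damped_derivative_integral_le)
  finally show ?thesis .
qed

end

section \<open>The Hardy space\<close>

lemma holomorphic_polynomial_continuous:
  assumes "p \<in> holomorphic_polynomials"
  shows "continuous_on S p"
proof -
  obtain A c where "p = (\<lambda>z. \<Sum>\<alpha>\<in>A. c \<alpha> * (\<Prod>i\<in>UNIV. (z $ i) ^ \<alpha> i))"
    using assms unfolding holomorphic_polynomials_def by blast
  then show ?thesis
    by (auto intro!: continuous_intros)
qed

text \<open>Along a complex line through the origin each coordinate of the automorphism is an affine
  function of the parameter divided by 1 - t <x,l>, which has no zero where t x lies in the
  ball.\<close>

lemma holomorphic_polynomial_slice:
  fixes p :: "complex ^ 'n::finite \<Rightarrow> complex"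
  assumes "p \<in> holomorphic_polynomials" and l: "norm l < 1"
  shows "slice_holomorphic (\<lambda>y. p (ball_moebius l y))"
  unfolding slice_holomorphic_def
proof (intro allI impI)
  fix x :: "complex ^ 'n" assume "norm x < 1"
  let ?S = "{c. norm (c *s x) < 1}"
  obtain A c where p: "p = (\<lambda>z. \<Sum>\<alpha>\<in>A. c \<alpha> * (\<Prod>i\<in>UNIV. (z $ i) ^ \<alpha> i))"
    using assms(1) unfolding holomorphic_polynomials_def by blast
  have nz: "1 - t * herm x l \<noteq> 0" if "t \<in> ?S" for t
    using one_minus_herm_nonzero[of "t *s x" l] that l by (simp add: herm_smult_left)
  have "(\<lambda>t. ball_moebius l (t *s x) $ i) holomorphic_on ?S" for i
  proof -
    let ?r = "of_real (sqrt (1 - (norm l)^2)) :: complex"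
    have "(\<lambda>t. inverse (1 - t * d) * (a - t * b)) holomorphic_on ?S"
      if "d = herm x l" for a b d
      unfolding that by (intro holomorphic_intros) (use nz in blast)
    moreover have "ball_moebius l (t *s x) $ i = inverse (1 - t * herm x l) *
        (l $ i - t * (?r * x $ i + herm x l / of_real (1 + sqrt (1 - (norm l)^2)) * l $ i))" for t
      unfolding ball_moebius_def herm_smult_left vector_smult_component vector_minus_component
      by (simp add: distrib_left)
    ultimately show ?thesis by simp
  qed
  then show "(\<lambda>t. p (ball_moebius l (t *s x))) holomorphic_on ?S"
    unfolding p by (intro holomorphic_on_sum holomorphic_on_mult holomorphic_on_const
        holomorphic_on_prod holomorphic_on_power)
qed

lemma hardy_kernel_herm_kernel:
  fixes w z :: "complex ^ 'n::finite"
  assumes w: "norm w < 1"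
  shows "(cmod (hardy_kernel w z))^2 = herm_kernel w z ^ CARD('n)"
proof -
  let ?h = "1 - (norm w)^2"
  have h: "0 < ?h" by (rule one_minus_norm_pos[OF w])
  have "(?h powr (real CARD('n) / 2))^2 = ?h ^ CARD('n)"
    using h by (simp add: powr_realpow[symmetric] powr_powr)
  then show ?thesis
    unfolding hardy_kernel_def herm_kernel_def norm_divide norm_power norm_of_real power_divide
    by (simp add: cmod_one_minus_herm_commute[of w z] power_mult[symmetric] mult.commute)
qed

text \<open>The complement of the support is a union of open sets meeting the space in null sets,
  and by Lindelof countably many of them suffice.\<close>

lemma AE_closed_support:
  fixes M :: "'a::second_countable_topology measure"
  assumes sets: "sets M = sets (restrict_space borel S)"
  shows "AE x in M. x \<in> closed_support M"
proof -
  have space: "space M = S"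
    using sets_eq_imp_space_eq[OF sets] by (simp add: space_restrict_space)
  define \<F> where "\<F> = {U. open U \<and> emeasure M (U \<inter> space M) = 0}"
  obtain \<F>' where F': "\<F>' \<subseteq> \<F>" "countable \<F>'" "\<Union>\<F>' = \<Union>\<F>"
    by (rule Lindelof[of \<F>]) (simp_all add: \<F>_def)
  have "U \<inter> space M \<in> null_sets M" if "U \<in> \<F>'" for U
  proof -
    have "open U" "emeasure M (U \<inter> S) = 0"
      using that F'(1) space unfolding \<F>_def by auto
    moreover from this have "S \<inter> U \<in> sets M"
      unfolding sets sets_restrict_space by (intro imageI borel_open)
    ultimately show ?thesis
      by (simp add: space null_sets_def Int_commute[of U S])
  qed
  then have "(\<Union>U\<in>\<F>'. U \<inter> space M) \<in> null_sets M"
    using F'(2) by (intro null_sets_UN') auto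
  moreover have "{x \<in> space M. x \<notin> closed_support M} \<subseteq> (\<Union>U\<in>\<F>'. U \<inter> space M)"
  proof
    fix x assume x: "x \<in> {x \<in> space M. x \<notin> closed_support M}"
    then obtain U where "open U" "x \<in> U" "emeasure M (U \<inter> space M) = 0"
      unfolding closed_support_def by auto
    then have "x \<in> \<Union>\<F>'" unfolding F'(3) by (auto simp: \<F>_def)
    then show "x \<in> (\<Union>U\<in>\<F>'. U \<inter> space M)" using x by auto
  qed
  ultimately show ?thesis by (rule AE_I')
qed

lemma integral_sphere_measure:
  fixes g :: "complex ^ 'n::finite \<Rightarrow> real"
  assumes [measurable]: "g \<in> borel_measurable borel"
  shows "(LINT x|sphere_measure. g x) = (LINT x|unif_ball. g (sgn x))"
proof -
  have [measurable]: "Measurable.pred borel (\<lambda>x :: complex ^ 'n. x \<in> sphere 0 1)"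
    by (rule pred_sets2[OF borel_closed[OF closed_sphere]]) simp_all
  have "(LINT x|sphere_measure. g x) = (LINT x|distr unif_ball borel sgn. indicator (sphere 0 1) x *\<^sub>R g x)"
    unfolding sphere_measure_def unif_ball_def[symmetric] by (rule integral_restrict_space) simp
  also have "\<dots> = (LINT x|unif_ball. indicator (sphere 0 1) (sgn x) *\<^sub>R g (sgn x))"
    by (rule integral_distr) measurable
  also have "\<dots> = (LINT x|unif_ball. g (sgn x))"
  proof (rule integral_cong_AE)
    \<comment> \<open>Only the origin has its \<open>sgn\<close> off the sphere.\<close>
    have "AE x::complex ^ 'n in unif_ball. x \<noteq> 0"
      unfolding unif_ball_def using AE_lborel_singleton[of "0 :: complex ^ 'n"]
      by (intro AE_uniform_measureI) auto
    then show "AE x in unif_ball. indicator (sphere 0 1) (sgn x) *\<^sub>R g (sgn x) = g (sgn x)"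
      by eventually_elim (simp add: indicator_def norm_sgn)
  qed measurable
  finally show ?thesis .
qed

text \<open>Here t = 1 / c, and \<open>\<nu>\<close> is t \<mu> cut to the closed ball of radius
  \<open>R\<close>. Cutting only decreases the potential, so the hypothesis still gives
  \<open>pot \<le> 1\<close> on the support of the full measure \<mu>. As \<mu>-almost every point
  lies there, |p|^2 is at most e times \<open>damped\<close>, almost everywhere.\<close>

lemma polynomial_embedding_truncated:
  fixes \<mu> :: "(complex ^ 'n::finite) measure" and c t :: real
  assumes sets: "sets \<mu> = sets (restrict_space borel (ball 0 1))" and fin: "finite_measure \<mu>"
    and bound: "\<And>w. w \<in> closed_support \<mu> \<Longrightarrow> (\<integral>\<^sup>+z. ennreal ((cmod (hardy_kernel w z))^2) \<partial>\<mu>) \<le> ennreal c"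
    and c: "0 < c" and R: "R < 1" and p: "p \<in> holomorphic_polynomials"
  shows "(\<integral>\<^sup>+z. indicator (cball 0 R) z * ennreal ((cmod (p z))^2) \<partial>\<mu>) \<le>
    ennreal (exp 1 * fact (2 * CARD('n)) / (fact CARD('n))^2 * c * (L2_sphere_norm p)^2)"
proof -
  have space: "space \<mu> = ball 0 1"
    using sets_eq_imp_space_eq[OF sets] by (simp add: space_restrict_space)
  have id: "(\<lambda>z. z) \<in> measurable \<mu> borel"
    unfolding measurable_cong_sets[OF sets refl] by (rule measurable_restrict_space1) simp
  have meas: "g \<in> borel_measurable \<mu>" if "g \<in> borel_measurable borel" for g :: "complex ^ 'n \<Rightarrow> ennreal"
    using measurable_compose[OF id that] .
  define t where "t = 1 / c"
  have t: "0 < t" using c by (simp add: t_def)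
  define \<nu> where "\<nu> = density (distr \<mu> borel (\<lambda>z. z)) (\<lambda>z. ennreal t * indicator (cball 0 R) z)"
  have [measurable]: "(\<lambda>z :: complex ^ 'n. ennreal t * indicator (cball 0 R) z) \<in> borel_measurable borel"
    by (intro borel_measurable_times_ennreal borel_measurable_indicator) auto
  have nu: "(\<integral>\<^sup>+z. g z \<partial>\<nu>) = ennreal t * (\<integral>\<^sup>+z. indicator (cball 0 R) z * g z \<partial>\<mu>)"
    if [measurable]: "g \<in> borel_measurable borel" for g
  proof -
    have [measurable]: "(\<lambda>z :: complex ^ 'n. indicator (cball 0 R) z * g z) \<in> borel_measurable borel"
      by (intro borel_measurable_times_ennreal borel_measurable_indicator that) auto
    have "(\<integral>\<^sup>+z. g z \<partial>\<nu>) = (\<integral>\<^sup>+z. (ennreal t * indicator (cball 0 R) z) * g z \<partial>distr \<mu> borel (\<lambda>z. z))"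
      unfolding \<nu>_def by (rule nn_integral_density) simp_all
    also have "\<dots> = (\<integral>\<^sup>+z. ennreal t * (indicator (cball 0 R) z * g z) \<partial>\<mu>)"
      by (subst nn_integral_distr[OF id]) (simp_all add: mult.assoc)
    also have "\<dots> = ennreal t * (\<integral>\<^sup>+z. indicator (cball 0 R) z * g z \<partial>\<mu>)"
      by (rule nn_integral_cmult) (simp add: meas)
    finally show ?thesis .
  qed
  have p_meas [measurable]: "p \<in> borel_measurable borel"
    by (intro borel_measurable_continuous_onI holomorphic_polynomial_continuous p)
  have "finite_measure \<nu>"
  proof (rule finite_measureI)
    have "emeasure \<nu> (space \<nu>) = (\<integral>\<^sup>+z. 1 \<partial>\<nu>)" by simp
    also have "\<dots> \<le> ennreal t * (\<integral>\<^sup>+z. 1 \<partial>\<mu>)"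
      unfolding nu[OF borel_measurable_const]
      by (intro mult_left_mono nn_integral_mono) (simp_all split: split_indicator)
    also have "\<dots> < \<infinity>"
      using finite_measure.emeasure_finite[OF fin, of "space \<mu>"] by (simp add: ennreal_mult_less_top less_top)
    finally show "emeasure \<nu> (space \<nu>) \<noteq> \<infinity>" by simp
  qed
  moreover have "AE z in \<nu>. norm z \<le> R"
    unfolding \<nu>_def by (subst AE_density) (auto simp: indicator_def)
  ultimately interpret ball_potential_function \<nu> R p
    by (intro ball_potential_function.intro ball_potential.intro ball_potential_function_axioms.intro
        holomorphic_polynomial_continuous holomorphic_polynomial_slice p R) (simp_all add: \<nu>_def)
  have pot_le_1: "pot z \<le> 1" if z: "z \<in> closed_support \<mu>" for z
  proof -
    have z1: "norm z < 1" using z space by (auto simp: closed_support_def)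
    have "ennreal (pot z) = ennreal t * (\<integral>\<^sup>+w. indicator (cball 0 R) w * ennreal (herm_kernel z w ^ CARD('n)) \<partial>\<mu>)"
      unfolding nn_integral_pot[OF z1] by (rule nu) measurable
    also have "\<dots> \<le> ennreal t * (\<integral>\<^sup>+w. ennreal ((cmod (hardy_kernel z w))^2) \<partial>\<mu>)"
      unfolding hardy_kernel_herm_kernel[OF z1]
      by (intro mult_left_mono nn_integral_mono) (auto simp: indicator_def)
    also have "\<dots> \<le> ennreal t * ennreal c"
      by (intro mult_left_mono bound z) simp
    also have "\<dots> = ennreal 1"
      using c t by (simp add: ennreal_mult'[symmetric] t_def)
    finally show ?thesis by (subst (asm) ennreal_le_iff) auto
  qed
  have "ennreal (exp (- 1)) * (\<integral>\<^sup>+z. indicator (cball 0 R) z * ennreal ((cmod (p z))^2) \<partial>\<mu>) =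
      (\<integral>\<^sup>+z. ennreal (exp (- 1)) * (indicator (cball 0 R) z * ennreal ((cmod (p z))^2)) \<partial>\<mu>)"
    by (rule nn_integral_cmult[symmetric], rule meas, intro borel_measurable_times_ennreal borel_measurable_indicator) auto
  also have "\<dots> \<le> (\<integral>\<^sup>+z. indicator (cball 0 R) z * ennreal (damped z) \<partial>\<mu>)"
  proof (intro nn_integral_mono_AE eventually_mono[OF AE_closed_support[OF sets]])
    fix z assume "z \<in> closed_support \<mu>"
    then have "exp (- 1) \<le> exp (- pot z)"
      using pot_le_1[of z] by simp
    then have "exp (- 1) * (cmod (p z))^2 \<le> damped z"
      unfolding damped_def mult.commute[of "(cmod (p z))^2"] by (intro mult_right_mono) auto
    then show "ennreal (exp (- 1)) * (indicator (cball 0 R) z * ennreal ((cmod (p z))^2)) \<le> indicator (cball 0 R) z * ennreal (damped z)"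
      by (auto simp: indicator_def ennreal_mult'[symmetric] intro: ennreal_leI)
  qed
  finally have le: "ennreal (exp (- 1)) * (\<integral>\<^sup>+z. indicator (cball 0 R) z * ennreal ((cmod (p z))^2) \<partial>\<mu>) \<le>
      (\<integral>\<^sup>+z. indicator (cball 0 R) z * ennreal (damped z) \<partial>\<mu>)" .
  have norm: "(LINT x|unif_ball. (cmod (p (sgn x)))^2) = (L2_sphere_norm p)^2"
    unfolding L2_sphere_norm_def
    by (subst real_sqrt_pow2) (auto intro!: Bochner_Integration.integral_nonneg integral_sphere_measure[symmetric])
  let ?w = "weight_const TYPE('n)"
  have w: "0 < ?w" by (rule weight_const_pos)
  let ?I = "\<integral>\<^sup>+z. indicator (cball 0 R) z * ennreal ((cmod (p z))^2) \<partial>\<mu>"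
  have "ennreal (?w * t * exp (- 1)) * ?I = ennreal ?w * (ennreal t * (ennreal (exp (- 1)) * ?I))"
    using w t by (simp add: ennreal_mult mult.assoc)
  also have "\<dots> \<le> ennreal ?w * (ennreal t * (\<integral>\<^sup>+z. indicator (cball 0 R) z * ennreal (damped z) \<partial>\<mu>))"
    by (intro mult_left_mono le) auto
  also have "\<dots> = ennreal ?w * (\<integral>\<^sup>+z. ennreal (damped z) \<partial>\<nu>)"
    by (subst nu) auto
  also have "\<dots> \<le> ennreal ((L2_sphere_norm p)^2)"
    using damped_embedding unfolding norm .
  finally have "?I \<le> ennreal ((L2_sphere_norm p)^2 / (?w * t * exp (- 1)))"
    using w t by (intro ennreal_le_divide) auto
  also have "(L2_sphere_norm p)^2 / (?w * t * exp (- 1)) = exp 1 * fact (2 * CARD('n)) / (fact CARD('n))^2 * c * (L2_sphere_norm p)^2"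
    using c by (simp add: weight_const_def t_def exp_minus field_simps)
  finally show ?thesis .
qed

section \<open>From polynomials to the Hardy space\<close>

lemma cmod_power2_le_weighted:
  assumes e: "0 < e"
  shows "(cmod a)^2 \<le> (1 + e) * (cmod b)^2 + (1 + 1 / e) * (cmod (a - b))^2"
proof -
  let ?b = "cmod b" and ?d = "cmod (a - b)"
  have "cmod a \<le> ?b + ?d"
    using norm_triangle_ineq[of b "a - b"] by simp
  then have "(cmod a)^2 \<le> (?b + ?d)^2"
    by (intro power_mono) auto
  also have "\<dots> = ?b^2 + ?d^2 + 2 * (e * ?b) * ?d / e"
    using e by (simp add: power2_sum)
  also have "2 * (e * ?b) * ?d / e \<le> ((e * ?b)^2 + ?d^2) / e"
    using e sum_squares_bound[of "e * ?b" ?d] by (intro divide_right_mono) auto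
  also have "?b^2 + ?d^2 + ((e * ?b)^2 + ?d^2) / e = (1 + e) * ?b^2 + (1 + 1 / e) * ?d^2"
    using e by (simp add: field_simps power2_eq_square)
  finally show ?thesis by simp
qed

text \<open>The weighted inequality for squares, integrated over the sphere, takes the place of the
  triangle inequality in L^2; its loss \<open>e\<close> is sent to 0 afterwards.\<close>

lemma L2_sphere_norm_limit_bound:
  fixes g :: "complex ^ 'n::finite \<Rightarrow> complex"
  assumes g: "g \<in> L2_sphere" and p: "\<And>k. p k \<in> holomorphic_polynomials"
    and lim: "(\<lambda>k. L2_sphere_norm (\<lambda>x. p k x - g x)) \<longlonglongrightarrow> 0" and e: "0 < e"
  shows "\<forall>\<^sub>F k in sequentially. (L2_sphere_norm (p k))^2 \<le> (1 + e) * (L2_sphere_norm g)^2 + e"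
proof -
  interpret S: prob_space "sphere_measure :: (complex ^ 'n) measure" by (rule prob_space_sphere_measure)
  have sq: "(L2_sphere_norm q)^2 = (LINT x|sphere_measure. (cmod (q x))^2)" for q :: "complex ^ 'n \<Rightarrow> complex"
    unfolding L2_sphere_norm_def by (simp add: Bochner_Integration.integral_nonneg)
  have [measurable]: "g \<in> borel_measurable sphere_measure" and int_g: "integrable sphere_measure (\<lambda>x. (cmod (g x))^2)"
    using g by (auto simp: L2_sphere_def)
  have pm [measurable]: "p k \<in> borel_measurable sphere_measure" for k
    unfolding measurable_cong_sets[OF sets_sphere_measure refl]
    by (intro measurable_restrict_space1 borel_measurable_continuous_onI holomorphic_polynomial_continuous p)
  have int_p: "integrable sphere_measure (\<lambda>x. (cmod (p k x))^2)" for k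
  proof -
    have "bounded (p k ` sphere 0 1)"
      by (intro compact_imp_bounded compact_continuous_image holomorphic_polynomial_continuous p) simp
    then obtain K where K: "\<forall>y\<in>p k ` sphere 0 1. norm y \<le> K"
      unfolding bounded_iff by blast
    show ?thesis
      by (rule S.integrable_const_bound[where B="K^2"]) (use K in \<open>auto intro!: AE_I2 power_mono\<close>)
  qed
  have int_d: "integrable sphere_measure (\<lambda>x. (cmod (p k x - g x))^2)" for k
  proof (rule Bochner_Integration.integrable_bound)
    show "integrable sphere_measure (\<lambda>x. 2 * (cmod (p k x))^2 + 2 * (cmod (g x))^2)"
      using int_p int_g by auto
    have "(cmod (p k x - g x))^2 \<le> 2 * (cmod (p k x))^2 + 2 * (cmod (g x))^2" for x
      using cmod_power2_le_weighted[of 1 "p k x - g x" "p k x"] by simp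
    then show "AE x in sphere_measure. norm ((cmod (p k x - g x))^2) \<le> norm (2 * (cmod (p k x))^2 + 2 * (cmod (g x))^2)"
      by (intro AE_I2) simp
  qed measurable
  have "(\<lambda>k. (1 + 1 / e) * (L2_sphere_norm (\<lambda>x. p k x - g x))^2) \<longlonglongrightarrow> (1 + 1 / e) * 0^2"
    by (intro tendsto_intros lim)
  then have "\<forall>\<^sub>F k in sequentially. (1 + 1 / e) * (L2_sphere_norm (\<lambda>x. p k x - g x))^2 < e"
    by (rule order_tendstoD) (use e in simp)
  then show ?thesis
  proof eventually_elim
    case (elim k)
    have "(L2_sphere_norm (p k))^2 \<le> (LINT x|sphere_measure. (1 + e) * (cmod (g x))^2 + (1 + 1 / e) * (cmod (p k x - g x))^2)"
      unfolding sq using int_p int_g int_d cmod_power2_le_weighted[OF e]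
      by (intro integral_mono) auto
    also have "\<dots> = (1 + e) * (L2_sphere_norm g)^2 + (1 + 1 / e) * (L2_sphere_norm (\<lambda>x. p k x - g x))^2"
      unfolding sq using int_g int_d by simp
    finally show ?case using elim by simp
  qed
qed

text \<open>The approximating polynomials and the truncation radii share the index \<open>k\<close>:
  at each point of the ball the truncation is eventually inactive, so one application of Fatou's
  lemma removes both approximations.\<close>

lemma hardy_embedding_finite:
  fixes \<mu> :: "(complex ^ 'n::finite) measure" and c :: real
  assumes sets: "sets \<mu> = sets (restrict_space borel (ball 0 1))" and fin: "finite_measure \<mu>"
    and bound: "\<And>w. w \<in> closed_support \<mu> \<Longrightarrow> (\<integral>\<^sup>+z. ennreal ((cmod (hardy_kernel w z))^2) \<partial>\<mu>) \<le> ennreal c"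
    and c: "0 < c" and g: "g \<in> L2_sphere" and f: "is_hardy_extension g f"
  shows "(\<integral>\<^sup>+z. ennreal ((cmod (f z))^2) \<partial>\<mu>) \<le>
    ennreal (exp 1 * fact (2 * CARD('n)) / (fact CARD('n))^2 * c * (L2_sphere_norm g)^2)"
proof -
  have space: "space \<mu> = ball 0 1"
    using sets_eq_imp_space_eq[OF sets] by (simp add: space_restrict_space)
  have id: "(\<lambda>z. z) \<in> measurable \<mu> borel"
    unfolding measurable_cong_sets[OF sets refl] by (rule measurable_restrict_space1) simp
  obtain p where p: "\<And>k. p k \<in> holomorphic_polynomials"
    and pg: "(\<lambda>k. L2_sphere_norm (\<lambda>x. p k x - g x)) \<longlonglongrightarrow> 0"
    and pf: "\<And>K. compact K \<Longrightarrow> K \<subseteq> ball 0 1 \<Longrightarrow> uniform_limit K p f sequentially"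
    using f unfolding is_hardy_extension_def by blast
  let ?A = "exp 1 * fact (2 * CARD('n)) / (fact CARD('n))^2 * c :: real"
  have A: "0 \<le> ?A" using c by simp
  define R where "R k = 1 - inverse (real (Suc k))" for k
  have R: "R k < 1" "R \<longlonglongrightarrow> 1" for k
  proof -
    show "R k < 1" by (simp add: R_def)
    have "R \<longlonglongrightarrow> 1 - 0" unfolding R_def by (intro tendsto_diff tendsto_const inverse_nat_Suc_props)
    then show "R \<longlonglongrightarrow> 1" by simp
  qed
  define u where "u k z = indicator (cball 0 (R k)) z * ennreal ((cmod (p k z))^2)" for k z
  have u_meas: "u k \<in> borel_measurable \<mu>" for k
  proof -
    have [measurable]: "p k \<in> borel_measurable borel"
      by (intro borel_measurable_continuous_onI holomorphic_polynomial_continuous p)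
    have "u k \<in> borel_measurable borel"
      unfolding u_def by (intro borel_measurable_times_ennreal borel_measurable_indicator) auto
    from measurable_compose[OF id this] show ?thesis .
  qed
  have key: "(\<integral>\<^sup>+z. ennreal ((cmod (f z))^2) \<partial>\<mu>) \<le> ennreal (?A * ((1 + e) * (L2_sphere_norm g)^2 + e))" if e: "0 < e" for e
  proof -
    have "(\<integral>\<^sup>+z. ennreal ((cmod (f z))^2) \<partial>\<mu>) = (\<integral>\<^sup>+z. liminf (\<lambda>k. u k z) \<partial>\<mu>)"
    proof (intro nn_integral_cong)
      fix z assume "z \<in> space \<mu>"
      then have z: "norm z < 1" by (simp add: space)
      have "uniform_limit {z} p f sequentially"
        using z by (intro pf) auto
      then have "(\<lambda>k. p k z) \<longlonglongrightarrow> f z"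
        by (rule tendsto_uniform_limitI) simp
      then have "(\<lambda>k. ennreal ((cmod (p k z))^2)) \<longlonglongrightarrow> ennreal ((cmod (f z))^2)"
        by (intro tendsto_ennrealI tendsto_intros)
      moreover have "\<forall>\<^sub>F k in sequentially. ennreal ((cmod (p k z))^2) = u k z"
        using order_tendstoD(1)[OF R(2) z] by eventually_elim (simp add: u_def)
      ultimately have "(\<lambda>k. u k z) \<longlonglongrightarrow> ennreal ((cmod (f z))^2)"
        by (rule Lim_transform_eventually)
      from lim_imp_Liminf[OF _ this]
      show "ennreal ((cmod (f z))^2) = liminf (\<lambda>k. u k z)" by simp
    qed
    also have "\<dots> \<le> liminf (\<lambda>k. \<integral>\<^sup>+z. u k z \<partial>\<mu>)"
      by (rule nn_integral_liminf[OF u_meas])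
    also have "\<dots> \<le> liminf (\<lambda>k. ennreal (?A * ((1 + e) * (L2_sphere_norm g)^2 + e)))"
    proof (rule Liminf_mono)
      show "\<forall>\<^sub>F k in sequentially. (\<integral>\<^sup>+z. u k z \<partial>\<mu>) \<le> ennreal (?A * ((1 + e) * (L2_sphere_norm g)^2 + e))"
        using L2_sphere_norm_limit_bound[OF g p pg e]
      proof eventually_elim
        case (elim k)
        have "(\<integral>\<^sup>+z. u k z \<partial>\<mu>) \<le> ennreal (?A * (L2_sphere_norm (p k))^2)"
          unfolding u_def by (rule polynomial_embedding_truncated[OF sets fin bound c R(1) p])
        also have "\<dots> \<le> ennreal (?A * ((1 + e) * (L2_sphere_norm g)^2 + e))"
          by (intro ennreal_leI mult_left_mono elim A)
        finally show ?case .
      qed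
    qed
    also have "\<dots> = ennreal (?A * ((1 + e) * (L2_sphere_norm g)^2 + e))"
      by (simp add: Liminf_const)
    finally show ?thesis .
  qed
  have "((\<lambda>e. ennreal (?A * ((1 + e) * (L2_sphere_norm g)^2 + e))) \<longlongrightarrow> ennreal (?A * ((1 + 0) * (L2_sphere_norm g)^2 + 0))) (at_right 0)"
    by (intro tendsto_ennrealI tendsto_intros)
  moreover have "\<forall>\<^sub>F e in at_right 0. (\<integral>\<^sup>+z. ennreal ((cmod (f z))^2) \<partial>\<mu>) \<le> ennreal (?A * ((1 + e) * (L2_sphere_norm g)^2 + e))"
    using eventually_at_right_less[of "0::real"] by eventually_elim (rule key)
  ultimately have "(\<integral>\<^sup>+z. ennreal ((cmod (f z))^2) \<partial>\<mu>) \<le> ennreal (?A * ((1 + 0) * (L2_sphere_norm g)^2 + 0))"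
    by (rule tendsto_lowerbound) simp
  then show ?thesis by simp
qed

theorem theorem0p3:
  fixes \<mu> :: "(complex ^ 'n::finite) measure" and C :: ennreal
  assumes "sets \<mu> = sets (restrict_space borel (ball 0 1))"
    and "(SUP w\<in>closed_support \<mu>. \<integral>\<^sup>+ z. ennreal ((cmod (hardy_kernel w z))^2) \<partial>\<mu>) = C"
    and "C < \<infinity>"
  shows "\<forall>g\<in>hardy_space. \<forall>f. is_hardy_extension g f \<longrightarrow>
    (\<integral>\<^sup>+ z. ennreal ((cmod (f z))^2) \<partial>\<mu>)
      \<le> ennreal (exp 1 * fact (2 * CARD('n)) / (fact CARD('n))^2) * C
          * ennreal ((L2_sphere_norm g)^2)"
proof (intro ballI allI impI)
  fix g f :: "complex ^ 'n \<Rightarrow> complex"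
  assume g: "g \<in> hardy_space" and f: "is_hardy_extension g f"
  have space: "space \<mu> = ball 0 1"
    using sets_eq_imp_space_eq[OF assms(1)] by (simp add: space_restrict_space)
  obtain c where c: "0 \<le> c" "C = ennreal c"
    using assms(3) by (cases C) auto
  have bound: "(\<integral>\<^sup>+z. ennreal ((cmod (hardy_kernel w z))^2) \<partial>\<mu>) \<le> ennreal c" if "w \<in> closed_support \<mu>" for w
    using SUP_upper[OF that, of "\<lambda>w. \<integral>\<^sup>+z. ennreal ((cmod (hardy_kernel w z))^2) \<partial>\<mu>"] assms(2) c(2) by simp
  let ?I = "\<integral>\<^sup>+ z. ennreal ((cmod (f z))^2) \<partial>\<mu>"
  have null: "?I = 0" if "emeasure \<mu> (space \<mu>) = 0"
  proof -
    have "AE z in \<mu>. False"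
      using that by (intro AE_I[of _ _ "space \<mu>"]) auto
    then have "?I = (\<integral>\<^sup>+z. 0 \<partial>\<mu>)"
      by (intro nn_integral_cong_AE) auto
    then show ?thesis by simp
  qed
  show "?I \<le> ennreal (exp 1 * fact (2 * CARD('n)) / (fact CARD('n))^2) * C * ennreal ((L2_sphere_norm g)^2)"
  proof (cases "closed_support \<mu> = {}")
    case True
    \<comment> \<open>Almost every point lies in the support, so an empty support means that \<mu>
      is zero.\<close>
    then have "AE z in \<mu>. False"
      using AE_closed_support[OF assms(1)] by simp
    then have "emeasure \<mu> (space \<mu>) = 0"
      using AE_iff_measurable[of "space \<mu>" \<mu> "\<lambda>_. False"] by auto
    then show ?thesis using null by simp
  next
    case False
    then obtain w where w: "w \<in> closed_support \<mu>" by auto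
    then have w1: "norm w < 1" using space by (auto simp: closed_support_def)
    \<comment> \<open>Since |1 - <w,z>| \<le> 2 on the ball, \<open>q\<close> is a lower bound for
      \<open>herm_kernel w z\<close>. The hypothesis at a single point of the support therefore
      bounds the total mass of \<mu>.\<close>
    define q where "q = (1 - (norm w)^2) / 4"
    have q: "0 < q" using one_minus_norm_pos[OF w1] by (simp add: q_def)
    have "ennreal (q ^ CARD('n)) * emeasure \<mu> (space \<mu>) = (\<integral>\<^sup>+z. ennreal (q ^ CARD('n)) \<partial>\<mu>)"
      by simp
    also have "\<dots> \<le> (\<integral>\<^sup>+z. ennreal ((cmod (hardy_kernel w z))^2) \<partial>\<mu>)"
    proof (intro nn_integral_mono ennreal_leI)
      fix z assume "z \<in> space \<mu>"
      then have z: "norm z < 1" by (simp add: space)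
      have "cmod (1 - herm w z) \<le> 2"
        using norm_triangle_ineq4[of 1 "herm w z"] cmod_herm_lt_1[of w z] w1 z by simp
      then have "(cmod (1 - herm w z))^2 \<le> 4"
        using power_mono[of "cmod (1 - herm w z)" 2 2] by simp
      then have "q \<le> herm_kernel w z"
        unfolding q_def herm_kernel_def using one_minus_norm_pos[OF w1] one_minus_herm_nonzero[of w z] w1 z
        by (intro divide_left_mono) auto
      then show "q ^ CARD('n) \<le> (cmod (hardy_kernel w z))^2"
        unfolding hardy_kernel_herm_kernel[OF w1] using q by (intro power_mono) auto
    qed
    also have "\<dots> \<le> ennreal c" by (rule bound[OF w])
    finally have le: "ennreal (q ^ CARD('n)) * emeasure \<mu> (space \<mu>) \<le> ennreal c" .
    then have m: "emeasure \<mu> (space \<mu>) \<le> ennreal (c / q ^ CARD('n))"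
      using q c by (intro ennreal_le_divide) auto
    show ?thesis
    proof (cases "c = 0")
      case True
      then show ?thesis using m null by simp
    next
      case False
      have "finite_measure \<mu>"
        by (rule finite_measureI) (use m in \<open>auto simp: top_unique\<close>)
      then have "?I \<le> ennreal (exp 1 * fact (2 * CARD('n)) / (fact CARD('n))^2 * c * (L2_sphere_norm g)^2)"
        using g c False by (intro hardy_embedding_finite[OF assms(1) _ bound _ _ f]) (auto simp: hardy_space_def)
      also have "\<dots> = ennreal (exp 1 * fact (2 * CARD('n)) / (fact CARD('n))^2) * C * ennreal ((L2_sphere_norm g)^2)"
        unfolding c(2) using c(1) by (simp add: ennreal_mult'[symmetric])
      finally show ?thesis .
    qed
  qed
qed

end
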